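(* Set $q=n=0$ (so $p+m\ge1$). With $\phi$, $\varphi$ and the Gaudin algebras as defined in the context, $$\phi\big(\mathcal A_d^{\mathbf w,\boldsymbol\xi}(\mathbf z,\boldsymbol\gamma)\big)=\varphi\big(\mathcal A_{m+p}^{\mathbf z,\boldsymbol\gamma}(\mathbf w,\boldsymbol\xi)\big)$$ as subalgebras of the Weyl algebra $\mathcal D$.
   Context: Everything is over $\mathbb C$; $d\ge1$, $p,m\ge0$, $p+m\ge1$. $\mathfrak{gl}_d$ has standard basis $e_{ab}$; $\mathfrak{gl}_{m+p}$ has standard basis $E^i_j$ ($1\le i,j\le p+m$), $[E^i_j,E^k_l]=\delta_{jk}E^i_l-\delta_{il}E^k_j$. **Parameters.** Integers $1\le d'\le d$, $0\le p'\le p$, $0\le m'\le m$; $\ell=p'+m'$; $\mathbf w\in\mathbb C^{d'}$, $\mathbf z\in\mathbb C^\ell$ arbitrary; positive integers $\boldsymbol\xi=(\xi_1,\dots,\xi_{d'})$ with $\sum\xi_a=d$, $\boldsymbol\gamma=(\gamma_1,\dots,\gamma_\ell)$ with $\sum_{i=1}^{p'}\gamma_i=p$, $\sum_{i=1}^{m'}\gamma_{p'+i}=m$; $d_1=0$, $d_{a+1}=\xi_1+\dots+\xi_a$; $l_1=0$, $l_{i+1}=\gamma_1+\dots+\gamma_i$. **Takiff algebras.** For a Lie algebra $\mathfrak g$, put $t_a=t-a$ and $\mathfrak g(a,\gamma)=\mathfrak g[t_a]/t_a^\gamma\mathfrak g[t_a]$; the class of $A\otimes t_a^k$ is $A\otimes\bar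 t_a^{\,k}$. $\mathfrak{gl}_d(\mathbf z,\boldsymbol\gamma)=\bigoplus_{i=1}^\ell\mathfrak{gl}_d(z_i,\gamma_i)$, $\mathfrak{gl}_{m+p}(\mathbf w,\boldsymbol\xi)=\bigoplus_{a=1}^{d'}\mathfrak{gl}_{m+p}(w_a,\xi_a)$ (external direct sums). **Homomorphisms.** $\mathcal F$ is the polynomial algebra in $x^a_i$ ($1\le i\le m$) and $y^a_r$ ($1\le r\le p$), $1\le a\le d$; $\mathcal D$ is its Weyl algebra of polynomial differential operators. The algebra homomorphism $\phi:U(\mathfrak{gl}_d(\mathbf z,\boldsymbol\gamma))\to\mathcal D$ is given by $$e_{ab}\otimes\bar t_{z_i}^{\,k}\mapsto-\sum_{r=l_i+1}^{l_{i+1}-k}y^b_r\partial_{y^a_{r+k}}\ (i\le p',\ 0\le k<\gamma_i),\qquad e_{ab}\otimes\bar t_{z_j}^{\,k}\mapsto\sum_{r=l_j+1-p}^{l_{j+1}-k-p}\partial_{x^b_r}x^a_{r+k}\ (p'<j\le\ell,\ 0\le k<\gamma_j).$$ The algebra homomorphism $\varphi:U(\mathfrak{gl}_{m+p}(\mathbf w,\boldsymbol\xi))\to\mathcal D$ is given, with all sums over $\alpha$ from $d_a+1$ to $d_{a+1}-k$, for $0\le k<\xi_a$, $1\le r,s\le p$, $1\le i,j\le m$, by $E^r_s\otimes\bar t_{w_a}^{\,k}\mapsto-\sum\partial_{y^{\alpha+k}_r}y^\alpha_s$; $E^r_{p+j}\otimes\bar t_{w_a}^{\,k}\mapsto\sum\partial_{y^{\alpha+k}_r}\partial_{x^\alpha_j}$;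 $E^{p+i}_s\otimes\bar t_{w_a}^{\,k}\mapsto-\sum x^{\alpha+k}_iy^\alpha_s$; $E^{p+i}_{p+j}\otimes\bar t_{w_a}^{\,k}\mapsto\sum x^{\alpha+k}_i\partial_{x^\alpha_j}$. **Gaudin algebras.** $\partial_z$ is differentiation with respect to $z$: $\partial_zf=f\partial_z+f'$ for $f$ a series in $z^{-1}$, and $z,\partial_z$ commute with the coefficient algebra; fractions are expanded in $z^{-1}$. $\mathrm{cdet}(A)=\sum_{\sigma\in\mathfrak S_k}(-1)^{l(\sigma)}a_{\sigma(1),1}\cdots a_{\sigma(k),k}$. $\mathrm J_k(\lambda)$ is the $k\times k$ Jordan block with $\lambda$ on the diagonal and $1$ on the superdiagonal; $\mathrm J_{\boldsymbol\xi}(\mathbf w)=\bigoplus_a\mathrm J_{\xi_a}(w_a)$, $\mathrm J_{\boldsymbol\gamma}(\mathbf z)=\bigoplus_i\mathrm J_{\gamma_i}(z_i)$. $\mathcal A_d^{\mathbf w,\boldsymbol\xi}(\mathbf z,\boldsymbol\gamma)\subseteq U(\mathfrak{gl}_d(\mathbf z,\boldsymbol\gamma))$ is generated by all coefficients of the series $a_i(z)$ in $$\mathrm{cdet}\Big[\delta_{ab}\partial_z-\mathrm J_{\boldsymbol\xi}(\mathbf w)_{a,b}-\sum_{i=1}^\ell\sum_{k=0}^{\gamma_i-1}\frac{e_{ab}\otimes\bar t_{z_i}^{\,k}}{(z-z_i)^{k+1}}\Big]_{a,b=1}^d=\partial_z^d+\sum_{i=1}^da_i(z)\partial_z^{i-1}.$$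 $\mathcal A_{m+p}^{\mathbf z,\boldsymbol\gamma}(\mathbf w,\boldsymbol\xi)\subseteq U(\mathfrak{gl}_{m+p}(\mathbf w,\boldsymbol\xi))$ is generated by all coefficients of the series $b_i(z)$ in $$\mathrm{cdet}\Big[\delta_{ij}\partial_z-\mathrm J_{\boldsymbol\gamma}(\mathbf z)_{i,j}-\sum_{a=1}^{d'}\sum_{k=0}^{\xi_a-1}\frac{E^i_j\otimes\bar t_{w_a}^{\,k}}{(z-w_a)^{k+1}}\Big]_{i,j=1}^{p+m}=\partial_z^{p+m}+\sum_{i=0}^{p+m-1}b_i(z)\partial_z^i.$$ *)

theory Defs
  imports
    "HOL-Library.Poly_Mapping"
    "HOL-Library.FuncSet"
    "HOL-Algebra.QuotRing"
    "HOL-Algebra.Module"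
    "HOL-Algebra.Generated_Rings"
    "HOL-Combinatorics.Permutations"
    "HOL-Computational_Algebra.Formal_Power_Series"
    "Jordan_Normal_Form.Jordan_Normal_Form"
begin

section \<open>Complex associative algebras\<close>

text \<open>An associative unital algebra over the complex numbers is a record of type
  \<open>(complex, 'r) module\<close>: a (non-commutative) ring together with scalar multiplication.\<close>

definition generated_subalgebra :: "(complex, 'r) module \<Rightarrow> 'r set \<Rightarrow> 'r set" where
  "generated_subalgebra R S = generate_ring R ({c \<odot>\<^bsub>R\<^esub> \<one>\<^bsub>R\<^esub> | c. True} \<union> S)"


section \<open>Universal enveloping algebras\<close>

record 'g lie_algebra = "'g partial_object" +
  lie_add :: "'g \<Rightarrow> 'g \<Rightarrow> 'g"
  lie_scale :: "complex \<Rightarrow> 'g \<Rightarrow> 'g"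
  lie_bracket :: "'g \<Rightarrow> 'g \<Rightarrow> 'g"

datatype 'g word = Word (letters: "'g list")

instantiation word :: (type) monoid_add
begin
definition zero_word :: "'a word" where "zero_word = Word []"
definition plus_word :: "'a word \<Rightarrow> 'a word \<Rightarrow> 'a word" where
  "plus_word u v = Word (letters u @ letters v)"
instance by standard (simp_all add: zero_word_def plus_word_def)
end

definition letter :: "'g \<Rightarrow> 'g word \<Rightarrow>\<^sub>0 complex" where
  "letter x = Poly_Mapping.single (Word [x]) 1"

text \<open>The free associative algebra on the underlying set of a Lie algebra.  The multiplication of
  \<open>'g word \<Rightarrow>\<^sub>0 complex\<close> is convolution with respect to concatenation of words.\<close>

definition free_algebra :: "'g lie_algebra \<Rightarrow> (complex, 'g word \<Rightarrow>\<^sub>0 complex) module" where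
  "free_algebra L = \<lparr>carrier = {f. \<forall>u\<in>Poly_Mapping.keys f. set (letters u) \<subseteq> carrier L},
     monoid.mult = (*), one = 1, zero = 0, add = (+),
     module.smult = (\<lambda>c f. Poly_Mapping.single 0 c * f)\<rparr>"

text \<open>The first two families turn the free algebra on the set underlying the Lie algebra into the
  tensor algebra of the vector space; the third one gives the enveloping algebra.\<close>

definition enveloping_relations :: "'g lie_algebra \<Rightarrow> ('g word \<Rightarrow>\<^sub>0 complex) set" where
  "enveloping_relations L =
     {letter (lie_add L x y) - (letter x + letter y) | x y. x \<in> carrier L \<and> y \<in> carrier L} \<union>
     {letter (lie_scale L c x) - Poly_Mapping.single 0 c * letter x | c x. x \<in> carrier L} \<union>
     {letter (lie_bracket L x y) - (letter x * letter y - letter y * letter x) | x y.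
        x \<in> carrier L \<and> y \<in> carrier L}"

definition enveloping_ideal :: "'g lie_algebra \<Rightarrow> ('g word \<Rightarrow>\<^sub>0 complex) set" where
  "enveloping_ideal L = Idl\<^bsub>free_algebra L\<^esub> (enveloping_relations L)"

definition U :: "'g lie_algebra \<Rightarrow> (complex, ('g word \<Rightarrow>\<^sub>0 complex) set) module" where
  "U L = ring.extend (free_algebra L Quot enveloping_ideal L)
     (module.fields (\<lambda>c A. \<Union>a\<in>A. enveloping_ideal L +>\<^bsub>free_algebra L\<^esub> (c \<odot>\<^bsub>free_algebra L\<^esub> a)))"

definition U_incl :: "'g lie_algebra \<Rightarrow> 'g \<Rightarrow> ('g word \<Rightarrow>\<^sub>0 complex) set" where
  "U_incl L x = enveloping_ideal L +>\<^bsub>free_algebra L\<^esub> letter x"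

definition free_algebra_eval ::
    "(complex, 'r) module \<Rightarrow> ('g \<Rightarrow> 'r) \<Rightarrow> ('g word \<Rightarrow>\<^sub>0 complex) \<Rightarrow> 'r" where
  "free_algebra_eval R \<rho> f = (\<Oplus>\<^bsub>R\<^esub>u\<in>Poly_Mapping.keys f.
     Poly_Mapping.lookup f u \<odot>\<^bsub>R\<^esub> foldr (\<lambda>x r. \<rho> x \<otimes>\<^bsub>R\<^esub> r) (letters u) \<one>\<^bsub>R\<^esub>)"

text \<open>The algebra homomorphism from the enveloping algebra to \<open>R\<close> that extends a linear map \<open>\<rho>\<close>
  taking Lie brackets to commutators: evaluation is then constant on each coset of the
  enveloping ideal, and this constant is the value of the homomorphism.\<close>

definition U_lift ::
    "(complex, 'r) module \<Rightarrow> ('g \<Rightarrow> 'r) \<Rightarrow> ('g word \<Rightarrow>\<^sub>0 complex) set \<Rightarrow> 'r" where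
  "U_lift R \<rho> A = the_elem (free_algebra_eval R \<rho> ` A)"


section \<open>Takiff algebras\<close>

text \<open>Direct sum over \<open>1 \<le> i \<le> L\<close> of the algebras \<open>gl_N[t_i]/(t_i^\<gamma>_i)\<close>.  An element \<open>A\<close> is the family
  of its components; \<open>A i a b\<close> is the \<open>(a,b)\<close> entry of the \<open>i\<close>-th component, given by the unique
  representative of degree less than \<open>\<gamma> i\<close>.  All polynomials are written in the local variable
  \<open>t_i = t - z_i\<close>, so the points \<open>z_i\<close> do not enter here.\<close>

definition gl_takiff :: "nat \<Rightarrow> nat \<Rightarrow> (nat \<Rightarrow> nat) \<Rightarrow> (nat \<Rightarrow> nat \<Rightarrow> nat \<Rightarrow> complex poly) lie_algebra" where
  "gl_takiff N L \<gamma> =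
     \<lparr>carrier = {A. \<forall>i a b. if i \<in> {1..L} \<and> a \<in> {1..N} \<and> b \<in> {1..N}
                           then Polynomial.degree (A i a b) < \<gamma> i else A i a b = 0},
      lie_add = (\<lambda>A B i a b. A i a b + B i a b),
      lie_scale = (\<lambda>c A i a b. Polynomial.smult c (A i a b)),
      lie_bracket = (\<lambda>A B i a b.
        (\<Sum>c=1..N. A i a c * B i c b - B i a c * A i c b) mod Polynomial.monom 1 (\<gamma> i))\<rparr>"

text \<open>\<open>e_ab\<close> times the \<open>k\<close>-th power of the local variable, in the \<open>i\<close>-th summand\<close>

definition takiff_unit :: "nat \<Rightarrow> nat \<Rightarrow> nat \<Rightarrow> nat \<Rightarrow> nat \<Rightarrow> nat \<Rightarrow> nat \<Rightarrow> complex poly" where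
  "takiff_unit i k a b =
     (\<lambda>i' a' b'. if i' = i \<and> a' = a \<and> b' = b then Polynomial.monom 1 k else 0)"

text \<open>Linear extension of the assignment \<open>takiff_unit i k a b \<mapsto> h i k a b\<close>\<close>

definition takiff_linear :: "(complex, 'r) module \<Rightarrow> nat \<Rightarrow> nat \<Rightarrow> (nat \<Rightarrow> nat) \<Rightarrow>
    (nat \<Rightarrow> nat \<Rightarrow> nat \<Rightarrow> nat \<Rightarrow> 'r) \<Rightarrow> (nat \<Rightarrow> nat \<Rightarrow> nat \<Rightarrow> complex poly) \<Rightarrow> 'r" where
  "takiff_linear R N L \<gamma> h A =
     (\<Oplus>\<^bsub>R\<^esub>i\<in>{1..L}. \<Oplus>\<^bsub>R\<^esub>k\<in>{..<\<gamma> i}. \<Oplus>\<^bsub>R\<^esub>a\<in>{1..N}. \<Oplus>\<^bsub>R\<^esub>b\<in>{1..N}.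
        Polynomial.coeff (A i a b) k \<odot>\<^bsub>R\<^esub> h i k a b)"


section \<open>Weyl algebras\<close>

type_synonym 'v mpol = "('v \<Rightarrow>\<^sub>0 nat) \<Rightarrow>\<^sub>0 complex"

definition polys :: "'v set \<Rightarrow> 'v mpol set" where
  "polys V = {f. \<forall>\<mu>\<in>Poly_Mapping.keys f. Poly_Mapping.keys \<mu> \<subseteq> V}"

definition mpol_deriv :: "'v \<Rightarrow> 'v mpol \<Rightarrow> 'v mpol" where
  "mpol_deriv v f = (\<Sum>\<mu>\<in>Poly_Mapping.keys f.
     Poly_Mapping.single (\<mu> - Poly_Mapping.single v 1)
       (of_nat (Poly_Mapping.lookup \<mu> v) * Poly_Mapping.lookup f \<mu>))"

text \<open>Linear endomorphisms of the polynomial algebra, as functions that are \<open>undefined\<close> off it\<close>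

definition End :: "'v set \<Rightarrow> (complex, 'v mpol \<Rightarrow> 'v mpol) module" where
  "End V =
     \<lparr>carrier = {S \<in> polys V \<rightarrow>\<^sub>E polys V.
                  (\<forall>f\<in>polys V. \<forall>g\<in>polys V. S (f + g) = S f + S g) \<and>
                  (\<forall>c. \<forall>f\<in>polys V. S (Poly_Mapping.single 0 c * f) = Poly_Mapping.single 0 c * S f)},
      monoid.mult = compose (polys V),
      one = (\<lambda>f\<in>polys V. f),
      zero = (\<lambda>f\<in>polys V. 0),
      add = (\<lambda>S T. \<lambda>f\<in>polys V. S f + T f),
      module.smult = (\<lambda>c S. \<lambda>f\<in>polys V. Poly_Mapping.single 0 c * S f)\<rparr>"

definition mul_op :: "'v set \<Rightarrow> 'v \<Rightarrow> 'v mpol \<Rightarrow> 'v mpol" where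
  "mul_op V v = (\<lambda>f\<in>polys V. Poly_Mapping.single (Poly_Mapping.single v 1) 1 * f)"

definition deriv_op :: "'v set \<Rightarrow> 'v \<Rightarrow> 'v mpol \<Rightarrow> 'v mpol" where
  "deriv_op V v = (\<lambda>f\<in>polys V. mpol_deriv v f)"

definition Weyl :: "'v set \<Rightarrow> (complex, 'v mpol \<Rightarrow> 'v mpol) module" where
  "Weyl V = (End V)\<lparr>carrier := generated_subalgebra (End V) (mul_op V ` V \<union> deriv_op V ` V)\<rparr>"


section \<open>Differential operators in \<open>z\<close>\<close>

text \<open>For an algebra \<open>R\<close>, a function \<open>P :: nat \<Rightarrow> nat \<Rightarrow> 'r\<close> with \<open>P i = 0\<close> for almost all \<open>i\<close> stands for
  the sum over \<open>i\<close> and \<open>n\<close> of \<open>P i n z^(-n) \<partial>^i\<close>, with coefficients to the left of \<open>\<partial>\<close>.\<close>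

definition series_mult :: "(complex, 'r) module \<Rightarrow> (nat \<Rightarrow> 'r) \<Rightarrow> (nat \<Rightarrow> 'r) \<Rightarrow> nat \<Rightarrow> 'r" where
  "series_mult R f g n = (\<Oplus>\<^bsub>R\<^esub>k\<in>{..n}. f k \<otimes>\<^bsub>R\<^esub> g (n - k))"

text \<open>The derivative of \<open>z^(-n)\<close> with respect to \<open>z\<close> is \<open>-n z^(-n-1)\<close>.\<close>

definition series_deriv :: "(complex, 'r) module \<Rightarrow> (nat \<Rightarrow> 'r) \<Rightarrow> nat \<Rightarrow> 'r" where
  "series_deriv R f n =
     (case n of 0 \<Rightarrow> \<zero>\<^bsub>R\<^esub> | Suc n' \<Rightarrow> (- of_nat n') \<odot>\<^bsub>R\<^esub> f n')"

text \<open>Left multiplication by \<open>\<partial>\<close>, from \<open>\<partial> f = f \<partial> + f'\<close>\<close>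

definition dz_mult :: "(complex, 'r) module \<Rightarrow> (nat \<Rightarrow> nat \<Rightarrow> 'r) \<Rightarrow> nat \<Rightarrow> nat \<Rightarrow> 'r" where
  "dz_mult R P i n =
     (case i of 0 \<Rightarrow> \<zero>\<^bsub>R\<^esub> | Suc i' \<Rightarrow> P i' n) \<oplus>\<^bsub>R\<^esub> series_deriv R (P i) n"

definition diff_ops :: "(complex, 'r) module \<Rightarrow> (nat \<Rightarrow> nat \<Rightarrow> 'r) ring" where
  "diff_ops R =
     \<lparr>carrier = {P. (\<forall>i n. P i n \<in> carrier R) \<and> finite {i. \<exists>n. P i n \<noteq> \<zero>\<^bsub>R\<^esub>}},
      monoid.mult = (\<lambda>P Q j n. \<Oplus>\<^bsub>R\<^esub>i\<in>{i. \<exists>n. P i n \<noteq> \<zero>\<^bsub>R\<^esub>}. series_mult R (P i) ((dz_mult R ^^ i) Q j) n),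
      one = (\<lambda>i n. if i = 0 \<and> n = 0 then \<one>\<^bsub>R\<^esub> else \<zero>\<^bsub>R\<^esub>),
      zero = (\<lambda>i n. \<zero>\<^bsub>R\<^esub>),
      add = (\<lambda>P Q i n. P i n \<oplus>\<^bsub>R\<^esub> Q i n)\<rparr>"

definition dz :: "(complex, 'r) module \<Rightarrow> nat \<Rightarrow> nat \<Rightarrow> 'r" where
  "dz R = (\<lambda>i n. if i = 1 \<and> n = 0 then \<one>\<^bsub>R\<^esub> else \<zero>\<^bsub>R\<^esub>)"

text \<open>The operator of multiplication by \<open>F(1/z) r\<close>\<close>

definition series_op :: "(complex, 'r) module \<Rightarrow> complex fps \<Rightarrow> 'r \<Rightarrow> nat \<Rightarrow> nat \<Rightarrow> 'r" where
  "series_op R F r = (\<lambda>i n. if i = 0 then fps_nth F n \<odot>\<^bsub>R\<^esub> r else \<zero>\<^bsub>R\<^esub>)"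

text \<open>\<open>1/(z - c) = u/(1 - c u)\<close> as a power series in \<open>u = 1/z\<close>\<close>

definition inv_linear :: "complex \<Rightarrow> complex fps" where
  "inv_linear c = fps_X * inverse (1 - fps_const c * fps_X)"

definition cdet :: "'r ring \<Rightarrow> nat \<Rightarrow> (nat \<Rightarrow> nat \<Rightarrow> 'r) \<Rightarrow> 'r" where
  "cdet R k A = (\<Oplus>\<^bsub>R\<^esub>\<sigma>\<in>{\<sigma>. \<sigma> permutes {1..k}}.
     [sign \<sigma>] \<cdot>\<^bsub>R\<^esub> foldr (\<lambda>j r. A (\<sigma> j) j \<otimes>\<^bsub>R\<^esub> r) [1..<Suc k] \<one>\<^bsub>R\<^esub>)"


section \<open>Gaudin algebras\<close>

text \<open>Rows and columns are numbered from 1 here, but from 0 in matrices of type \<open>mat\<close>.\<close>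

definition jordan :: "nat \<Rightarrow> (nat \<Rightarrow> complex) \<Rightarrow> (nat \<Rightarrow> nat) \<Rightarrow> nat \<Rightarrow> nat \<Rightarrow> complex" where
  "jordan L \<mu> \<xi> a b = jordan_matrix (map (\<lambda>i. (\<xi> i, \<mu> i)) [1..<Suc L]) $$ (a - 1, b - 1)"

definition gaudin_matrix :: "nat \<Rightarrow> (nat \<Rightarrow> nat \<Rightarrow> complex) \<Rightarrow> nat \<Rightarrow> (nat \<Rightarrow> complex) \<Rightarrow> (nat \<Rightarrow> nat) \<Rightarrow>
    nat \<Rightarrow> nat \<Rightarrow> nat \<Rightarrow> nat \<Rightarrow> ((nat \<Rightarrow> nat \<Rightarrow> nat \<Rightarrow> complex poly) word \<Rightarrow>\<^sub>0 complex) set" where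
  "gaudin_matrix N J L z \<gamma> a b =
     (let \<gg> = gl_takiff N L \<gamma>; R = U \<gg>; D = diff_ops R in
       (if a = b then dz R else \<zero>\<^bsub>D\<^esub>)
       \<ominus>\<^bsub>D\<^esub> series_op R (fps_const (J a b)) \<one>\<^bsub>R\<^esub>
       \<ominus>\<^bsub>D\<^esub> (\<Oplus>\<^bsub>D\<^esub>i\<in>{1..L}. \<Oplus>\<^bsub>D\<^esub>k\<in>{..<\<gamma> i}.
              series_op R (inv_linear (z i) ^ (k + 1)) (U_incl \<gg> (takiff_unit i k a b))))"

definition gaudin_algebra :: "nat \<Rightarrow> (nat \<Rightarrow> nat \<Rightarrow> complex) \<Rightarrow> nat \<Rightarrow> (nat \<Rightarrow> complex) \<Rightarrow> (nat \<Rightarrow> nat) \<Rightarrow>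
    ((nat \<Rightarrow> nat \<Rightarrow> nat \<Rightarrow> complex poly) word \<Rightarrow>\<^sub>0 complex) set set" where
  "gaudin_algebra N J L z \<gamma> =
     (let R = U (gl_takiff N L \<gamma>) in
       generated_subalgebra R
         {cdet (diff_ops R) N (gaudin_matrix N J L z \<gamma>) i n | i n. i < N})"


section \<open>The two homomorphisms\<close>

text \<open>\<open>XV a i\<close> and \<open>YV a r\<close> are the variables with upper index \<open>a\<close> and lower index \<open>i\<close> or \<open>r\<close>.\<close>

datatype var = XV nat nat | YV nat nat

definition vars :: "nat \<Rightarrow> nat \<Rightarrow> nat \<Rightarrow> var set" where
  "vars d p m = {XV a i | a i. a \<in> {1..d} \<and> i \<in> {1..m}} \<union> {YV a r | a r. a \<in> {1..d} \<and> r \<in> {1..p}}"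

text \<open>The numbers \<open>d_a\<close> (for \<open>\<xi>\<close>) and \<open>l_i\<close> (for \<open>\<gamma>\<close>): sum of the entries before the given index\<close>

definition offset :: "(nat \<Rightarrow> nat) \<Rightarrow> nat \<Rightarrow> nat" where
  "offset \<xi> a = (\<Sum>b\<in>{1..<a}. \<xi> b)"

definition phi_unit :: "nat \<Rightarrow> nat \<Rightarrow> nat \<Rightarrow> nat \<Rightarrow> (nat \<Rightarrow> nat) \<Rightarrow>
    nat \<Rightarrow> nat \<Rightarrow> nat \<Rightarrow> nat \<Rightarrow> var mpol \<Rightarrow> var mpol" where
  "phi_unit d p m p' \<gamma> i k a b =
     (let V = vars d p m; D = Weyl V in
       if i \<le> p' then
         \<ominus>\<^bsub>D\<^esub> (\<Oplus>\<^bsub>D\<^esub>r\<in>{offset \<gamma> i + 1..offset \<gamma> (i + 1) - k}.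
                mul_op V (YV b r) \<otimes>\<^bsub>D\<^esub> deriv_op V (YV a (r + k)))
       else
         (\<Oplus>\<^bsub>D\<^esub>r\<in>{offset \<gamma> i + 1 - p..offset \<gamma> (i + 1) - k - p}.
                deriv_op V (XV b r) \<otimes>\<^bsub>D\<^esub> mul_op V (XV a (r + k))))"

definition phi :: "nat \<Rightarrow> nat \<Rightarrow> nat \<Rightarrow> nat \<Rightarrow> nat \<Rightarrow> (nat \<Rightarrow> nat) \<Rightarrow>
    ((nat \<Rightarrow> nat \<Rightarrow> nat \<Rightarrow> complex poly) word \<Rightarrow>\<^sub>0 complex) set \<Rightarrow> var mpol \<Rightarrow> var mpol" where
  "phi d p m p' m' \<gamma> =
     (let D = Weyl (vars d p m) in
       U_lift D (takiff_linear D d (p' + m') \<gamma> (phi_unit d p m p' \<gamma>)))"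

text \<open>Here \<open>a\<close> numbers the summand, \<open>k\<close> is the power of the local variable, and \<open>i\<close>, \<open>j\<close> are the upper
  and the lower index of the matrix unit.\<close>

definition varphi_unit :: "nat \<Rightarrow> nat \<Rightarrow> nat \<Rightarrow> (nat \<Rightarrow> nat) \<Rightarrow>
    nat \<Rightarrow> nat \<Rightarrow> nat \<Rightarrow> nat \<Rightarrow> var mpol \<Rightarrow> var mpol" where
  "varphi_unit d p m \<xi> a k i j =
     (let V = vars d p m; D = Weyl V; I = {offset \<xi> a + 1..offset \<xi> (a + 1) - k} in
       if i \<le> p \<and> j \<le> p then
         \<ominus>\<^bsub>D\<^esub> (\<Oplus>\<^bsub>D\<^esub>\<alpha>\<in>I. deriv_op V (YV (\<alpha> + k) i) \<otimes>\<^bsub>D\<^esub> mul_op V (YV \<alpha> j))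
       else if i \<le> p \<and> p < j then
         (\<Oplus>\<^bsub>D\<^esub>\<alpha>\<in>I. deriv_op V (YV (\<alpha> + k) i) \<otimes>\<^bsub>D\<^esub> deriv_op V (XV \<alpha> (j - p)))
       else if p < i \<and> j \<le> p then
         \<ominus>\<^bsub>D\<^esub> (\<Oplus>\<^bsub>D\<^esub>\<alpha>\<in>I. mul_op V (XV (\<alpha> + k) (i - p)) \<otimes>\<^bsub>D\<^esub> mul_op V (YV \<alpha> j))
       else
         (\<Oplus>\<^bsub>D\<^esub>\<alpha>\<in>I. mul_op V (XV (\<alpha> + k) (i - p)) \<otimes>\<^bsub>D\<^esub> deriv_op V (XV \<alpha> (j - p))))"

definition varphi :: "nat \<Rightarrow> nat \<Rightarrow> nat \<Rightarrow> nat \<Rightarrow> (nat \<Rightarrow> nat) \<Rightarrow>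
    ((nat \<Rightarrow> nat \<Rightarrow> nat \<Rightarrow> complex poly) word \<Rightarrow>\<^sub>0 complex) set \<Rightarrow> var mpol \<Rightarrow> var mpol" where
  "varphi d p m d' \<xi> =
     (let D = Weyl (vars d p m) in
       U_lift D (takiff_linear D (p + m) d' \<xi> (varphi_unit d p m \<xi>)))"

end

theory Submission
  imports
    Defs
    "HOL-Computational_Algebra.Formal_Laurent_Series"
    "HOL-Library.Nat_Bijection"
begin

text \<open>
  In terms of Weyl generators with commutator 1, both Gaudin matrices have the shape
  \<open>\<partial> - A - \<Sum> x (z - B)^-1 \<xi>\<close> with Jordan matrices \<open>A\<close>, \<open>B\<close>, where \<open>x\<close> stands left of \<open>\<xi>\<close>
  on the \<open>gl_(m+p)\<close> side and right of it on the \<open>gl_d\<close> side. When a column determinant is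
  expanded, the corrections due to normal ordering cancel between permutations that differ by a
  transposition, so it is the normally ordered form of a commutative determinant. The two commutative
  determinants are, up to the scalar factors \<open>det (t - B)\<close> and \<open>det (s - A)\<close>, the determinant of one
  block matrix with diagonal blocks \<open>s - A\<close> and \<open>t - B^T\<close> (Schur complements), hence their
  coefficients span the same space. The order \<open>\<xi> x\<close> on the \<open>gl_d\<close> side amounts to replacing \<open>\<partial>\<close> by
  \<open>\<partial>\<close> minus the trace of \<open>(z - B)^-1\<close>, which does not change the span.
\<close>

text \<open>The cancellation works because a resolvent satisfies \<open>fps_dz R = - R R\<close>:
  moving \<partial> past an entry and moving \<xi> past x leave the same quadratic expression in
  \<open>R\<close>, with the roles of two rows exchanged. The block determinant is a polynomial in
  two commuting parameters. One side reads the first as \<partial> and the second as z, the other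
  side conversely, so both see the same array of coefficients. Equality of spans is expressed by
  arbitrary linear subspaces of the commutative symbol ring; this fits the goal, since the symbols
  whose quantization lies in a given subalgebra form such a subspace. A different obstacle is that
  the enveloping algebra and the Weyl algebra are rings with explicit carriers, made of cosets and
  of functions that are \<open>undefined\<close> outside a set of polynomials. Calculations
  therefore take place in a type of class \<open>ring_1\<close>, the linear operators on polynomials
  in all variables. The map \<open>hom\<close> leads from the enveloping algebra into it, and
  \<open>restr\<close> leads from it to the Weyl algebra, so the symbolic calculus is free of
  carriers.\<close>

locale central_scalars =
  fixes cs :: "complex \<Rightarrow> 'o::ring_1"
  assumes cs_add: "cs (c + c') = cs c + cs c'"
    and cs_mult: "cs (c * c') = cs c * cs c'"
    and cs_1 [simp]: "cs 1 = 1"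
    and cs_commute: "cs c * x = x * cs c"
begin

lemma cs_0 [simp]: "cs 0 = 0"
  using cs_add[of 0 0] by simp

lemma cs_minus: "cs (- c) = - cs c"
  using cs_add[of c "- c"] by (simp add: eq_neg_iff_add_eq_0 add.commute)

lemma cs_diff: "cs (c - c') = cs c - cs c'"
  using cs_add[of c "- c'"] by (simp add: cs_minus)

lemma cs_sum: "cs (sum f S) = (\<Sum>x\<in>S. cs (f x))"
  by (induction S rule: infinite_finite_induct) (simp_all add: cs_add)

lemma cs_of_nat: "cs (of_nat n) = of_nat n"
  by (induction n) (simp_all add: cs_add)

lemma cs_left_commute: "x * (cs c * y) = cs c * (x * y)"
  by (metis cs_commute mult.assoc)

end

section \<open>Linear maps out of finitely supported functions\<close>

lemma poly_mapping_sum_single: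
  fixes f :: "'k \<Rightarrow>\<^sub>0 'c::comm_monoid_add"
  shows "f = (\<Sum>k\<in>Poly_Mapping.keys f. Poly_Mapping.single k (Poly_Mapping.lookup f k))"
proof (rule poly_mapping_eqI)
  fix k
  show "Poly_Mapping.lookup f k =
      Poly_Mapping.lookup (\<Sum>k\<in>Poly_Mapping.keys f. Poly_Mapping.single k (Poly_Mapping.lookup f k)) k"
    by (simp add: lookup_sum lookup_single when_def in_keys_iff)
qed

lemma poly_mapping_additive_induct [case_names zero single add]:
  fixes f :: "'k \<Rightarrow>\<^sub>0 'c::comm_monoid_add"
  assumes "P 0" and "\<And>k c. P (Poly_Mapping.single k c)"
    and "\<And>f g. P f \<Longrightarrow> P g \<Longrightarrow> P (f + g)"
  shows "P f"
proof -
  have "P (\<Sum>k\<in>S. Poly_Mapping.single k (Poly_Mapping.lookup f k))" if "finite S" for S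
    using that by (induction S rule: finite_induct) (use assms in auto)
  then show ?thesis
    using poly_mapping_sum_single[of f] finite_keys[of f] by metis
qed

text \<open>\<open>B k\<close> takes the coefficient as an argument, so additivity of
  \<open>B k\<close> replaces a module structure on the target. Evaluation in the free algebra,
  partial differentiation and quantization are all instances.\<close>

definition lin_ext :: "('k \<Rightarrow> 'c::zero \<Rightarrow> 'o::comm_monoid_add) \<Rightarrow> ('k \<Rightarrow>\<^sub>0 'c) \<Rightarrow> 'o" where
  "lin_ext B f = (\<Sum>k\<in>Poly_Mapping.keys f. B k (Poly_Mapping.lookup f k))"

lemma lin_ext_superset:
  assumes "finite S" "Poly_Mapping.keys f \<subseteq> S" "\<And>k. B k 0 = 0"
  shows "lin_ext B f = (\<Sum>k\<in>S. B k (Poly_Mapping.lookup f k))"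
  unfolding lin_ext_def
  by (rule sum.mono_neutral_left) (use assms in \<open>auto simp: in_keys_iff\<close>)

lemma lin_ext_0 [simp]: "lin_ext B 0 = 0"
  by (simp add: lin_ext_def)

lemma lin_ext_single:
  assumes "\<And>k. B k 0 = 0"
  shows "lin_ext B (Poly_Mapping.single k c) = B k c"
  using assms by (subst lin_ext_superset[of "{k}"]) (auto simp: lookup_single)

lemma lin_ext_add:
  assumes "\<And>k. B k 0 = 0" "\<And>k c c'. B k (c + c') = B k c + B k c'"
  shows "lin_ext B (f + g) = lin_ext B f + lin_ext B g"
proof -
  let ?S = "Poly_Mapping.keys f \<union> Poly_Mapping.keys g"
  have "lin_ext B h = (\<Sum>k\<in>?S. B k (Poly_Mapping.lookup h k))"
    if "Poly_Mapping.keys h \<subseteq> ?S" for h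
    by (rule lin_ext_superset) (use that assms in auto)
  then show ?thesis
    using keys_add[of f g] by (simp add: lookup_add assms sum.distrib)
qed

lemma lin_ext_uminus:
  fixes B :: "'k \<Rightarrow> 'c::ab_group_add \<Rightarrow> 'o::ab_group_add"
  assumes "\<And>k. B k 0 = 0" "\<And>k c c'. B k (c + c') = B k c + B k c'"
  shows "lin_ext B (- f) = - lin_ext B f"
  using lin_ext_add[of B f "- f"] assms by (simp add: eq_neg_iff_add_eq_0 add.commute)

section \<open>Homomorphisms from enveloping algebras\<close>

lemma free_algebra_simps [simp]:
  "monoid.mult (free_algebra L) = (*)" "one (free_algebra L) = 1"
  "zero (free_algebra L) = 0" "add (free_algebra L) = (+)"
  "module.smult (free_algebra L) = (\<lambda>c f. Poly_Mapping.single 0 c * f)"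
  by (simp_all add: free_algebra_def)

lemma free_algebra_carrier:
  "f \<in> carrier (free_algebra L) \<longleftrightarrow> (\<forall>u\<in>Poly_Mapping.keys f. set (letters u) \<subseteq> carrier L)"
  by (simp add: free_algebra_def)

lemma ring_free_algebra: "ring (free_algebra L)"
proof (rule ringI)
  have add: "f + g \<in> carrier (free_algebra L)"
    if "f \<in> carrier (free_algebra L)" "g \<in> carrier (free_algebra L)" for f g
    using that keys_add[of f g] by (auto simp: free_algebra_carrier)
  show "abelian_group (free_algebra L)"
  proof (rule abelian_groupI)
    show "\<exists>g\<in>carrier (free_algebra L). g \<oplus>\<^bsub>free_algebra L\<^esub> f = \<zero>\<^bsub>free_algebra L\<^esub>"
      if "f \<in> carrier (free_algebra L)" for f
      using that by (intro bexI[of _ "- f"]) (auto simp: free_algebra_carrier)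
  qed (use add in \<open>simp_all add: add.assoc add.commute\<close>, simp_all add: free_algebra_carrier)
  have "f * g \<in> carrier (free_algebra L)"
    if "f \<in> carrier (free_algebra L)" "g \<in> carrier (free_algebra L)" for f g
  proof -
    have "set (letters u) \<subseteq> carrier L" if u: "u \<in> Poly_Mapping.keys (f * g)" for u
    proof -
      obtain a b where "u = a + b" "a \<in> Poly_Mapping.keys f" "b \<in> Poly_Mapping.keys g"
        using u keys_mult[of f g] by blast
      then show ?thesis
        using \<open>f \<in> _\<close> \<open>g \<in> _\<close> by (auto simp: free_algebra_carrier plus_word_def)
    qed
    then show ?thesis by (simp add: free_algebra_carrier)
  qed
  moreover have "1 \<in> carrier (free_algebra L)"
    by (simp add: free_algebra_carrier zero_word_def)
  ultimately show "Group.monoid (free_algebra L)"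
    by (intro monoidI) (simp_all add: mult.assoc)
qed (simp_all add: distrib_left distrib_right)

lemma free_algebra_smult_closed:
  "f \<in> carrier (free_algebra L) \<Longrightarrow> Poly_Mapping.single 0 c * f \<in> carrier (free_algebra L)"
proof -
  assume f: "f \<in> carrier (free_algebra L)"
  have "Poly_Mapping.single 0 c \<in> carrier (free_algebra L)"
    by (auto simp: free_algebra_carrier zero_word_def)
  then show ?thesis
    using monoid.m_closed[OF ring.is_monoid[OF ring_free_algebra], of "Poly_Mapping.single 0 c" L f] f
    by simp
qed

text \<open>Closure under the three operations places the enveloping relations inside the free
  algebra on the carrier, so that the set they generate is an ideal of it.\<close>

locale closed_lie =
  fixes L :: "'g lie_algebra"
  assumes add_closed: "x \<in> carrier L \<Longrightarrow> y \<in> carrier L \<Longrightarrow> lie_add L x y \<in> carrier L"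
    and scale_closed: "x \<in> carrier L \<Longrightarrow> lie_scale L c x \<in> carrier L"
    and bracket_closed: "x \<in> carrier L \<Longrightarrow> y \<in> carrier L \<Longrightarrow> lie_bracket L x y \<in> carrier L"
begin

abbreviation "F \<equiv> free_algebra L"
abbreviation "I \<equiv> enveloping_ideal L"

sublocale F: ring F by (rule ring_free_algebra)

lemma letter_closed: "x \<in> carrier L \<Longrightarrow> letter x \<in> carrier F"
  by (simp add: free_algebra_carrier letter_def)

lemma F_minus: "f \<in> carrier F \<Longrightarrow> g \<in> carrier F \<Longrightarrow> f - g \<in> carrier F"
proof -
  assume fg: "f \<in> carrier F" "g \<in> carrier F"
  then have "- g \<in> carrier F" by (simp add: free_algebra_carrier)
  then show ?thesis using F.a_closed[of f "- g"] fg by simp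
qed

lemma relations_closed: "enveloping_relations L \<subseteq> carrier F"
  unfolding enveloping_relations_def
  by (auto intro!: F_minus F.a_closed[simplified] F.m_closed[simplified] free_algebra_smult_closed
      letter_closed add_closed scale_closed bracket_closed)

sublocale I: ideal I F
  unfolding enveloping_ideal_def by (rule F.genideal_ideal[OF relations_closed])

lemma U_simps:
  "carrier (U L) = carrier (F Quot I)" "monoid.mult (U L) = monoid.mult (F Quot I)"
  "one (U L) = one (F Quot I)" "zero (U L) = zero (F Quot I)" "add (U L) = add (F Quot I)"
  "module.smult (U L) = (\<lambda>c A. \<Union>a\<in>A. I +>\<^bsub>F\<^esub> (Poly_Mapping.single 0 c * a))"
  by (simp_all add: U_def ring.defs module.defs)

lemma ring_U: "ring (U L)"
proof -
  interpret Q: ring "F Quot I" by (rule I.quotient_is_ring)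
  show ?thesis
  proof (rule ringI)
    show "abelian_group (U L)"
      by (rule abelian_groupI; simp add: U_simps Q.a_assoc; metis Q.a_comm Q.a_inv_closed Q.l_neg)
    show "Group.monoid (U L)"
      by (rule monoidI) (auto simp: U_simps Q.m_assoc)
  qed (auto simp: U_simps Q.l_distr Q.r_distr)
qed

lemma U_carrier: "A \<in> carrier (U L) \<longleftrightarrow> (\<exists>f\<in>carrier F. A = I +>\<^bsub>F\<^esub> f)"
  by (auto simp: U_simps FactRing_def A_RCOSETS_def')

lemma U_add: "f \<in> carrier F \<Longrightarrow> g \<in> carrier F \<Longrightarrow>
    (I +>\<^bsub>F\<^esub> f) \<oplus>\<^bsub>U L\<^esub> (I +>\<^bsub>F\<^esub> g) = I +>\<^bsub>F\<^esub> (f + g)"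
  using I.a_rcos_sum[of f g] by (simp add: U_simps FactRing_def)

lemma U_mult: "f \<in> carrier F \<Longrightarrow> g \<in> carrier F \<Longrightarrow>
    (I +>\<^bsub>F\<^esub> f) \<otimes>\<^bsub>U L\<^esub> (I +>\<^bsub>F\<^esub> g) = I +>\<^bsub>F\<^esub> (f * g)"
  using I.rcoset_mult_add[of f g] by (simp add: U_simps FactRing_def)

lemma U_one: "one (U L) = I +>\<^bsub>F\<^esub> 1"
  by (simp add: U_simps FactRing_def)

lemma coset_subset: "f \<in> carrier F \<Longrightarrow> I +>\<^bsub>F\<^esub> f \<subseteq> carrier F"
  by (simp add: F.a_r_coset_subset_G I.a_subset)

text \<open>Scaling is multiplication by an element of the free algebra, so the union over a coset
  in the definition of \<open>U\<close> is a union of equal cosets.\<close>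

lemma U_smult: assumes f: "f \<in> carrier F"
  shows "c \<odot>\<^bsub>U L\<^esub> (I +>\<^bsub>F\<^esub> f) = I +>\<^bsub>F\<^esub> (Poly_Mapping.single 0 c * f)"
proof -
  let ?c = "Poly_Mapping.single 0 c"
  have c: "?c \<in> carrier F" by (auto simp: free_algebra_carrier zero_word_def)
  have "I +>\<^bsub>F\<^esub> (?c * a) = I +>\<^bsub>F\<^esub> (?c * f)" if a: "a \<in> I +>\<^bsub>F\<^esub> f" for a
  proof -
    have "a \<in> carrier F" using a coset_subset[OF f] by blast
    moreover have "I +>\<^bsub>F\<^esub> f = I +>\<^bsub>F\<^esub> a"
      using F.a_repr_independence[OF a f] I.a_subgroup
      by (simp add: I.is_additive_subgroup additive_subgroup.a_subgroup)
    ultimately show ?thesis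
      using U_mult[OF c f] U_mult[OF c, of a] by simp
  qed
  moreover have "f \<in> I +>\<^bsub>F\<^esub> f" using f by (rule I.a_rcos_self)
  ultimately have "(\<Union>a\<in>I +>\<^bsub>F\<^esub> f. I +>\<^bsub>F\<^esub> (?c * a)) = I +>\<^bsub>F\<^esub> (?c * f)" by blast
  then show ?thesis by (simp only: U_simps)
qed

lemma U_incl_closed: "x \<in> carrier L \<Longrightarrow> U_incl L x \<in> carrier (U L)"
  by (auto simp: U_incl_def U_carrier intro: letter_closed)

end

locale lie_rep = central_scalars cs + closed_lie L
  for cs :: "complex \<Rightarrow> 'o::ring_1" and L :: "'g lie_algebra" +
  fixes \<rho> :: "'g \<Rightarrow> 'o"
  assumes rho_add: "x \<in> carrier L \<Longrightarrow> y \<in> carrier L \<Longrightarrow> \<rho> (lie_add L x y) = \<rho> x + \<rho> y"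
    and rho_scale: "x \<in> carrier L \<Longrightarrow> \<rho> (lie_scale L c x) = cs c * \<rho> x"
    and rho_bracket: "x \<in> carrier L \<Longrightarrow> y \<in> carrier L \<Longrightarrow>
      \<rho> (lie_bracket L x y) = \<rho> x * \<rho> y - \<rho> y * \<rho> x"
begin

definition eval :: "('g word \<Rightarrow>\<^sub>0 complex) \<Rightarrow> 'o" where
  "eval = lin_ext (\<lambda>u c. cs c * prod_list (map \<rho> (letters u)))"

lemma eval_single: "eval (Poly_Mapping.single u c) = cs c * prod_list (map \<rho> (letters u))"
  unfolding eval_def by (rule lin_ext_single) simp

lemma eval_0 [simp]: "eval 0 = 0" by (simp add: eval_def)

lemma eval_add: "eval (f + g) = eval f + eval g"
  unfolding eval_def by (rule lin_ext_add) (simp_all add: cs_add distrib_right)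

lemma eval_uminus: "eval (- f) = - eval f"
  unfolding eval_def by (rule lin_ext_uminus) (simp_all add: cs_add distrib_right)

lemma eval_diff: "eval (f - g) = eval f - eval g"
  using eval_add[of f "- g"] by (simp add: eval_uminus)

lemma eval_mult: "eval (f * g) = eval f * eval g"
proof (induction f rule: poly_mapping_additive_induct)
  case (single u c)
  show ?case
  proof (induction g rule: poly_mapping_additive_induct)
    case (single v c')
    show ?case
      by (simp add: mult_single eval_single plus_word_def cs_mult mult.assoc
          cs_left_commute[of "prod_list (map \<rho> (letters u))"])
  qed (simp_all add: distrib_left eval_add)
qed (simp_all add: distrib_right eval_add)

lemma eval_letter: "eval (letter x) = \<rho> x"
  by (simp add: letter_def eval_single)

lemma eval_scalar: "eval (Poly_Mapping.single 0 c) = cs c"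
  by (simp add: eval_single zero_word_def)

lemma eval_1 [simp]: "eval 1 = 1"
  using eval_scalar[of 1] by simp

text \<open>The kernel of \<open>eval\<close> on the free algebra is an ideal that contains the
  relations, hence contains the ideal generated by them.\<close>

lemma eval_ideal: "f \<in> I \<Longrightarrow> eval f = 0"
proof -
  let ?K = "{f \<in> carrier F. eval f = 0}"
  have "ideal ?K F"
  proof (rule idealI)
    show "subgroup ?K (add_monoid F)"
    proof (rule F.add.subgroupI)
      show "?K \<noteq> {}" using F.zero_closed by auto
      show "\<ominus>\<^bsub>F\<^esub> f \<in> ?K" if "f \<in> ?K" for f
      proof -
        have "\<ominus>\<^bsub>F\<^esub> f + f = 0"
          using F.l_neg[of f] that by simp
        then have "eval (\<ominus>\<^bsub>F\<^esub> f + f) = 0" by simp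
        then show ?thesis
          using that F.a_inv_closed[of f] by (simp add: eval_add)
      qed
    qed (use F.a_closed in \<open>auto simp: eval_add\<close>)
  qed (use F.m_closed ring_free_algebra in \<open>auto simp: eval_mult\<close>)
  moreover have "enveloping_relations L \<subseteq> ?K"
  proof -
    have "eval f = 0" if "f \<in> enveloping_relations L" for f
      using that unfolding enveloping_relations_def
      by (auto simp: eval_diff eval_add eval_mult eval_letter eval_scalar rho_add rho_scale rho_bracket)
    then show ?thesis using relations_closed by blast
  qed
  ultimately have "I \<subseteq> ?K"
    unfolding enveloping_ideal_def by (rule F.genideal_minimal)
  then show "f \<in> I \<Longrightarrow> eval f = 0" by blast
qed

lemma eval_coset:
  assumes "f \<in> carrier F" "g \<in> I +>\<^bsub>F\<^esub> f" shows "eval g = eval f"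
  using assms by (auto simp: a_r_coset_def' eval_add eval_ideal)

text \<open>Any representative serves, because \<open>eval\<close> is constant on cosets of the
  enveloping ideal.\<close>

definition hom :: "('g word \<Rightarrow>\<^sub>0 complex) set \<Rightarrow> 'o" where
  "hom A = eval (SOME f. f \<in> A)"

lemma hom_coset: "f \<in> carrier F \<Longrightarrow> hom (I +>\<^bsub>F\<^esub> f) = eval f"
  unfolding hom_def
  by (rule eval_coset) (auto intro: someI I.a_rcos_self)

end

text \<open>The interface through which differential operators over the enveloping algebra are
  transported coefficientwise. The target is a \<open>ring_1\<close> type without scalar
  multiplication, so complex numbers act on it through the central map \<open>cs\<close>.\<close>

locale algebra_hom = central_scalars cs + R: ring R
  for cs :: "complex \<Rightarrow> 'o::ring_1" and R :: "(complex, 'r) module" +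
  fixes H :: "'r \<Rightarrow> 'o"
  assumes smult_closed: "x \<in> carrier R \<Longrightarrow> c \<odot>\<^bsub>R\<^esub> x \<in> carrier R"
    and smult_zero: "c \<odot>\<^bsub>R\<^esub> \<zero>\<^bsub>R\<^esub> = \<zero>\<^bsub>R\<^esub>"
    and H_add: "x \<in> carrier R \<Longrightarrow> y \<in> carrier R \<Longrightarrow> H (x \<oplus>\<^bsub>R\<^esub> y) = H x + H y"
    and H_mult: "x \<in> carrier R \<Longrightarrow> y \<in> carrier R \<Longrightarrow> H (x \<otimes>\<^bsub>R\<^esub> y) = H x * H y"
    and H_one: "H \<one>\<^bsub>R\<^esub> = 1"
    and H_smult: "x \<in> carrier R \<Longrightarrow> H (c \<odot>\<^bsub>R\<^esub> x) = cs c * H x"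

context lie_rep
begin

lemma algebra_hom_hom: "algebra_hom cs (U L) hom"
proof (intro algebra_hom.intro algebra_hom_axioms.intro central_scalars_axioms ring_U)
  show "c \<odot>\<^bsub>U L\<^esub> A \<in> carrier (U L)" if "A \<in> carrier (U L)" for c A
    using that by (auto simp: U_carrier U_smult intro: free_algebra_smult_closed)
  show "c \<odot>\<^bsub>U L\<^esub> \<zero>\<^bsub>U L\<^esub> = \<zero>\<^bsub>U L\<^esub>" for c
  proof -
    have "\<zero>\<^bsub>U L\<^esub> = I +>\<^bsub>F\<^esub> 0"
      using F.a_rcos_zero[OF I.ideal_axioms I.zero_closed] by (simp add: U_simps FactRing_def)
    then show ?thesis using U_smult[OF F.zero_closed] by simp
  qed
  show "hom (A \<oplus>\<^bsub>U L\<^esub> B) = hom A + hom B" if "A \<in> carrier (U L)" "B \<in> carrier (U L)" for A B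
    using that F.a_closed by (auto simp: U_carrier U_add hom_coset eval_add)
  show "hom (A \<otimes>\<^bsub>U L\<^esub> B) = hom A * hom B" if "A \<in> carrier (U L)" "B \<in> carrier (U L)" for A B
    using that F.m_closed by (auto simp: U_carrier U_mult hom_coset eval_mult)
  show "hom \<one>\<^bsub>U L\<^esub> = 1"
    using F.one_closed by (simp add: U_one hom_coset)
  show "hom (c \<odot>\<^bsub>U L\<^esub> A) = cs c * hom A" if "A \<in> carrier (U L)" for c A
    using that
    by (auto simp: U_carrier U_smult hom_coset free_algebra_smult_closed eval_mult eval_scalar)
qed

lemma hom_incl: "x \<in> carrier L \<Longrightarrow> hom (U_incl L x) = \<rho> x"
  by (simp add: U_incl_def hom_coset letter_closed eval_letter)

end

section \<open>Column determinants of differential operators\<close>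

text \<open>Left multiplication by \<partial> on an array of coefficients \<open>P i n\<close> of
  z^(-n) \<partial>^i: the counterpart of \<open>dz_mult\<close> over a ring type.\<close>

definition op_dz :: "(nat \<Rightarrow> nat \<Rightarrow> 'o::ring_1) \<Rightarrow> nat \<Rightarrow> nat \<Rightarrow> 'o" where
  "op_dz P i n = (case i of 0 \<Rightarrow> 0 | Suc i' \<Rightarrow> P i' n) +
     (case n of 0 \<Rightarrow> 0 | Suc n' \<Rightarrow> - (of_nat n' * P i n'))"

definition op_series :: "(nat \<Rightarrow> 'o::ring_1) \<Rightarrow> (nat \<Rightarrow> nat \<Rightarrow> 'o) \<Rightarrow> nat \<Rightarrow> nat \<Rightarrow> 'o" where
  "op_series f P i n = (\<Sum>k\<le>n. f k * P i (n - k))"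

definition op_one :: "nat \<Rightarrow> nat \<Rightarrow> 'o::ring_1" where
  "op_one i n = (if i = 0 \<and> n = 0 then 1 else 0)"

text \<open>Left multiplication by \<open>f\<close> or by \<partial> + \<open>f\<close>. A column
  determinant arises from 1 by such steps alone, so products of arbitrary differential operators and
  their associativity do not enter.\<close>

definition op_entry :: "bool \<Rightarrow> (nat \<Rightarrow> 'o::ring_1) \<Rightarrow> (nat \<Rightarrow> nat \<Rightarrow> 'o) \<Rightarrow> nat \<Rightarrow> nat \<Rightarrow> 'o" where
  "op_entry b f P i n = (if b then op_dz P i n else 0) + op_series f P i n"

text \<open>The column determinant of the matrix with entries \<open>\<delta>_ab \<partial> + f a b\<close>\<close>

definition op_cdet :: "nat \<Rightarrow> (nat \<Rightarrow> nat \<Rightarrow> nat \<Rightarrow> 'o::ring_1) \<Rightarrow> nat \<Rightarrow> nat \<Rightarrow> 'o" where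
  "op_cdet N f i n = (\<Sum>\<sigma> | \<sigma> permutes {1..N}. of_int (sign \<sigma>) *
     foldr (\<lambda>j. op_entry (\<sigma> j = j) (f (\<sigma> j) j)) [1..<Suc N] op_one i n)"

context algebra_hom
begin

lemma H_zero [simp]: "H \<zero>\<^bsub>R\<^esub> = 0"
  using H_add[of "\<zero>\<^bsub>R\<^esub>" "\<zero>\<^bsub>R\<^esub>"] by simp

lemma H_a_inv: "x \<in> carrier R \<Longrightarrow> H (\<ominus>\<^bsub>R\<^esub> x) = - H x"
  using H_add[of "\<ominus>\<^bsub>R\<^esub> x" x] by (simp add: R.l_neg eq_neg_iff_add_eq_0)

lemma H_finsum: "f \<in> S \<rightarrow> carrier R \<Longrightarrow> H (finsum R f S) = (\<Sum>x\<in>S. H (f x))"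
proof (induction S rule: infinite_finite_induct)
  case (insert x S)
  then have f: "f \<in> S \<rightarrow> carrier R" "f x \<in> carrier R" by auto
  then show ?case
    using insert by (simp add: R.finsum_insert H_add R.finsum_closed)
qed (simp_all add: R.add.finprod_infinite)

abbreviation "D \<equiv> diff_ops R"

definition supp :: "(nat \<Rightarrow> nat \<Rightarrow> 'r) \<Rightarrow> nat set" where
  "supp P = {i. \<exists>n. P i n \<noteq> \<zero>\<^bsub>R\<^esub>}"

lemma D_simps:
  "one D = (\<lambda>i n. if i = 0 \<and> n = 0 then \<one>\<^bsub>R\<^esub> else \<zero>\<^bsub>R\<^esub>)"
  "zero D = (\<lambda>i n. \<zero>\<^bsub>R\<^esub>)"
  "add D = (\<lambda>P Q i n. P i n \<oplus>\<^bsub>R\<^esub> Q i n)"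
  "monoid.mult D = (\<lambda>P Q j n. \<Oplus>\<^bsub>R\<^esub>i\<in>supp P. series_mult R (P i) ((dz_mult R ^^ i) Q j) n)"
  by (simp_all add: diff_ops_def supp_def)

lemma D_carrier: "P \<in> carrier D \<longleftrightarrow> (\<forall>i n. P i n \<in> carrier R) \<and> finite (supp P)"
  by (simp add: diff_ops_def supp_def)

lemma D_closed: "P \<in> carrier D \<Longrightarrow> P i n \<in> carrier R"
  by (simp add: D_carrier)

lemma D_uminus: "P \<in> carrier D \<Longrightarrow> (\<lambda>i n. \<ominus>\<^bsub>R\<^esub> P i n) \<in> carrier D"
proof -
  assume "P \<in> carrier D"
  moreover have "supp (\<lambda>i n. \<ominus>\<^bsub>R\<^esub> P i n) \<subseteq> supp P"
    unfolding supp_def by (intro Collect_mono) (metis R.minus_zero)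
  ultimately show ?thesis by (auto simp: D_carrier intro: finite_subset)
qed

sublocale D: abelian_group D
proof (rule abelian_groupI)
  show "P \<oplus>\<^bsub>D\<^esub> Q \<in> carrier D" if PQ: "P \<in> carrier D" "Q \<in> carrier D" for P Q
  proof -
    have "supp (P \<oplus>\<^bsub>D\<^esub> Q) \<subseteq> supp P \<union> supp Q"
    proof -
      have "P i n \<oplus>\<^bsub>R\<^esub> Q i n = \<zero>\<^bsub>R\<^esub>" if "P i n = \<zero>\<^bsub>R\<^esub>" "Q i n = \<zero>\<^bsub>R\<^esub>" for i n
        using that by simp
      then show ?thesis by (fastforce simp: supp_def D_simps)
    qed
    then have "finite (supp (P \<oplus>\<^bsub>D\<^esub> Q))"
      using PQ by (meson D_carrier finite_UnI finite_subset)
    then show ?thesis using PQ by (simp add: D_carrier D_simps)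
  qed
  show "\<exists>Q\<in>carrier D. Q \<oplus>\<^bsub>D\<^esub> P = \<zero>\<^bsub>D\<^esub>" if "P \<in> carrier D" for P
    by (rule bexI[OF _ D_uminus[OF that]]) (use that in \<open>simp add: D_simps D_carrier R.l_neg\<close>)
qed (auto simp: D_carrier D_simps supp_def R.a_ac fun_eq_iff)

lemma D_a_inv: "P \<in> carrier D \<Longrightarrow> \<ominus>\<^bsub>D\<^esub> P = (\<lambda>i n. \<ominus>\<^bsub>R\<^esub> P i n)"
  by (rule D.minus_equality) (simp_all add: D_uminus D_simps D_closed R.l_neg)

text \<open>Membership in the carrier travels together with the image under \<open>H\<close>, since
  \<open>H\<close> is additive and multiplicative only there.\<close>

definition represents :: "(nat \<Rightarrow> nat \<Rightarrow> 'r) \<Rightarrow> (nat \<Rightarrow> nat \<Rightarrow> 'o) \<Rightarrow> bool" where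
  "represents P P' \<longleftrightarrow> P \<in> carrier D \<and> (\<forall>i n. H (P i n) = P' i n)"

lemma represents_zero: "represents \<zero>\<^bsub>D\<^esub> (\<lambda>i n. 0)"
  by (simp add: represents_def) (simp add: D_simps)

lemma represents_one: "represents \<one>\<^bsub>D\<^esub> op_one"
proof -
  have "supp \<one>\<^bsub>D\<^esub> \<subseteq> {0}" by (auto simp: D_simps supp_def split: if_splits)
  then show ?thesis
    using finite_subset by (auto simp: represents_def D_carrier) (auto simp: D_simps H_one op_one_def)
qed

lemma represents_dz: "represents (dz R) (\<lambda>i n. if i = 1 \<and> n = 0 then 1 else 0)"
proof -
  have "supp (dz R) \<subseteq> {1}" by (auto simp: dz_def supp_def split: if_splits)
  then show ?thesis
    using finite_subset by (auto simp: represents_def D_carrier) (auto simp: dz_def H_one)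
qed

lemma represents_series:
  assumes "r \<in> carrier R"
  shows "represents (series_op R F r) (\<lambda>i n. if i = 0 then cs (fps_nth F n) * H r else 0)"
proof -
  have "supp (series_op R F r) \<subseteq> {0}" by (auto simp: series_op_def supp_def split: if_splits)
  then show ?thesis
    using finite_subset assms
    by (auto simp: represents_def D_carrier) (auto simp: series_op_def H_smult smult_closed)
qed

lemma represents_add: "represents P P' \<Longrightarrow> represents Q Q' \<Longrightarrow>
    represents (P \<oplus>\<^bsub>D\<^esub> Q) (\<lambda>i n. P' i n + Q' i n)"
  unfolding represents_def using D.a_closed[of P Q] D_closed by (simp add: D_simps H_add)

lemma represents_uminus: "represents P P' \<Longrightarrow> represents (\<ominus>\<^bsub>D\<^esub> P) (\<lambda>i n. - P' i n)"
  unfolding represents_def using D_a_inv[of P] D_closed D.a_inv_closed[of P] by (simp add: H_a_inv)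

lemma represents_diff: "represents P P' \<Longrightarrow> represents Q Q' \<Longrightarrow>
    represents (P \<ominus>\<^bsub>D\<^esub> Q) (\<lambda>i n. P' i n - Q' i n)"
  using represents_add[OF _ represents_uminus, of P P' Q Q'] by (simp add: a_minus_def)

lemma represents_finsum:
  assumes "\<And>x. x \<in> S \<Longrightarrow> represents (f x) (f' x)"
  shows "represents (finsum D f S) (\<lambda>i n. \<Sum>x\<in>S. f' x i n)"
  using assms
proof (induction S rule: infinite_finite_induct)
  case (insert x S)
  then have "f \<in> S \<rightarrow> carrier D" "f x \<in> carrier D"
    by (auto simp: represents_def)
  then show ?case
    using insert represents_add[of "f x" "f' x" "finsum D f S"] by (simp add: D.finsum_insert)
qed (simp_all add: represents_zero D.add.finprod_infinite)

lemma represents_sign: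
  assumes "represents P P'" "s = 1 \<or> s = (-1::int)"
  shows "represents ([s] \<cdot>\<^bsub>D\<^esub> P) (\<lambda>i n. of_int s * P' i n)"
  using assms(2)
proof
  assume "s = 1"
  then show ?thesis using assms(1) by (simp add: represents_def)
next
  assume s: "s = -1"
  have "[(-1::int)] \<cdot>\<^bsub>D\<^esub> P = \<ominus>\<^bsub>D\<^esub> ([(1::int)] \<cdot>\<^bsub>D\<^esub> P)"
    using assms(1) by (intro D.add.int_pow_neg) (simp add: represents_def)
  then show ?thesis
    using represents_uminus[OF assms(1)] assms(1) s by (simp add: represents_def)
qed

lemma represents_dz_mult:
  assumes "represents P P'" shows "represents (dz_mult R P) (op_dz P')"
proof -
  have P: "P i n \<in> carrier R" "H (P i n) = P' i n" for i n
    using assms by (auto simp: represents_def D_closed)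
  have "dz_mult R P i n = \<zero>\<^bsub>R\<^esub>" if "i \<notin> Suc ` supp P \<union> supp P" for i n
  proof -
    have "(case i of 0 \<Rightarrow> \<zero>\<^bsub>R\<^esub> | Suc i' \<Rightarrow> P i' n) = \<zero>\<^bsub>R\<^esub>"
      using that by (auto simp: supp_def split: nat.splits)
    moreover have "P i = (\<lambda>n. \<zero>\<^bsub>R\<^esub>)"
      using that by (auto simp: supp_def)
    ultimately show ?thesis
      by (auto simp: dz_mult_def series_deriv_def smult_zero split: nat.splits)
  qed
  then have "supp (dz_mult R P) \<subseteq> Suc ` supp P \<union> supp P"
    unfolding supp_def[of "dz_mult R P"] by blast
  moreover have "finite (supp P)" using assms by (simp add: represents_def D_carrier)
  ultimately have fin: "finite (supp (dz_mult R P))"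
    using finite_subset by blast
  have "dz_mult R P i n \<in> carrier R \<and> H (dz_mult R P i n) = op_dz P' i n" for i n
    by (cases i; cases n)
      (simp_all add: dz_mult_def series_deriv_def op_dz_def P smult_closed H_add H_smult cs_minus cs_of_nat)
  then show ?thesis
    using fin by (simp add: represents_def D_carrier)
qed

lemma represents_dz_mult_power:
  assumes "represents P P'" shows "represents ((dz_mult R ^^ i) P) ((op_dz ^^ i) P')"
  by (induction i) (simp_all add: assms represents_dz_mult)

text \<open>The image of the left factor has order at most one, so only the indices 0 and 1 of the
  sum that defines the product survive under \<open>H\<close>.\<close>

lemma represents_mult:
  assumes M: "represents M (\<lambda>i n. if i = 0 then f n else if i = 1 \<and> n = 0 \<and> b then 1 else 0)"
    and P: "represents P P'"
  shows "represents (M \<otimes>\<^bsub>D\<^esub> P) (op_entry b f P')"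
proof -
  have M_closed: "M i n \<in> carrier R" and M_H: "H (M i n) = (if i = 0 then f n else if i = 1 \<and> n = 0 \<and> b then 1 else 0)"
    and fin: "finite (supp M)" for i n
    using M by (auto simp: represents_def D_carrier)
  have dP: "(dz_mult R ^^ i) P \<in> carrier D" "(dz_mult R ^^ i) P j n \<in> carrier R"
     "H ((dz_mult R ^^ i) P j n) = (op_dz ^^ i) P' j n" for i j n
    using represents_dz_mult_power[OF P] by (auto simp: represents_def D_closed)
  have entry_closed: "series_mult R (M i) ((dz_mult R ^^ i) P j) n \<in> carrier R" for i j n
    by (auto simp: series_mult_def M_closed dP intro!: R.finsum_closed)
  then have closed: "(M \<otimes>\<^bsub>D\<^esub> P) j n \<in> carrier R" for j n
    by (auto simp: D_simps intro!: R.finsum_closed)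
  have "(M \<otimes>\<^bsub>D\<^esub> P) j n = \<zero>\<^bsub>R\<^esub>" if "j \<notin> (\<Union>i\<in>supp M. supp ((dz_mult R ^^ i) P))" for j n
  proof -
    have "series_mult R (M i) ((dz_mult R ^^ i) P j) n = \<zero>\<^bsub>R\<^esub>" if "i \<in> supp M" for i
    proof -
      have "(dz_mult R ^^ i) P j k = \<zero>\<^bsub>R\<^esub>" for k
        using that \<open>j \<notin> _\<close> by (auto simp: supp_def)
      then have "(dz_mult R ^^ i) P j = (\<lambda>k. \<zero>\<^bsub>R\<^esub>)" by blast
      then show ?thesis by (simp add: series_mult_def M_closed)
    qed
    then show ?thesis by (simp add: D_simps R.add.finprod_one_eqI)
  qed
  then have "supp (M \<otimes>\<^bsub>D\<^esub> P) \<subseteq> (\<Union>i\<in>supp M. supp ((dz_mult R ^^ i) P))"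
    unfolding supp_def[of "M \<otimes>\<^bsub>D\<^esub> P"] by blast
  moreover have "finite (\<Union>i\<in>supp M. supp ((dz_mult R ^^ i) P))"
    using fin dP(1) by (auto simp: D_carrier)
  ultimately have finite_supp: "finite (supp (M \<otimes>\<^bsub>D\<^esub> P))"
    using finite_subset by blast
  have "H ((M \<otimes>\<^bsub>D\<^esub> P) j n) = op_entry b f P' j n" for j n
  proof -
    let ?g = "\<lambda>i. \<Sum>k\<le>n. H (M i k) * (op_dz ^^ i) P' j (n - k)"
    have "H ((M \<otimes>\<^bsub>D\<^esub> P) j n) = (\<Sum>i\<in>supp M. ?g i)"
      using entry_closed M_closed dP
      by (simp add: D_simps H_finsum series_mult_def H_mult Pi_iff)
    \<comment> \<open>The support is taken before \<open>H\<close> is applied. It may miss 0 or 1,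
      and it may contain indices whose coefficients are killed by \<open>H\<close>; the union is a
      common superset for both comparisons.\<close>
    also have "\<dots> = (\<Sum>i\<in>supp M \<union> {0, 1}. ?g i)"
      by (rule sum.mono_neutral_left) (use fin in \<open>auto simp: supp_def\<close>)
    also have "\<dots> = (\<Sum>i\<in>{0, 1}. ?g i)"
      by (rule sum.mono_neutral_right) (use fin in \<open>auto simp: M_H\<close>)
    also have "\<dots> = ?g 0 + ?g 1" by simp
    also have "?g 0 = op_series f P' j n"
      by (simp add: M_H op_series_def)
    also have "?g 1 = (if b then op_dz P' j n else 0)"
      by (simp add: M_H if_distrib[of "\<lambda>x. x * _"] sum.If_cases cong: if_cong)
    finally show ?thesis by (simp add: op_entry_def add.commute)
  qed
  then show ?thesis
    using closed finite_supp by (simp add: represents_def D_carrier)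
qed

lemma represents_cdet:
  assumes "\<And>i j. i \<in> {1..N} \<Longrightarrow> j \<in> {1..N} \<Longrightarrow> represents (M i j)
    (\<lambda>k n. if k = 0 then f i j n else if k = 1 \<and> n = 0 \<and> i = j then 1 else 0)"
  shows "represents (cdet D N M) (op_cdet N f)"
proof -
  have row: "represents (foldr (\<lambda>j P. M (\<sigma> j) j \<otimes>\<^bsub>D\<^esub> P) js \<one>\<^bsub>D\<^esub>)
     (foldr (\<lambda>j. op_entry (\<sigma> j = j) (f (\<sigma> j) j)) js op_one)"
    if "\<sigma> permutes {1..N}" "set js \<subseteq> {1..N}" for \<sigma> js
    using that(2)
  proof (induction js)
    case Nil
    then show ?case by (simp add: represents_one)
  next
    case (Cons j js)
    then show ?case
      using permutes_in_image[OF that(1), of j] assms[of "\<sigma> j" j] represents_mult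
      by simp
  qed
  have "represents ([sign \<sigma>] \<cdot>\<^bsub>D\<^esub> foldr (\<lambda>j P. M (\<sigma> j) j \<otimes>\<^bsub>D\<^esub> P) [1..<Suc N] \<one>\<^bsub>D\<^esub>)
     (\<lambda>i n. of_int (sign \<sigma>) * foldr (\<lambda>j. op_entry (\<sigma> j = j) (f (\<sigma> j) j)) [1..<Suc N] op_one i n)"
    if "\<sigma> permutes {1..N}" for \<sigma>
    by (rule represents_sign[OF row[OF that]]) (auto simp: sign_def)
  then show ?thesis
    unfolding cdet_def op_cdet_def by (intro represents_finsum) auto
qed

lemma represents_gaudin:
  assumes "\<And>i k. i \<in> {1..L} \<Longrightarrow> k < \<gamma> i \<Longrightarrow> g i k \<in> carrier R"
  shows "represents ((if b then dz R else \<zero>\<^bsub>D\<^esub>) \<ominus>\<^bsub>D\<^esub> series_op R (fps_const c) \<one>\<^bsub>R\<^esub>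
       \<ominus>\<^bsub>D\<^esub> (\<Oplus>\<^bsub>D\<^esub>i\<in>{1..L}. \<Oplus>\<^bsub>D\<^esub>k\<in>{..<\<gamma> i}. series_op R (G i k) (g i k)))
     (\<lambda>j n. if j = 0 then - (if n = 0 then cs c else 0) -
         (\<Sum>i=1..L. \<Sum>k<\<gamma> i. cs (fps_nth (G i k) n) * H (g i k))
       else if j = 1 \<and> n = 0 \<and> b then 1 else 0)"
proof -
  have "represents (if b then dz R else \<zero>\<^bsub>D\<^esub>) (\<lambda>j n. if j = 1 \<and> n = 0 \<and> b then 1 else 0)"
    using represents_dz represents_zero by simp
  moreover have "represents (series_op R (fps_const c) \<one>\<^bsub>R\<^esub>)
      (\<lambda>j n. if j = 0 then cs (fps_nth (fps_const c) n) * H \<one>\<^bsub>R\<^esub> else 0)"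
    by (rule represents_series) simp
  moreover have "represents (\<Oplus>\<^bsub>D\<^esub>i\<in>{1..L}. \<Oplus>\<^bsub>D\<^esub>k\<in>{..<\<gamma> i}. series_op R (G i k) (g i k))
     (\<lambda>j n. \<Sum>i=1..L. \<Sum>k<\<gamma> i. if j = 0 then cs (fps_nth (G i k) n) * H (g i k) else 0)"
    by (intro represents_finsum represents_series assms) auto
  ultimately have "represents ((if b then dz R else \<zero>\<^bsub>D\<^esub>) \<ominus>\<^bsub>D\<^esub> series_op R (fps_const c) \<one>\<^bsub>R\<^esub>
       \<ominus>\<^bsub>D\<^esub> (\<Oplus>\<^bsub>D\<^esub>i\<in>{1..L}. \<Oplus>\<^bsub>D\<^esub>k\<in>{..<\<gamma> i}. series_op R (G i k) (g i k)))
     (\<lambda>j n. (if j = 1 \<and> n = 0 \<and> b then 1 else 0) -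
        (if j = 0 then cs (fps_nth (fps_const c) n) * H \<one>\<^bsub>R\<^esub> else 0) -
        (\<Sum>i=1..L. \<Sum>k<\<gamma> i. if j = 0 then cs (fps_nth (G i k) n) * H (g i k) else 0))"
    by (intro represents_diff)
  then show ?thesis
    by (rule back_subst[of "represents _"]) (auto simp: fun_eq_iff H_one)
qed

end

section \<open>Normal ordering\<close>

text \<open>Each column acts as multiplication by its entry plus a derivation. When the derivation
  of column c falls on the factor of a later column j, \<open>sym\<close> says that the result does
  not change if the rows chosen in these two columns are exchanged, whereas the sign of the
  permutation does.\<close>

lemma column_determinant_derivations:
  fixes M :: "nat \<Rightarrow> nat \<Rightarrow> 's::comm_ring_1"
  assumes add: "\<And>a c f g. d a c (f + g) = d a c f + d a c g"
    and mult: "\<And>a c f g. d a c (f * g) = d a c f * g + f * d a c g"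
    and sym: "\<And>a b c j. {a, b, c, j} \<subseteq> {1..N} \<Longrightarrow> d a c (M b j) = d b c (M a j)"
    and two: "\<And>x::'s. x + x = 0 \<Longrightarrow> x = 0"
  shows "(\<Sum>\<sigma> | \<sigma> permutes {1..N}. of_int (sign \<sigma>) *
      foldr (\<lambda>j W. M (\<sigma> j) j * W + d (\<sigma> j) j W) [1..<Suc N] 1) =
    (\<Sum>\<sigma> | \<sigma> permutes {1..N}. of_int (sign \<sigma>) * (\<Prod>j\<in>{1..N}. M (\<sigma> j) j))"
proof -
  define step where "step \<sigma> = (\<lambda>j W. M (\<sigma> j) j * W + d (\<sigma> j) j W)" for \<sigma>
  have d0: "d a c 0 = 0" for a c using add[of a c 0 0] by simp
  have d1: "d a c 1 = 0" for a c using mult[of a c 1 1] by simp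
  have fold_add: "foldr (step \<sigma>) js (x + y) = foldr (step \<sigma>) js x + foldr (step \<sigma>) js y" for \<sigma> js x y
    by (induction js) (simp_all add: step_def add distrib_left)
  have fold_0: "foldr (step \<sigma>) js 0 = 0" for \<sigma> js
    by (induction js) (simp_all add: step_def d0)
  have fold_sum: "foldr (step \<sigma>) js (\<Sum>x\<in>S. f x) = (\<Sum>x\<in>S. foldr (step \<sigma>) js (f x))"
    for \<sigma> js f and S :: "nat set"
    by (induction S rule: infinite_finite_induct) (simp_all add: fold_add fold_0)
  have d_prod: "d a c (\<Prod>j\<in>S. f j) = (\<Sum>j\<in>S. d a c (f j) * (\<Prod>i\<in>S - {j}. f i))"
    if "finite S" for a c f and S :: "nat set"
    using that
  proof (induction S rule: finite_induct)
    case (insert x S)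
    have "(\<Sum>j\<in>S. d a c (f j) * (\<Prod>i\<in>insert x S - {j}. f i)) =
        (\<Sum>j\<in>S. f x * (d a c (f j) * (\<Prod>i\<in>S - {j}. f i)))"
    proof (rule sum.cong)
      fix j assume "j \<in> S"
      then have "insert x S - {j} = insert x (S - {j})" using insert by auto
      then show "d a c (f j) * (\<Prod>i\<in>insert x S - {j}. f i) =
          f x * (d a c (f j) * (\<Prod>i\<in>S - {j}. f i))"
        using insert by (simp add: mult_ac)
    qed simp
    then show ?case
      using insert by (simp add: mult sum_distrib_left)
  qed (simp add: d1)
  \<comment> \<open>Interpolates between the two sides: columns 1 to k still act as operators, on
    the ordinary product of the entries in the remaining columns.\<close>
  define T where "T k = (\<Sum>\<sigma> | \<sigma> permutes {1..N}. of_int (sign \<sigma>) *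
      foldr (step \<sigma>) [1..<Suc k] (\<Prod>j\<in>{Suc k..N}. M (\<sigma> j) j))" for k
  have T_Suc: "T (Suc k) = T k" if k: "Suc k \<le> N" for k
  proof -
    let ?c = "Suc k"
    \<comment> \<open>The term in which the derivation of column k + 1 falls on the factor of column
      j.\<close>
    define E where "E \<sigma> j = d (\<sigma> ?c) ?c (M (\<sigma> j) j) * (\<Prod>i\<in>{Suc ?c..N} - {j}. M (\<sigma> i) i)" for \<sigma> j
    have cancel: "(\<Sum>\<sigma> | \<sigma> permutes {1..N}. of_int (sign \<sigma>) * foldr (step \<sigma>) [1..<?c] (E \<sigma> j)) = 0"
      (is "sum ?f _ = 0") if j: "j \<in> {Suc ?c..N}" for j
    proof (rule two)
      \<comment> \<open>Composition with this transposition exchanges the rows of columns k + 1 and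
        j, preserves the operators of columns 1 to k and reverses the sign, so the sum equals its
        own negative.\<close>
      let ?\<tau> = "transpose ?c j"
      have \<tau>: "?\<tau> permutes {1..N}" using k j by (intro permutes_swap_id) auto
      have "?f (\<sigma> \<circ> ?\<tau>) = - ?f \<sigma>" if \<sigma>: "\<sigma> permutes {1..N}" for \<sigma>
      proof -
        have "sign (\<sigma> \<circ> ?\<tau>) = - sign \<sigma>"
          using sign_compose[of \<sigma> ?\<tau>] \<sigma> \<tau> j
          by (auto simp: sign_swap_id permutation_permutes)
        moreover have "foldr (step (\<sigma> \<circ> ?\<tau>)) [1..<?c] x = foldr (step \<sigma>) [1..<?c] x" for x
          by (rule foldr_cong) (use j in \<open>auto simp: step_def transpose_def fun_eq_iff\<close>)
        moreover have "E (\<sigma> \<circ> ?\<tau>) j = E \<sigma> j"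
        proof -
          have "{\<sigma> j, \<sigma> ?c, ?c, j} \<subseteq> {1..N}"
            using k j permutes_in_image[OF \<sigma>] by auto
          from sym[OF this]
          have "d (\<sigma> j) ?c (M (\<sigma> ?c) j) = d (\<sigma> ?c) ?c (M (\<sigma> j) j)" .
          moreover have "(\<Prod>i\<in>{Suc ?c..N} - {j}. M ((\<sigma> \<circ> ?\<tau>) i) i) = (\<Prod>i\<in>{Suc ?c..N} - {j}. M (\<sigma> i) i)"
            by (rule prod.cong) (auto simp: transpose_def)
          ultimately show ?thesis by (simp add: E_def)
        qed
        ultimately show ?thesis by simp
      qed
      moreover have "sum ?f {\<sigma>. \<sigma> permutes {1..N}} = sum (\<lambda>\<sigma>. ?f (\<sigma> \<circ> ?\<tau>)) {\<sigma>. \<sigma> permutes {1..N}}"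
        by (rule sum_permutations_compose_right[OF \<tau>])
      ultimately have "sum ?f {\<sigma>. \<sigma> permutes {1..N}} = - sum ?f {\<sigma>. \<sigma> permutes {1..N}}"
        by (simp add: sum_negf)
      then show "sum ?f {\<sigma>. \<sigma> permutes {1..N}} + sum ?f {\<sigma>. \<sigma> permutes {1..N}} = 0"
        by (simp add: eq_neg_iff_add_eq_0)
    qed
    have "foldr (step \<sigma>) [1..<Suc ?c] (\<Prod>j\<in>{Suc ?c..N}. M (\<sigma> j) j) =
        foldr (step \<sigma>) [1..<?c] (\<Prod>j\<in>{?c..N}. M (\<sigma> j) j) +
        (\<Sum>j\<in>{Suc ?c..N}. foldr (step \<sigma>) [1..<?c] (E \<sigma> j))" for \<sigma>
    proof -
      have "{?c..N} = insert ?c {Suc ?c..N}" using k by auto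
      then have "step \<sigma> ?c (\<Prod>j\<in>{Suc ?c..N}. M (\<sigma> j) j) =
          (\<Prod>j\<in>{?c..N}. M (\<sigma> j) j) + (\<Sum>j\<in>{Suc ?c..N}. E \<sigma> j)"
        by (simp add: step_def d_prod E_def)
      then show ?thesis by (simp add: fold_add fold_sum)
    qed
    then have "T ?c = T k + (\<Sum>\<sigma> | \<sigma> permutes {1..N}. \<Sum>j\<in>{Suc ?c..N}.
         of_int (sign \<sigma>) * foldr (step \<sigma>) [1..<?c] (E \<sigma> j))"
      unfolding T_def by (simp add: distrib_left sum.distrib sum_distrib_left del: upt_Suc)
    also have "\<dots> = T k"
      by (subst sum.swap) (use cancel in simp)
    finally show ?thesis .
  qed
  have "T k = T 0" if "k \<le> N" for k
    using that by (induction k) (use T_Suc in auto)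
  then have "T N = T 0" by blast
  moreover have "foldr (step \<sigma>) [1..<Suc 0] x = x" for \<sigma> x by simp
  ultimately show ?thesis
    by (simp add: T_def step_def)
qed

section \<open>Partial derivatives of polynomials\<close>

text \<open>Subtraction of exponents is truncated at 0, so moving it past an addition requires a
  positive exponent of \<open>v\<close>. When the exponent is 0, the factor that differentiation
  brings down vanishes.\<close>

lemma single_minus_add:
  fixes \<mu> \<nu> :: "'v \<Rightarrow>\<^sub>0 nat"
  assumes "Poly_Mapping.lookup \<mu> v \<noteq> 0"
  shows "\<mu> - Poly_Mapping.single v 1 + \<nu> = \<mu> + \<nu> - Poly_Mapping.single v 1"
  using assms by (intro poly_mapping_eqI) (auto simp: lookup_add lookup_minus lookup_single when_def)

lemma mpol_deriv_lin_ext: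
  "mpol_deriv v = lin_ext (\<lambda>\<mu> c. Poly_Mapping.single (\<mu> - Poly_Mapping.single v 1)
     (of_nat (Poly_Mapping.lookup \<mu> v) * c))"
  by (simp add: fun_eq_iff mpol_deriv_def lin_ext_def)

lemma mpol_deriv_single: "mpol_deriv v (Poly_Mapping.single \<mu> c) =
    Poly_Mapping.single (\<mu> - Poly_Mapping.single v 1) (of_nat (Poly_Mapping.lookup \<mu> v) * c)"
  unfolding mpol_deriv_lin_ext by (rule lin_ext_single) simp

lemma mpol_deriv_add: "mpol_deriv v (f + g) = mpol_deriv v f + mpol_deriv v g"
  unfolding mpol_deriv_lin_ext by (rule lin_ext_add) (simp_all add: distrib_left single_add)

lemma mpol_deriv_0 [simp]: "mpol_deriv v 0 = 0"
  by (simp add: mpol_deriv_lin_ext)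

lemma mpol_deriv_mult: "mpol_deriv v (f * g) = mpol_deriv v f * g + f * mpol_deriv v g"
proof (induction f rule: poly_mapping_additive_induct)
  case (single \<mu> c)
  show ?case
  proof (induction g rule: poly_mapping_additive_induct)
    case (single \<nu> c')
    let ?e = "Poly_Mapping.single v (1::nat)"
    let ?l = "\<lambda>\<mu>. complex_of_nat (Poly_Mapping.lookup \<mu> v)"
    have "Poly_Mapping.single (\<mu> - ?e + \<nu>) (?l \<mu> * c * c') = Poly_Mapping.single (\<mu> + \<nu> - ?e) (?l \<mu> * c * c')"
      using single_minus_add[of \<mu> v \<nu>] by (cases "Poly_Mapping.lookup \<mu> v = 0") auto
    moreover have "Poly_Mapping.single (\<mu> + (\<nu> - ?e)) (c * (?l \<nu> * c')) =
        Poly_Mapping.single (\<mu> + \<nu> - ?e) (c * (?l \<nu> * c'))"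
      using single_minus_add[of \<nu> v \<mu>]
      by (cases "Poly_Mapping.lookup \<nu> v = 0") (auto simp: add.commute)
    ultimately show ?case
      by (simp add: mult_single mpol_deriv_single lookup_add single_add[symmetric] algebra_simps)
  qed (simp_all add: distrib_left mpol_deriv_add)
qed (simp_all add: distrib_right mpol_deriv_add)

lemma mpol_deriv_const [simp]: "mpol_deriv v (Poly_Mapping.single 0 c) = 0"
  by (simp add: mpol_deriv_single)

lemma mpol_deriv_scale:
  "mpol_deriv v (Poly_Mapping.single 0 c * f) = Poly_Mapping.single 0 c * mpol_deriv v f"
  by (simp add: mpol_deriv_mult)

lemma mpol_deriv_var: "mpol_deriv v (Poly_Mapping.single (Poly_Mapping.single w 1) 1) =
    (if v = w then 1 else 0)"
  by (auto simp: mpol_deriv_single lookup_single)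

text \<open>Polynomials in the symbols \<open>x_k\<close> and \<open>\<xi>_k\<close> of the generators, with index \<open>2 k\<close> and \<open>2 k + 1\<close>\<close>

type_synonym symbol = "nat mpol"

abbreviation scalar :: "complex \<Rightarrow> symbol" where
  "scalar c \<equiv> Poly_Mapping.single 0 c"

definition sx :: "nat \<Rightarrow> symbol" where
  "sx k = Poly_Mapping.single (Poly_Mapping.single (2 * k) 1) 1"

definition sxi :: "nat \<Rightarrow> symbol" where
  "sxi k = Poly_Mapping.single (Poly_Mapping.single (2 * k + 1) 1) 1"

definition sD :: "nat \<Rightarrow> symbol \<Rightarrow> symbol" where
  "sD k = mpol_deriv (2 * k)"

section \<open>Ordered products of Weyl generators and quantization of symbols\<close>

definition ordered_product :: "(nat \<Rightarrow> 'o::monoid_mult) \<Rightarrow> nat list \<Rightarrow> (nat \<Rightarrow> nat) \<Rightarrow> 'o" where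
  "ordered_product X ks e = prod_list (map (\<lambda>k. X k ^ e k) ks)"

lemma ordered_product_Nil [simp]: "ordered_product X [] e = 1"
  by (simp add: ordered_product_def)

lemma ordered_product_Cons [simp]: "ordered_product X (k # ks) e = X k ^ e k * ordered_product X ks e"
  by (simp add: ordered_product_def)

lemma ordered_product_upd: "k \<notin> set ks \<Longrightarrow> ordered_product X ks (e(k := n)) = ordered_product X ks e"
  by (induction ks) auto

lemma of_nat_left_commute: "x * (of_nat n * y) = of_nat n * (x * (y::'o::semiring_1))"
  by (metis mult.assoc mult_of_nat_commute)

lemma ordered_product_Suc:
  fixes X :: "nat \<Rightarrow> 'o::monoid_mult"
  assumes "\<And>i j. X i * X j = X j * X i" "distinct ks" "k \<in> set ks"
  shows "ordered_product X ks (e(k := Suc (e k))) = X k * ordered_product X ks e"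
  using assms(2,3)
proof (induction ks)
  case (Cons j ks)
  have pow: "X j ^ n * X k = X k * X j ^ n" for n
    by (induction n) (simp_all add: mult.assoc, metis assms(1) mult.assoc)
  show ?case
  proof (cases "j = k")
    case True
    then show ?thesis
      using Cons.prems by (simp add: ordered_product_upd del: fun_upd_apply) (simp add: mult.assoc)
  next
    case False
    then have "ordered_product X ks (e(k := Suc (e k))) = X k * ordered_product X ks e"
      by (intro Cons.IH) (use Cons.prems in auto)
    then show ?thesis
      using False pow[of "e j"] by (simp add: mult.assoc[symmetric] del: fun_upd_apply) simp
  qed
qed simp

locale weyl_generators = central_scalars cs
  for cs :: "complex \<Rightarrow> 'o::ring_1" +
  fixes P Q :: "nat \<Rightarrow> 'o"
  assumes PP: "P i * P j = P j * P i" and QQ: "Q i * Q j = Q j * Q i"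
    and QP: "Q i * P j = P j * Q i + (if i = j then 1 else 0)"
begin

text \<open>The commutator with \<open>Q i\<close> is a derivation that sends \<open>P i\<close> to
  1 and every other \<open>P j\<close> to 0.\<close>

lemma Q_P_power: "Q i * P j ^ n = P j ^ n * Q i + (if i = j then of_nat n * P j ^ (n - 1) else 0)"
proof (induction n)
  case (Suc n)
  have "Q i * P j ^ Suc n = (P j * Q i + (if i = j then 1 else 0)) * P j ^ n"
    by (simp add: QP mult.assoc[symmetric])
  also have "\<dots> = P j * (Q i * P j ^ n) + (if i = j then P j ^ n else 0)"
    by (simp add: distrib_right mult.assoc)
  also have "\<dots> = P j ^ Suc n * Q i + (if i = j then of_nat n * (P j * P j ^ (n - 1)) + P j ^ n else 0)"
    by (simp add: Suc.IH distrib_left mult.assoc[symmetric] mult_of_nat_commute[of n "P j"])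
  also have "of_nat n * (P j * P j ^ (n - 1)) = of_nat n * P j ^ n"
    by (cases n) simp_all
  finally show ?case by (simp add: distrib_right add.commute)
qed simp

lemma Q_ordered_product:
  assumes "distinct ks"
  shows "Q k * ordered_product P ks e = ordered_product P ks e * Q k +
    (if k \<in> set ks then of_nat (e k) * ordered_product P ks (e(k := e k - 1)) else 0)"
  using assms
proof (induction ks)
  case (Cons j ks)
  let ?o = "ordered_product P"
  have "Q k * ?o (j # ks) e = (Q k * P j ^ e j) * ?o ks e"
    by (simp add: mult.assoc)
  also have "\<dots> = P j ^ e j * (Q k * ?o ks e) + (if k = j then of_nat (e j) * P j ^ (e j - 1) * ?o ks e else 0)"
    by (simp add: Q_P_power distrib_right mult.assoc)
  also have "\<dots> = ?o (j # ks) e * Q k +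
      ((if k \<in> set ks then of_nat (e k) * (P j ^ e j * ?o ks (e(k := e k - 1))) else 0) +
      (if k = j then of_nat (e j) * (P j ^ (e j - 1) * ?o ks e) else 0))"
    using Cons by (simp add: distrib_left mult.assoc of_nat_left_commute[of "P j ^ e j"])
  also have "(if k \<in> set ks then of_nat (e k) * (P j ^ e j * ?o ks (e(k := e k - 1))) else 0) +
      (if k = j then of_nat (e j) * (P j ^ (e j - 1) * ?o ks e) else 0) =
    (if k \<in> set (j # ks) then of_nat (e k) * ?o (j # ks) (e(k := e k - 1)) else 0)"
  proof (cases "k = j")
    case True
    then show ?thesis using Cons.prems
      by (simp add: ordered_product_upd del: fun_upd_apply) simp
  qed simp
  finally show ?case .
qed simp

end

text \<open>The bound \<open>m\<close> makes ordered products run over the finite list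
  \<open>[0..<m]\<close>. Symbols of larger index are sent to 1 by \<open>quantize\<close>, which is
  why the multiplication rules ask for an index below \<open>m\<close>.\<close>

locale normal_ordering = weyl_generators +
  fixes m :: nat
begin

definition quantize :: "symbol \<Rightarrow> 'a" where
  "quantize = lin_ext (\<lambda>\<mu> c. cs c *
     (ordered_product P [0..<m] (\<lambda>k. Poly_Mapping.lookup \<mu> (2 * k)) *
      ordered_product Q [0..<m] (\<lambda>k. Poly_Mapping.lookup \<mu> (2 * k + 1))))"

lemma quantize_single: "quantize (Poly_Mapping.single \<mu> c) = cs c *
     (ordered_product P [0..<m] (\<lambda>k. Poly_Mapping.lookup \<mu> (2 * k)) *
      ordered_product Q [0..<m] (\<lambda>k. Poly_Mapping.lookup \<mu> (2 * k + 1)))"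
  unfolding quantize_def by (rule lin_ext_single) simp

lemma quantize_add: "quantize (f + g) = quantize f + quantize g"
  unfolding quantize_def by (rule lin_ext_add) (simp_all add: cs_add distrib_right)

lemma quantize_0 [simp]: "quantize 0 = 0"
  by (simp add: quantize_def)

lemma quantize_sum: "quantize (sum f S) = (\<Sum>x\<in>S. quantize (f x))"
  by (induction S rule: infinite_finite_induct) (simp_all add: quantize_add)

lemma quantize_uminus: "quantize (- f) = - quantize f"
  using quantize_add[of f "- f"] by (simp add: eq_neg_iff_add_eq_0 add.commute)

lemma quantize_diff: "quantize (f - g) = quantize f - quantize g"
  using quantize_add[of f "- g"] by (simp add: quantize_uminus)

lemma quantize_scalar: "quantize (scalar c * f) = cs c * quantize f"
  by (induction f rule: poly_mapping_additive_induct)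
    (simp_all add: mult_single quantize_single cs_mult mult.assoc distrib_left quantize_add)

lemma quantize_1: "quantize 1 = 1"
proof -
  have "ordered_product X ks (\<lambda>k. 0) = 1" for X :: "nat \<Rightarrow> 'a" and ks
    by (induction ks) simp_all
  then show ?thesis
    using quantize_single[of 0 1] by simp
qed

text \<open>The \<open>P\<close> stand on the left and commute with each other, so a further one on
  the left creates no correction.\<close>

lemma quantize_sx: assumes k: "k < m" shows "quantize (sx k * f) = P k * quantize f"
proof (induction f rule: poly_mapping_additive_induct)
  case (single \<mu> c)
  let ?\<nu> = "Poly_Mapping.single (2 * k) (1::nat) + \<mu>"
  let ?e = "\<lambda>j. Poly_Mapping.lookup \<mu> (2 * j)"
  have "(\<lambda>j. Poly_Mapping.lookup ?\<nu> (2 * j)) = ?e(k := Suc (?e k))"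
    "(\<lambda>j. Poly_Mapping.lookup ?\<nu> (2 * j + 1)) = (\<lambda>j. Poly_Mapping.lookup \<mu> (2 * j + 1))"
    by (auto simp: fun_eq_iff lookup_add lookup_single when_def) presburger+
  then show ?case
    using ordered_product_Suc[where X = P and ks = "[0..<m]" and k = k and e = ?e, OF PP] k
    by (simp add: sx_def mult_single quantize_single mult.assoc cs_left_commute[of "P k"])
qed (simp_all add: distrib_left quantize_add)

text \<open>To reach its place, \<open>Q k\<close> must pass all the \<open>P\<close>; the
  commutators met on the way add up to the derivative in x_k.\<close>

lemma quantize_sxi: assumes k: "k < m" shows "quantize (sxi k * f + sD k f) = Q k * quantize f"
proof (induction f rule: poly_mapping_additive_induct)
  case (single \<mu> c)
  let ?\<nu> = "Poly_Mapping.single (2 * k + 1) (1::nat) + \<mu>"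
  let ?\<kappa> = "\<mu> - Poly_Mapping.single (2 * k) (1::nat)"
  let ?d = "\<lambda>j. Poly_Mapping.lookup \<mu> (2 * j)"
  let ?e = "\<lambda>j. Poly_Mapping.lookup \<mu> (2 * j + 1)"
  let ?P = "ordered_product P [0..<m]" and ?Q = "ordered_product Q [0..<m]"
  have "(\<lambda>j. Poly_Mapping.lookup ?\<nu> (2 * j + 1)) = ?e(k := Suc (?e k))"
    "(\<lambda>j. Poly_Mapping.lookup ?\<nu> (2 * j)) = ?d"
    by (auto simp: fun_eq_iff lookup_add lookup_single when_def) presburger+
  then have 1: "quantize (sxi k * Poly_Mapping.single \<mu> c) = cs c * (?P ?d * (Q k * ?Q ?e))"
    using ordered_product_Suc[where X = Q and ks = "[0..<m]" and k = k and e = ?e, OF QQ] k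
    by (simp add: sxi_def mult_single quantize_single)
  have "(\<lambda>j. Poly_Mapping.lookup ?\<kappa> (2 * j)) = ?d(k := ?d k - 1)"
    "(\<lambda>j. Poly_Mapping.lookup ?\<kappa> (2 * j + 1)) = ?e"
    by (auto simp: fun_eq_iff lookup_minus lookup_single when_def) presburger+
  then have 2: "quantize (sD k (Poly_Mapping.single \<mu> c)) = cs c * (of_nat (?d k) * ?P (?d(k := ?d k - 1)) * ?Q ?e)"
    by (simp add: sD_def mpol_deriv_single quantize_single cs_mult cs_of_nat mult.assoc
        cs_left_commute[of "of_nat _"])
  have "Q k * (?P ?d * ?Q ?e) = ?P ?d * (Q k * ?Q ?e) + of_nat (?d k) * ?P (?d(k := ?d k - 1)) * ?Q ?e"
    using Q_ordered_product[of "[0..<m]" k ?d] k by (simp add: mult.assoc[symmetric] distrib_right)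
  then show ?case
    by (simp only: quantize_add 1 2) (simp add: quantize_single cs_left_commute[of "Q k"] distrib_left)
next
  case (add f g)
  have "sxi k * (f + g) + sD k (f + g) = (sxi k * f + sD k f) + (sxi k * g + sD k g)"
    by (simp add: sD_def mpol_deriv_add distrib_left)
  then show ?case
    using add by (metis quantize_add distrib_left)
qed (simp add: sD_def)

end

section \<open>Derivations of symbols and substitution of a shifted \<partial>\<close>

definition derivation :: "('s::comm_ring_1 \<Rightarrow> 's) \<Rightarrow> bool" where
  "derivation d \<longleftrightarrow> (\<forall>x y. d (x + y) = d x + d y) \<and> (\<forall>x y. d (x * y) = d x * y + x * d y)"

lemma derivationD:
  assumes "derivation d"
  shows "d (x + y) = d x + d y" "d (x * y) = d x * y + x * d y" "d 0 = 0" "d 1 = 0"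
    "d (- x) = - d x" "d (x - y) = d x - d y"
proof -
  show add: "d (x + y) = d x + d y" and mult: "d (x * y) = d x * y + x * d y" for x y
    using assms by (simp_all add: derivation_def)
  show zero: "d 0 = 0" using add[of 0 0] by simp
  show "d 1 = 0" using mult[of 1 1] by simp
  show uminus: "d (- x) = - d x" for x
    using add[of x "- x"] zero by (simp add: eq_neg_iff_add_eq_0 add.commute)
  show "d (x - y) = d x - d y"
    using add[of x "- y"] uminus[of y] by simp
qed

lemma derivation_sum: "derivation d \<Longrightarrow> d (sum f S) = (\<Sum>x\<in>S. d (f x))"
  by (induction S rule: infinite_finite_induct) (simp_all add: derivationD)

lemma derivation_add_scaled:
  "derivation d \<Longrightarrow> derivation d' \<Longrightarrow> derivation (\<lambda>x. d x + c * d' x)"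
  by (simp add: derivation_def algebra_simps)

lemma derivation_zero: "derivation (\<lambda>x. 0)"
  by (simp add: derivation_def)

lemma derivation_sD: "derivation (sD k)"
  by (simp add: derivation_def sD_def mpol_deriv_add mpol_deriv_mult)

definition fps_map :: "('a::zero \<Rightarrow> 'b::zero) \<Rightarrow> 'a fps \<Rightarrow> 'b fps" where
  "fps_map h f = Abs_fps (\<lambda>n. h (fps_nth f n))"

lemma fps_map_nth [simp]: "fps_nth (fps_map h f) n = h (fps_nth f n)"
  by (simp add: fps_map_def)

lemma derivation_fps_map: "derivation d \<Longrightarrow> derivation (fps_map d)"
  unfolding derivation_def[of "fps_map d"]
  by (auto simp: fps_eq_iff derivationD fps_mult_nth derivation_sum sum.distrib[symmetric])

lemma derivation_map_poly:
  assumes "derivation d" shows "derivation (map_poly d)"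
  unfolding derivation_def[of "map_poly d"] using derivationD[OF assms]
  by (auto simp: poly_eq_iff coeff_map_poly coeff_mult derivation_sum[OF assms] sum.distrib[symmetric])

text \<open>Differentiation with respect to \<open>z = 1/u\<close> is \<open>- u^2 d/du\<close>.\<close>

definition fps_dz :: "'a::comm_ring_1 fps \<Rightarrow> 'a fps" where
  "fps_dz f = - (fps_X ^ 2 * fps_deriv f)"

lemma derivation_fps_dz: "derivation fps_dz"
  by (simp add: derivation_def fps_dz_def algebra_simps)

lemma fps_dz_nth: "fps_nth (fps_dz f) n = (case n of 0 \<Rightarrow> 0 | Suc n' \<Rightarrow> - (of_nat n' * fps_nth f n'))"
  by (cases n) (auto simp: fps_dz_def power2_eq_square mult.assoc fps_X_mult_nth)

definition sfps :: "complex fps \<Rightarrow> symbol fps" where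
  "sfps = fps_map scalar"

lemma sfps_nth [simp]: "fps_nth (sfps f) n = scalar (fps_nth f n)"
  by (simp add: sfps_def)

lemma scalar_mult: "scalar c * scalar c' = scalar (c * c')"
  by (simp add: mult_single)

lemma scalar_sum: "scalar (sum f S) = (\<Sum>x\<in>S. scalar (f x))"
  by (induction S rule: infinite_finite_induct) (simp_all add: single_add)

lemma sfps_add: "sfps (f + g) = sfps f + sfps g"
  by (simp add: fps_eq_iff single_add)

lemma sfps_uminus: "sfps (- f) = - sfps f"
  by (simp add: fps_eq_iff single_uminus)

lemma sfps_mult: "sfps (f * g) = sfps f * sfps g"
  by (simp add: fps_eq_iff fps_mult_nth scalar_sum mult_single)

lemma sfps_0 [simp]: "sfps 0 = 0"
  by (simp add: fps_eq_iff)

lemma sfps_sum: "sfps (sum f S) = (\<Sum>x\<in>S. sfps (f x))"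
  by (induction S rule: infinite_finite_induct) (simp_all add: sfps_add)

lemma sfps_dz: "fps_dz (sfps f) = sfps (fps_dz f)"
  by (auto simp: fps_eq_iff fps_dz_nth scalar_mult[symmetric] single_uminus of_nat_single[symmetric] split: nat.splits)

lemma sD_scalar [simp]: "sD k (scalar c) = 0"
  by (simp add: sD_def)

lemma sD_of_nat [simp]: "sD k (of_nat j) = 0"
  using sD_scalar[of k "of_nat j"] by (simp del: sD_scalar)

definition poly_D :: "nat \<Rightarrow> symbol fps poly \<Rightarrow> symbol fps poly" where
  "poly_D k = map_poly (fps_map (sD k))"

lemma derivation_poly_D: "derivation (poly_D k)"
  unfolding poly_D_def by (intro derivation_map_poly derivation_fps_map derivation_sD)

definition poly_dz :: "'a::comm_ring_1 fps poly \<Rightarrow> 'a fps poly" where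
  "poly_dz = map_poly fps_dz"

lemma derivation_poly_dz: "derivation (poly_dz :: 'a::comm_ring_1 fps poly \<Rightarrow> _)"
  unfolding poly_dz_def by (intro derivation_map_poly derivation_fps_dz)

lemma coeff_poly_D: "fps_nth (coeff (poly_D k W) i) n = sD k (fps_nth (coeff W i) n)"
  by (simp add: poly_D_def coeff_map_poly derivationD[OF derivation_fps_map[OF derivation_sD]])

lemma coeff_poly_dz: "coeff (poly_dz W) i = fps_dz (coeff W i)"
  by (simp add: poly_dz_def coeff_map_poly fps_dz_def)

lemma degree_poly_D: "Polynomial.degree (poly_D k W) \<le> Polynomial.degree W"
  unfolding poly_D_def by (rule degree_map_poly_le)

lemma degree_poly_dz: "Polynomial.degree (poly_dz W) \<le> Polynomial.degree W"
  unfolding poly_dz_def by (rule degree_map_poly_le)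

lemma poly_D_pCons: "poly_D k (pCons f W) = pCons (fps_map (sD k) f) (poly_D k W)"
  by (simp add: poly_eq_iff fps_eq_iff coeff_poly_D coeff_pCons split: nat.split)

lemma poly_dz_pCons: "poly_dz (pCons f W) = pCons (fps_dz f) (poly_dz W)"
  by (simp add: poly_eq_iff coeff_poly_dz coeff_pCons split: nat.split)

text \<open>The symbol of \<open>(\<partial> + g) W\<close>, for \<open>W\<close> with coefficients to the left of \<open>\<partial>\<close>\<close>

definition shifted_dz :: "complex fps \<Rightarrow> symbol fps poly \<Rightarrow> symbol fps poly" where
  "shifted_dz g W = pCons 0 W + poly_dz W + smult (sfps g) W"

text \<open>Substitution of \<open>\<partial> + g\<close> for \<open>\<partial>\<close>\<close>

definition shift :: "complex fps \<Rightarrow> symbol fps poly \<Rightarrow> symbol fps poly" where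
  "shift g W = (\<Sum>j\<le>Polynomial.degree W. smult (coeff W j) ((shifted_dz g ^^ j) 1))"

lemma shift_bound:
  assumes "Polynomial.degree W \<le> n"
  shows "shift g W = (\<Sum>j\<le>n. smult (coeff W j) ((shifted_dz g ^^ j) 1))"
  unfolding shift_def
  by (rule sum.mono_neutral_left) (use assms in \<open>auto simp: coeff_eq_0\<close>)

lemma shift_add: "shift g (V + W) = shift g V + shift g W"
proof -
  let ?n = "max (Polynomial.degree V) (Polynomial.degree W)"
  have "Polynomial.degree (V + W) \<le> ?n" by (rule degree_add_le_max)
  then show ?thesis
    by (simp add: shift_bound[of _ ?n] smult_add_left sum.distrib)
qed

lemma shift_0 [simp]: "shift g 0 = 0"
  by (simp add: shift_def)

lemma shift_1 [simp]: "shift g 1 = 1"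
  by (simp add: shift_def)

lemma shift_smult: "shift g (smult s W) = smult s (shift g W)"
  using shift_bound[of "smult s W" "Polynomial.degree W"]
  by (simp add: degree_smult_le shift_def smult_sum2)

lemma shift_sum: "shift g (sum f S) = (\<Sum>x\<in>S. shift g (f x))"
  by (induction S rule: infinite_finite_induct) (simp_all add: shift_add)

lemma shift_uminus: "shift g (- W) = - shift g W"
  using shift_smult[of g "-1" W] by simp

lemma shift_of_int: "shift g (of_int k * W) = of_int k * shift g W"
  using shift_smult[of g "of_int k" W] by (simp add: of_int_poly)

lemma shifted_dz_add: "shifted_dz g (V + W) = shifted_dz g V + shifted_dz g W"
  by (simp add: shifted_dz_def derivationD[OF derivation_poly_dz] smult_add_right)

lemma shifted_dz_sum: "shifted_dz g (sum f S) = (\<Sum>x\<in>S. shifted_dz g (f x))"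
  by (induction S rule: infinite_finite_induct)
    (simp_all add: shifted_dz_add shifted_dz_def[of g 0] derivationD[OF derivation_poly_dz])

lemma poly_dz_smult: "poly_dz (smult s W) = smult (fps_dz s) W + smult s (poly_dz W)"
  by (simp add: poly_eq_iff coeff_poly_dz derivationD[OF derivation_fps_dz])

lemma shifted_dz_smult: "shifted_dz g (smult s W) = smult s (shifted_dz g W) + smult (fps_dz s) W"
  by (simp add: shifted_dz_def poly_dz_smult smult_add_right) (simp add: mult.commute)

text \<open>\<open>pCons 0 W + poly_dz W\<close> is the symbol of \<partial> W, so the substitution
  turns left multiplication by \<partial> into left multiplication by \<partial> +
  \<open>g\<close>.\<close>

lemma shift_pCons_dz: "shift g (pCons 0 W + poly_dz W) = shifted_dz g (shift g W)"
proof -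
  let ?n = "Polynomial.degree W"
  let ?T = "\<lambda>j. (shifted_dz g ^^ j) 1"
  have "shift g (pCons 0 W) = (\<Sum>j\<le>Suc ?n. smult (coeff (pCons 0 W) j) (?T j))"
    by (rule shift_bound) (rule degree_pCons_le)
  also have "\<dots> = (\<Sum>j\<le>?n. smult (coeff W j) (shifted_dz g (?T j)))"
    by (simp add: sum.atMost_Suc_shift del: sum.atMost_Suc)
  finally have "shift g (pCons 0 W) = (\<Sum>j\<le>?n. smult (coeff W j) (shifted_dz g (?T j)))" .
  moreover have "shift g (poly_dz W) = (\<Sum>j\<le>?n. smult (fps_dz (coeff W j)) (?T j))"
    using shift_bound[OF degree_poly_dz] by (simp add: coeff_poly_dz)
  ultimately show ?thesis
    by (simp add: shift_add shift_def[of g W] shifted_dz_sum shifted_dz_smult sum.distrib)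
qed

lemma poly_D_shifted_dz: "poly_D k (shifted_dz g W) = shifted_dz g (poly_D k W)"
proof -
  have *: "sD k (- f) = - sD k f" "sD k (of_nat j * f) = of_nat j * sD k f" for j f
    using derivationD[OF derivation_sD, of k] by simp_all
  have "sD k (fps_nth (fps_dz f) n) = fps_nth (fps_dz (fps_map (sD k) f)) n" for f n
    by (auto simp: fps_dz_nth * derivationD[OF derivation_sD] split: nat.splits)
  moreover have "poly_D k (pCons 0 W) = pCons 0 (poly_D k W)"
    by (simp add: poly_D_pCons derivationD[OF derivation_fps_map[OF derivation_sD]])
  moreover have "sD k (fps_nth (sfps g * f) n) = fps_nth (sfps g * fps_map (sD k) f) n" for f n
    by (simp add: fps_mult_nth derivation_sum[OF derivation_sD] derivationD[OF derivation_sD])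
  ultimately show ?thesis
    by (simp add: shifted_dz_def derivationD[OF derivation_poly_D])
      (simp add: poly_eq_iff fps_eq_iff coeff_poly_D coeff_poly_dz,
       simp add: poly_D_def coeff_map_poly derivationD[OF derivation_fps_map[OF derivation_sD]])
qed

lemma poly_D_smult: "poly_D k (smult s W) = smult (fps_map (sD k) s) W + smult s (poly_D k W)"
  by (simp add: poly_eq_iff poly_D_def coeff_map_poly derivationD[OF derivation_fps_map[OF derivation_sD]])

text \<open>The powers of \<partial> + \<open>g\<close> applied to 1 do not involve x_k, so the
  derivative meets only the coefficients of \<open>W\<close>.\<close>

lemma poly_D_shift: "poly_D k (shift g W) = shift g (poly_D k W)"
proof -
  have "poly_D k ((shifted_dz g ^^ j) 1) = 0" for j
    by (induction j)
      (simp_all add: poly_D_shifted_dz derivationD[OF derivation_poly_D] shifted_dz_def[of g 0] derivationD[OF derivation_poly_dz])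
  then have "poly_D k (shift g W) =
      (\<Sum>j\<le>Polynomial.degree W. smult (fps_map (sD k) (coeff W j)) ((shifted_dz g ^^ j) 1))"
    by (simp add: shift_def derivation_sum[OF derivation_poly_D] poly_D_smult)
  also have "\<dots> = shift g (poly_D k W)"
    using shift_bound[OF degree_poly_D]
    by (simp add: poly_D_def coeff_map_poly derivationD[OF derivation_fps_map[OF derivation_sD]])
  finally show ?thesis .
qed

text \<open>Substitution is linear over the coefficients on the left and respects left
  multiplication by \<partial>; it thus suffices that the powers of \<partial> + \<open>g\<close>
  are carried back to the powers of \<partial>.\<close>

lemma shift_shift: "shift (- g) (shift g W) = W"
proof -
  have "shift (- g) (shifted_dz g V) = pCons 0 (shift (- g) V) + poly_dz (shift (- g) V)" for V
    using shift_pCons_dz[of "- g" V]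
    by (simp add: shifted_dz_def shift_add shift_smult sfps_uminus)
  then have "shift (- g) ((shifted_dz g ^^ j) 1) = Polynomial.monom 1 j" for j
  proof (induction j)
    case 0
    show ?case by (simp add: monom_0 flip: one_pCons)
  next
    case (Suc j)
    then show ?case
      by (simp add: poly_dz_def map_poly_monom derivationD[OF derivation_fps_dz] Polynomial.monom_Suc)
  qed
  then show ?thesis
    by (simp add: shift_def[of g W] shift_sum shift_smult smult_monom poly_as_sum_of_monoms)
qed

section \<open>Differential operators with normally ordered coefficients\<close>

context normal_ordering
begin

definition op_symbol :: "symbol fps poly \<Rightarrow> nat \<Rightarrow> nat \<Rightarrow> 'a" where
  "op_symbol W i n = quantize (fps_nth (coeff W i) n)"

lemma op_symbol_add: "op_symbol (V + W) i n = op_symbol V i n + op_symbol W i n"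
  by (simp add: op_symbol_def quantize_add)

lemma op_symbol_uminus: "op_symbol (- W) i n = - op_symbol W i n"
  by (simp add: op_symbol_def quantize_uminus)

lemma op_symbol_diff: "op_symbol (V - W) i n = op_symbol V i n - op_symbol W i n"
  by (simp add: op_symbol_def quantize_diff)

lemma op_symbol_sum: "op_symbol (sum f S) i n = (\<Sum>x\<in>S. op_symbol (f x) i n)"
  by (induction S rule: infinite_finite_induct) (simp_all add: op_symbol_add, simp_all add: op_symbol_def)

lemma op_symbol_of_int: "op_symbol (of_int k * W) i n = of_int k * op_symbol W i n"
proof (cases k)
  case (nonneg j)
  have "op_symbol (of_nat j * W) i n = of_nat j * op_symbol W i n"
    by (induction j) (simp_all add: distrib_right op_symbol_add, simp add: op_symbol_def)
  then show ?thesis using nonneg by simp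
next
  case (neg j)
  have "op_symbol (of_nat j * W) i n = of_nat j * op_symbol W i n" for j
    by (induction j) (simp_all add: distrib_right op_symbol_add, simp add: op_symbol_def)
  from this[of "Suc j"] show ?thesis using neg by (simp add: op_symbol_uminus del: of_nat_Suc)
qed

lemma op_symbol_1: "op_symbol 1 = op_one"
  by (simp add: fun_eq_iff op_one_def op_symbol_def quantize_1 coeff_1)

lemma op_dz_op_symbol: "op_dz (op_symbol W) = op_symbol (pCons 0 W + poly_dz W)"
proof (intro ext)
  fix i n
  have "quantize (of_nat j * f) = of_nat j * quantize f" for j f
    using quantize_scalar[of "of_nat j" f] by (simp add: cs_of_nat)
  then show "op_dz (op_symbol W) i n = op_symbol (pCons 0 W + poly_dz W) i n"
    by (simp add: op_dz_def op_symbol_def quantize_add coeff_pCons coeff_poly_dz fps_dz_nth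
        quantize_uminus split: nat.splits)
qed

lemma op_series_op_symbol: "op_series (\<lambda>n. cs (fps_nth F n)) (op_symbol W) = op_symbol (smult (sfps F) W)"
  by (simp add: fun_eq_iff op_series_def op_symbol_def fps_mult_nth quantize_sum quantize_scalar atLeast0AtMost)

text \<open>On symbols, \<open>P k * Q l\<close> becomes multiplication by x_k after \<xi>_l +
  \<partial>/\<partial>x_l.\<close>

lemma op_symbol_quadratic:
  assumes "k < m" "l < m"
  shows "op_symbol (smult (fps_const (sx k)) (smult (fps_const (sxi l)) W + poly_D l W)) i n =
     P k * Q l * op_symbol W i n"
  using assms by (simp add: op_symbol_def quantize_sx quantize_sxi coeff_poly_D mult.assoc)

lemma op_series_quadratic:
  assumes "k < m" "l < m"
  shows "op_series (\<lambda>n. cs (fps_nth F n) * (P k * Q l)) (op_symbol W) =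
     op_symbol (smult (sfps F * fps_const (sx k)) (smult (fps_const (sxi l)) W + poly_D l W))"
proof -
  have "op_series (\<lambda>n. cs (fps_nth F n) * (P k * Q l)) (op_symbol W) =
      op_series (\<lambda>n. cs (fps_nth F n)) (\<lambda>i n. P k * Q l * op_symbol W i n)"
    by (simp add: op_series_def fun_eq_iff mult.assoc)
  also have "(\<lambda>i n. P k * Q l * op_symbol W i n) =
      op_symbol (smult (fps_const (sx k)) (smult (fps_const (sxi l)) W + poly_D l W))"
    using op_symbol_quadratic[OF assms] by (simp add: fun_eq_iff)
  finally show ?thesis by (simp only: op_series_op_symbol smult_smult)
qed

end

lemma op_series_add: "op_series (\<lambda>n. f n + g n) P i n = op_series f P i n + op_series g P i n"
  by (simp add: op_series_def distrib_right sum.distrib)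

lemma op_series_uminus: "op_series (\<lambda>n. - f n) P i n = - op_series f P i n"
  by (simp add: op_series_def sum_negf)

lemma op_series_diff: "op_series (\<lambda>n. f n - g n) P i n = op_series f P i n - op_series g P i n"
  using op_series_add[of f "\<lambda>n. - g n" P i n] by (simp add: op_series_uminus)

lemma op_series_sum: "op_series (\<lambda>n. \<Sum>x\<in>S. f x n) P i n = (\<Sum>x\<in>S. op_series (f x) P i n)"
  by (induction S rule: infinite_finite_induct) (simp_all add: op_series_add, simp_all add: op_series_def)

text \<open>In matrix form this is A + x R^T \<xi>^T, where x and \<xi> are arrays with rows
  \<open>a\<close> and columns \<open>s\<close>, and \<open>v a s\<close> numbers the generator at
  that place. The transpose reflects that the k-th power of the local variable leads from position
  r, carried by \<xi>, to position r + k, carried by x.\<close>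

definition gaudin_symbol :: "nat \<Rightarrow> (nat \<Rightarrow> nat \<Rightarrow> complex) \<Rightarrow> (nat \<Rightarrow> nat \<Rightarrow> complex fps) \<Rightarrow>
    (nat \<Rightarrow> nat \<Rightarrow> nat) \<Rightarrow> nat \<Rightarrow> nat \<Rightarrow> symbol fps" where
  "gaudin_symbol K A R v a b = sfps (fps_const (A a b)) +
     (\<Sum>r=1..K. \<Sum>s=1..K. sfps (R r s) * fps_const (sx (v a s) * sxi (v b r)))"

lemma sD_sx: "sD k (sx l) = (if k = l then 1 else 0)"
  unfolding sD_def sx_def by (subst mpol_deriv_var) simp

lemma sD_sxi [simp]: "sD k (sxi l) = 0"
proof -
  have "2 * k \<noteq> 2 * l + 1" by presburger
  then show ?thesis unfolding sD_def sxi_def by (subst mpol_deriv_var) simp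
qed

lemma fps_map_sD_const: "fps_map (sD k) (fps_const f) = fps_const (sD k f)"
  by (simp add: fps_eq_iff derivationD[OF derivation_sD])

lemma fps_map_sD_sfps [simp]: "fps_map (sD k) (sfps f) = 0"
  by (simp add: fps_eq_iff)

lemma fps_dz_const [simp]: "fps_dz (fps_const c) = 0"
  by (simp add: fps_dz_def)

lemma poly_D_var: "poly_D k [:0, 1:] = 0"
  by (simp add: poly_D_pCons derivationD[OF derivation_fps_map[OF derivation_sD]] derivationD[OF derivation_poly_D])

lemma poly_dz_var: "poly_dz [:0, 1:] = 0"
  by (simp add: poly_dz_pCons derivationD[OF derivation_fps_dz] derivationD[OF derivation_poly_dz])

context normal_ordering
begin

text \<open>Acting on symbols, an entry is \<delta>_ab (\<partial> + \<open>g\<close>) minus A minus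
  the sum of R x (\<xi> + \<partial>/\<partial>x). With \<open>shift g\<close> pulled out in front,
  it is multiplication by the commutative entry plus a derivation, as
  \<open>column_determinant_derivations\<close> demands.\<close>

lemma op_cdet_eq:
  fixes R :: "nat \<Rightarrow> nat \<Rightarrow> complex fps" and v :: "nat \<Rightarrow> nat \<Rightarrow> nat"
  assumes v_inj: "\<And>a b s t. {a, b} \<subseteq> {1..N} \<Longrightarrow> {s, t} \<subseteq> {1..K} \<Longrightarrow> v a s = v b t \<longleftrightarrow> a = b \<and> s = t"
    and v_less: "\<And>a s. a \<in> {1..N} \<Longrightarrow> s \<in> {1..K} \<Longrightarrow> v a s < m"
    and R_dz: "\<And>r s. {r, s} \<subseteq> {1..K} \<Longrightarrow> fps_dz (R r s) = - (\<Sum>q=1..K. R r q * R q s)"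
    and f: "\<And>a b n. {a, b} \<subseteq> {1..N} \<Longrightarrow> f a b n = (if a = b then cs (fps_nth g n) else 0) -
        (if n = 0 then cs (A a b) else 0) -
        (\<Sum>r=1..K. \<Sum>s=1..K. cs (fps_nth (R r s) n) * (P (v a s) * Q (v b r)))"
  shows "op_cdet N f i n = op_symbol (shift g (\<Sum>\<sigma> | \<sigma> permutes {1..N}. of_int (sign \<sigma>) *
     (\<Prod>j\<in>{1..N}. (if \<sigma> j = j then [:0, 1:] else 0) - [:gaudin_symbol K A R v (\<sigma> j) j:]))) i n"
proof -
  let ?I = "{1..K}"
  define M where "M a b = (if a = b then [:0, 1:] else 0) - [:gaudin_symbol K A R v a b:]" for a b
  \<comment> \<open>The effect of \<partial> and of the \<xi> in row \<open>a\<close> and column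
    \<open>c\<close> on the factors to their right, beyond plain multiplication.\<close>
  define d where "d a c W = (if a = c then poly_dz W else 0) -
     (\<Sum>r\<in>?I. \<Sum>s\<in>?I. smult (sfps (R r s) * fps_const (sx (v a s))) (poly_D (v c r) W))" for a c W
  have step: "op_entry (a = b) (f a b) (op_symbol (shift g W)) = op_symbol (shift g (M a b * W + d a b W))"
    if ab: "{a, b} \<subseteq> {1..N}" for a b W
  proof (intro ext)
    fix i n
    let ?V = "shift g W"
    have "op_series (\<lambda>n. \<Sum>r\<in>?I. \<Sum>s\<in>?I. cs (fps_nth (R r s) n) * (P (v a s) * Q (v b r))) (op_symbol ?V) i n =
        (\<Sum>r\<in>?I. \<Sum>s\<in>?I. op_symbol (smult (sfps (R r s) * fps_const (sx (v a s)))
           (smult (fps_const (sxi (v b r))) ?V + poly_D (v b r) ?V)) i n)"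
      unfolding op_series_sum
      by (intro sum.cong refl) (use op_series_quadratic v_less ab in auto)
    moreover have "op_series (\<lambda>n. if n = 0 then cs (A a b) else 0) (op_symbol ?V) i n =
        op_symbol (smult (sfps (fps_const (A a b))) ?V) i n"
      unfolding op_series_op_symbol[symmetric]
      by (intro arg_cong[of _ _ "\<lambda>f. op_series f _ i n"]) (auto simp: fun_eq_iff)
    moreover have "op_series (\<lambda>n. if a = b then cs (fps_nth g n) else 0) (op_symbol ?V) i n =
        (if a = b then op_symbol (smult (sfps g) ?V) i n else 0)"
      using fun_cong[OF fun_cong[OF op_series_op_symbol[of g ?V]], of i n] by (simp add: op_series_def)
    ultimately have "op_entry (a = b) (f a b) (op_symbol ?V) i n =
       op_symbol ((if a = b then shifted_dz g ?V else 0) - smult (sfps (fps_const (A a b))) ?V -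
         (\<Sum>r\<in>?I. \<Sum>s\<in>?I. smult (sfps (R r s) * fps_const (sx (v a s)))
           (smult (fps_const (sxi (v b r))) ?V + poly_D (v b r) ?V))) i n"
      unfolding op_entry_def f[OF ab] op_series_diff
      by (auto simp: op_symbol_diff op_symbol_sum op_dz_op_symbol shifted_dz_def op_symbol_add)
        (simp_all add: op_symbol_def)
    also have "(if a = b then shifted_dz g ?V else 0) - smult (sfps (fps_const (A a b))) ?V -
         (\<Sum>r\<in>?I. \<Sum>s\<in>?I. smult (sfps (R r s) * fps_const (sx (v a s)))
           (smult (fps_const (sxi (v b r))) ?V + poly_D (v b r) ?V)) =
       shift g (M a b * W + d a b W)"
    proof -
      have "shift g (\<Sum>r\<in>?I. \<Sum>s\<in>?I. smult (sfps (R r s) * fps_const (sx (v a s)))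
           (smult (fps_const (sxi (v b r))) W + poly_D (v b r) W)) =
         (\<Sum>r\<in>?I. \<Sum>s\<in>?I. smult (sfps (R r s) * fps_const (sx (v a s)))
           (smult (fps_const (sxi (v b r))) ?V + poly_D (v b r) ?V))"
        by (simp add: shift_sum shift_smult shift_add poly_D_shift)
      moreover have "shift g ((if a = b then pCons 0 W + poly_dz W else 0) -
           smult (sfps (fps_const (A a b))) W) =
         (if a = b then shifted_dz g ?V else 0) - smult (sfps (fps_const (A a b))) ?V"
        using shift_add[of g _ "- smult (sfps (fps_const (A a b))) W"]
        by (simp add: shift_pCons_dz shift_uminus shift_smult)
      moreover have "M a b * W + d a b W = (if a = b then pCons 0 W + poly_dz W else 0) -
           smult (sfps (fps_const (A a b))) W -
         (\<Sum>r\<in>?I. \<Sum>s\<in>?I. smult (sfps (R r s) * fps_const (sx (v a s)))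
           (smult (fps_const (sxi (v b r))) W + poly_D (v b r) W))"
      proof -
        have "smult (\<Sum>r\<in>?I. \<Sum>s\<in>?I. sfps (R r s) * fps_const (sx (v a s) * sxi (v b r))) W =
           (\<Sum>r\<in>?I. \<Sum>s\<in>?I. smult (sfps (R r s) * fps_const (sx (v a s))) (smult (fps_const (sxi (v b r))) W))"
          by (simp add: smult_sum mult.assoc flip: fps_const_mult)
        then show ?thesis
          by (auto simp: M_def d_def gaudin_symbol_def left_diff_distrib smult_add_left smult_add_right sum.distrib)
      qed
      ultimately show ?thesis
        using shift_add[of g "(if a = b then pCons 0 W + poly_dz W else 0) -
           smult (sfps (fps_const (A a b))) W" "- (\<Sum>r\<in>?I. \<Sum>s\<in>?I. smult (sfps (R r s) * fps_const (sx (v a s)))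
           (smult (fps_const (sxi (v b r))) W + poly_D (v b r) W))"]
        by (simp add: shift_uminus)
    qed
    finally show "op_entry (a = b) (f a b) (op_symbol ?V) i n = op_symbol (shift g (M a b * W + d a b W)) i n" .
  qed
  have derivation: "derivation (d a c)" for a c
  proof -
    have "derivation (\<lambda>W. \<Sum>r\<in>?I. \<Sum>s\<in>?I. [:sfps (R r s) * fps_const (sx (v a s)):] * poly_D (v c r) W)"
      by (simp add: derivation_def derivationD[OF derivation_poly_D] sum.distrib[symmetric]
        sum_distrib_left sum_distrib_right smult_add_right algebra_simps)
    then show ?thesis
      using derivation_poly_dz derivation_zero derivation_add_scaled[of _ _ "-1"]
      by (auto simp: d_def derivation_def algebra_simps)
  qed
  have sym: "d a c (M b j) = d b c (M a j)" if abcj: "{a, b, c, j} \<subseteq> {1..N}" for a b c j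
  proof -
    \<comment> \<open>The quadratic part of the entry with R replaced by its square. The square
      comes from \<partial> through \<open>R_dz\<close>, and from \<partial>/\<partial>x because
      that derivative joins the R of one entry to the R of the next.\<close>
    define Y where "Y b = (\<Sum>r\<in>?I. \<Sum>s\<in>?I. \<Sum>q\<in>?I. sfps (R r q * R q s) * fps_const (sx (v b s) * sxi (v j r)))" for b
    \<comment> \<open>The first summand is due to \<partial>, the second to reordering; together
      they are visibly symmetric in \<open>a\<close> and \<open>b\<close>.\<close>
    have "d a c (M b j) = (if a = c then [:Y b:] else 0) + (if b = c then [:Y a:] else 0)"
      if "{a, b, c} \<subseteq> {1..N}" for a b
    proof -
      have "fps_dz (sfps (R r s) * fps_const x) = - (\<Sum>q\<in>?I. sfps (R r q * R q s) * fps_const x)"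
        if "r \<in> ?I" "s \<in> ?I" for r s x
        using that by (simp add: derivationD[OF derivation_fps_dz] sfps_dz R_dz sfps_uminus sfps_sum
            sum_distrib_right)
      then have "fps_dz (gaudin_symbol K A R v b j) = - Y b"
        by (simp add: gaudin_symbol_def Y_def derivationD[OF derivation_fps_dz]
            derivation_sum[OF derivation_fps_dz] sfps_dz sum_negf del: fps_const_mult)
      then have 1: "poly_dz (M b j) = [:Y b:]"
        by (simp add: M_def derivationD[OF derivation_poly_dz] derivationD[OF derivation_fps_dz]
            poly_dz_pCons poly_dz_var)
      have "fps_map (sD (v c r)) (gaudin_symbol K A R v b j) = (if b = c then \<Sum>q\<in>?I. sfps (R q r) * fps_const (sxi (v j q)) else 0)"
        if r: "r \<in> ?I" for r
      proof -
        note D = derivation_fps_map[OF derivation_sD, of "v c r"]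
        have "fps_map (sD (v c r)) (sfps (R q s) * fps_const (sx (v b s) * sxi (v j q))) =
            (if s = r then if b = c then sfps (R q r) * fps_const (sxi (v j q)) else 0 else 0)"
          if "q \<in> ?I" "s \<in> ?I" for q s
          using v_inj[of c b r s] \<open>{a, b, c} \<subseteq> _\<close> r that
          by (auto simp: derivationD[OF D] fps_map_sD_const derivationD[OF derivation_sD] sD_sx
              simp del: fps_const_mult)
        then show ?thesis
          using r by (simp add: gaudin_symbol_def derivationD[OF D] derivation_sum[OF D] if_distrib cong: if_cong)
      qed
      then have 2: "poly_D (v c r) (M b j) = (if b = c then - [:\<Sum>q\<in>?I. sfps (R q r) * fps_const (sxi (v j q)):] else 0)"
        if "r \<in> ?I" for r
        using that by (simp add: M_def derivationD[OF derivation_poly_D] poly_D_pCons poly_D_var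
            derivationD[OF derivation_fps_map[OF derivation_sD]])
      have "(\<Sum>r\<in>?I. \<Sum>s\<in>?I. smult (sfps (R r s) * fps_const (sx (v a s))) (poly_D (v c r) (M b j))) =
         (if b = c then - [:Y a:] else 0)"
      proof -
        have "(\<Sum>r\<in>?I. \<Sum>s\<in>?I. sfps (R r s) * fps_const (sx (v a s)) *
             (\<Sum>q\<in>?I. sfps (R q r) * fps_const (sxi (v j q)))) =
           (\<Sum>r\<in>?I. \<Sum>s\<in>?I. \<Sum>q\<in>?I. sfps (R q r * R r s) * fps_const (sx (v a s) * sxi (v j q)))"
          by (simp add: sum_distrib_left sfps_mult mult_ac flip: fps_const_mult)
        also have "\<dots> = (\<Sum>s\<in>?I. \<Sum>r\<in>?I. \<Sum>q\<in>?I. sfps (R q r * R r s) * fps_const (sx (v a s) * sxi (v j q)))"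
          by (rule sum.swap)
        also have "\<dots> = (\<Sum>s\<in>?I. \<Sum>q\<in>?I. \<Sum>r\<in>?I. sfps (R q r * R r s) * fps_const (sx (v a s) * sxi (v j q)))"
          by (intro sum.cong refl sum.swap)
        also have "\<dots> = Y a"
          unfolding Y_def by (rule sum.swap)
        finally show ?thesis
          using 2 by (simp add: sum_to_poly sum_negf)
      qed
      then show ?thesis unfolding d_def 1 by (cases "b = c") simp_all
    qed
    from this[of a b] this[of b a] abcj show ?thesis by auto
  qed
  have two: "x = 0" if "x + x = 0" for x :: "symbol fps poly"
  proof -
    have "Poly_Mapping.lookup (fps_nth (coeff (x + x) i) n) \<mu> = 0" for i n \<mu>
      unfolding that by simp
    then have "Poly_Mapping.lookup (fps_nth (coeff x i) n) \<mu> = 0" for i n \<mu>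
      unfolding coeff_add fps_add_nth lookup_add by simp
    then show ?thesis
      by (simp add: poly_eq_iff fps_eq_iff poly_mapping_eq_iff fun_eq_iff)
  qed
  let ?fold = "\<lambda>\<sigma> js. foldr (\<lambda>j W. M (\<sigma> j) j * W + d (\<sigma> j) j W) js 1"
  have fold: "foldr (\<lambda>j. op_entry (\<sigma> j = j) (f (\<sigma> j) j)) js op_one = op_symbol (shift g (?fold \<sigma> js))"
    if "\<sigma> permutes {1..N}" "set js \<subseteq> {1..N}" for \<sigma> js
    using that(2)
  proof (induction js)
    case Nil
    then show ?case by (simp add: op_symbol_1)
  next
    case (Cons j js)
    then have "{\<sigma> j, j} \<subseteq> {1..N}" using permutes_in_image[OF that(1), of j] by auto
    from step[OF this] Cons show ?case by simp
  qed
  have "op_cdet N f i n = (\<Sum>\<sigma> | \<sigma> permutes {1..N}. of_int (sign \<sigma>) * op_symbol (shift g (?fold \<sigma> [1..<Suc N])) i n)"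
    unfolding op_cdet_def
  proof (rule sum.cong[OF refl])
    fix \<sigma> assume "\<sigma> \<in> {\<sigma>. \<sigma> permutes {1..N}}"
    then show "of_int (sign \<sigma>) * foldr (\<lambda>j. op_entry (\<sigma> j = j) (f (\<sigma> j) j)) [1..<Suc N] op_one i n =
        of_int (sign \<sigma>) * op_symbol (shift g (?fold \<sigma> [1..<Suc N])) i n"
      by (subst fold) auto
  qed
  also have "\<dots> = op_symbol (shift g (\<Sum>\<sigma> | \<sigma> permutes {1..N}. of_int (sign \<sigma>) * ?fold \<sigma> [1..<Suc N])) i n"
    by (simp add: shift_sum shift_of_int op_symbol_sum op_symbol_of_int del: upt_Suc)
  also have "\<dots> = op_symbol (shift g (\<Sum>\<sigma> | \<sigma> permutes {1..N}. of_int (sign \<sigma>) * (\<Prod>j\<in>{1..N}. M (\<sigma> j) j))) i n"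
    by (subst column_determinant_derivations[OF derivationD(1)[OF derivation] derivationD(2)[OF derivation] sym two])
      simp_all
  finally show ?thesis unfolding M_def .
qed

end

section \<open>Duality of characteristic polynomials\<close>

text \<open>Gaudin determinants are sums over permutations of 1, ..., N, but \<open>det\<close>
  numbers rows from 0; conjugation by \<open>Suc\<close> identifies the permutations and keeps their
  signs.\<close>

lemma det_shift_index:
  fixes h :: "nat \<Rightarrow> nat \<Rightarrow> 'a::comm_ring_1"
  shows "(\<Sum>\<sigma> | \<sigma> permutes {1..N}. of_int (sign \<sigma>) * (\<Prod>j\<in>{1..N}. h (\<sigma> j) j)) =
    det (mat N N (\<lambda>(i, j). h (Suc i) (Suc j)))"
proof -
  let ?M = "mat N N (\<lambda>(i, j). h (Suc i) (Suc j))"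
  let ?F = "map_permutation {0..<N} Suc"
  have bij: "bij_betw Suc {0..<N} {1..N}"
    by (auto simp: bij_betw_def image_Suc_atLeastLessThan atLeastLessThanSuc_atLeastAtMost)
  have F: "?F = (\<lambda>\<sigma> x. if x \<in> {1..N} then Suc (\<sigma> (inv_into {0..<N} Suc x)) else x)"
    by (auto simp: fun_eq_iff map_permutation_def restrict_id_def image_Suc_atLeastLessThan)
  have "(\<Sum>\<sigma> | \<sigma> permutes {1..N}. of_int (sign \<sigma>) * (\<Prod>j\<in>{1..N}. h (\<sigma> j) j)) =
      (\<Sum>\<sigma> | \<sigma> permutes {0..<N}. of_int (sign (?F \<sigma>)) * (\<Prod>j\<in>{1..N}. h (?F \<sigma> j) j))"
    unfolding F by (rule sum.reindex_bij_betw[symmetric, OF bij_betw_permutations[OF bij]])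
  also have "\<dots> = (\<Sum>\<sigma> | \<sigma> permutes {0..<N}. of_int (sign \<sigma>) * (\<Prod>j<N. ?M $$ (\<sigma> j, j)))"
  proof (rule sum.cong[OF refl])
    fix \<sigma> assume "\<sigma> \<in> {\<sigma>. \<sigma> permutes {0..<N}}"
    then have \<sigma>: "\<sigma> permutes {0..<N}" by simp
    have "(\<Prod>j\<in>{1..N}. h (?F \<sigma> j) j) = (\<Prod>j<N. h (?F \<sigma> (Suc j)) (Suc j))"
      by (simp add: prod.atLeast1_atMost_eq)
    also have "\<dots> = (\<Prod>j<N. ?M $$ (\<sigma> j, j))"
    proof (rule prod.cong[OF refl])
      fix j assume "j \<in> {..<N}"
      moreover from this have "\<sigma> j < N" using permutes_in_image[OF \<sigma>, of j] by auto
      ultimately show "h (?F \<sigma> (Suc j)) (Suc j) = ?M $$ (\<sigma> j, j)"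
        by (simp add: map_permutation_apply)
    qed
    finally show "of_int (sign (?F \<sigma>)) * (\<Prod>j\<in>{1..N}. h (?F \<sigma> j) j) =
        of_int (sign \<sigma>) * (\<Prod>j<N. ?M $$ (\<sigma> j, j))"
      using sign_map_permutation[of Suc "{0..<N}", OF _ \<sigma>] by simp
  qed
  also have "\<dots> = det ?M"
    by (subst det_col[of _ N]) simp_all
  finally show ?thesis .
qed

text \<open>Left multiplication by a unipotent block matrix clears the lower left block, because - X
  P' P + X = 0.\<close>

lemma det_four_block_left_inverse:
  fixes P :: "'a::idom mat"
  assumes [simp]: "P \<in> carrier_mat n n" "P' \<in> carrier_mat n n" "Q \<in> carrier_mat n k"
    "X \<in> carrier_mat k n" "T \<in> carrier_mat k k" and inv: "P' * P = 1\<^sub>m n"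
  shows "det (four_block_mat P Q X T) = det P * det (T - X * P' * Q)"
proof -
  let ?E = "four_block_mat (1\<^sub>m n) (0\<^sub>m n k) (- (X * P')) (1\<^sub>m k)"
  have X: "- (X * P') * P = - X"
    using assms(1-5)[THEN carrier_matD(1)] assms(1-5)[THEN carrier_matD(2)]
    by (subst uminus_mult_left_mat) (simp_all add: assoc_mult_mat[of X k n P' n P n] inv right_mult_one_mat[of X k n])
  have Y [simp]: "X * P' \<in> carrier_mat k n" by (rule mult_carrier_mat[of _ _ n]) simp_all
  have "X * P' * Q \<in> carrier_mat k k" by (rule mult_carrier_mat[of _ _ n]) simp_all
  then have [simp]: "T - X * P' * Q \<in> carrier_mat k k" by (rule minus_carrier_mat)
  have "?E * four_block_mat P Q X T = four_block_mat (1\<^sub>m n * P + 0\<^sub>m n k * X) (1\<^sub>m n * Q + 0\<^sub>m n k * T)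
      (- (X * P') * P + 1\<^sub>m k * X) (- (X * P') * Q + 1\<^sub>m k * T)"
    by (rule mult_four_block_mat[of _ n n _ k _ k _ _ n _ k]) simp_all
  also have "1\<^sub>m n * P + 0\<^sub>m n k * X = P"
    by (simp add: left_mult_one_mat[of _ n n] left_mult_zero_mat[of _ k n] right_add_zero_mat[of _ n n])
  also have "1\<^sub>m n * Q + 0\<^sub>m n k * T = Q"
    by (simp add: left_mult_one_mat[of _ n k] left_mult_zero_mat[of _ k k] right_add_zero_mat[of _ n k])
  also have "- (X * P') * P + 1\<^sub>m k * X = 0\<^sub>m k n"
    unfolding X by (simp add: left_mult_one_mat[of _ k n] uminus_l_inv_mat[of _ k n])
  also have "- (X * P') * Q + 1\<^sub>m k * T = T - X * P' * Q"
    using assms(1-5)[THEN carrier_matD(1)] assms(1-5)[THEN carrier_matD(2)]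
    by (subst uminus_mult_left_mat) (auto simp: left_mult_one_mat[of _ k k] intro!: eq_matI)
  finally have "?E * four_block_mat P Q X T = four_block_mat P Q (0\<^sub>m k n) (T - X * P' * Q)" .
  moreover have "det ?E = 1"
    by (subst det_four_block_mat_upper_right_zero[of _ n]) auto
  moreover have "det (four_block_mat P Q (0\<^sub>m k n) (T - X * P' * Q)) = det P * det (T - X * P' * Q)"
    by (rule det_four_block_mat_lower_left_zero[of _ n _ k]) simp_all
  ultimately show ?thesis
    using det_mult[of ?E "n + k" "four_block_mat P Q X T"] by simp
qed

text \<open>The mirror image, by column operations. The two one-sided versions match the resolvents
  at hand: a resolvent is given as a right inverse, and its transpose is a left inverse of the
  transposed matrix.\<close>

lemma det_four_block_right_inverse:
  fixes P :: "'a::idom mat"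
  assumes [simp]: "P \<in> carrier_mat n n" "T' \<in> carrier_mat k k" "Q \<in> carrier_mat n k"
    "X \<in> carrier_mat k n" "T \<in> carrier_mat k k" and inv: "T * T' = 1\<^sub>m k"
  shows "det (four_block_mat P Q X T) = det T * det (P - Q * T' * X)"
proof -
  let ?E = "four_block_mat (1\<^sub>m n) (0\<^sub>m n k) (- (T' * X)) (1\<^sub>m k)"
  have X: "T * - (T' * X) = - X"
    using assms(1-5)[THEN carrier_matD(1)] assms(1-5)[THEN carrier_matD(2)]
    by (subst uminus_mult_right_mat) (simp_all add: assoc_mult_mat[symmetric, of T k k T' k X n] inv left_mult_one_mat[of X k n])
  have Y [simp]: "T' * X \<in> carrier_mat k n" by (rule mult_carrier_mat[of _ _ k]) simp_all
  have "Q * T' * X \<in> carrier_mat n n"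
    by (rule mult_carrier_mat[of _ _ k], rule mult_carrier_mat[of _ _ k]) simp_all
  then have [simp]: "P - Q * T' * X \<in> carrier_mat n n" by (rule minus_carrier_mat)
  have "four_block_mat P Q X T * ?E = four_block_mat (P * 1\<^sub>m n + Q * - (T' * X)) (P * 0\<^sub>m n k + Q * 1\<^sub>m k)
      (X * 1\<^sub>m n + T * - (T' * X)) (X * 0\<^sub>m n k + T * 1\<^sub>m k)"
    by (rule mult_four_block_mat[of _ n n _ k _ k _ _ n _ k]) simp_all
  also have "P * 1\<^sub>m n + Q * - (T' * X) = P - Q * T' * X"
    using assms(1-5)[THEN carrier_matD(1)] assms(1-5)[THEN carrier_matD(2)]
    by (subst uminus_mult_right_mat)
      (auto simp: right_mult_one_mat[of _ n n] assoc_mult_mat[of Q n k T' k X n] intro!: eq_matI)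
  also have "P * 0\<^sub>m n k + Q * 1\<^sub>m k = Q"
    by (simp add: right_mult_one_mat[of _ n k] right_mult_zero_mat[of _ n n] left_add_zero_mat[of _ n k])
  also have "X * 1\<^sub>m n + T * - (T' * X) = 0\<^sub>m k n"
    unfolding X using assms(4)[THEN carrier_matD(1)] assms(4)[THEN carrier_matD(2)] by (auto simp: right_mult_one_mat[of _ k n] intro!: eq_matI)
  also have "X * 0\<^sub>m n k + T * 1\<^sub>m k = T"
    by (simp add: right_mult_one_mat[of _ k k] right_mult_zero_mat[of _ k n] left_add_zero_mat[of _ k k])
  finally have "four_block_mat P Q X T * ?E = four_block_mat (P - Q * T' * X) Q (0\<^sub>m k n) T" .
  moreover have "det ?E = 1"
    by (subst det_four_block_mat_upper_right_zero[of _ n]) auto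
  moreover have "det (four_block_mat (P - Q * T' * X) Q (0\<^sub>m k n) T) = det (P - Q * T' * X) * det T"
    by (rule det_four_block_mat_lower_left_zero[of _ n _ k]) simp_all
  ultimately show ?thesis
    using det_mult[of "four_block_mat P Q X T" "n + k" ?E] by (simp add: mult.commute)
qed

subsection \<open>Coefficients in a subspace\<close>

text \<open>Two families have the same span when every subspace that contains one of them contains
  the other; quantifying over subspaces avoids explicit linear combinations.\<close>

definition symbol_subspace :: "symbol set \<Rightarrow> bool" where
  "symbol_subspace V \<longleftrightarrow> 0 \<in> V \<and> (\<forall>f\<in>V. \<forall>g\<in>V. f + g \<in> V) \<and> (\<forall>c. \<forall>f\<in>V. scalar c * f \<in> V)"

lemma symbol_subspaceD:
  assumes "symbol_subspace V"
  shows "0 \<in> V" "f \<in> V \<Longrightarrow> g \<in> V \<Longrightarrow> f + g \<in> V" "f \<in> V \<Longrightarrow> scalar c * f \<in> V" "f \<in> V \<Longrightarrow> - f \<in> V"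
    "f \<in> V \<Longrightarrow> g \<in> V \<Longrightarrow> f - g \<in> V"
proof -
  show "0 \<in> V" and add: "f \<in> V \<Longrightarrow> g \<in> V \<Longrightarrow> f + g \<in> V" and scale: "f \<in> V \<Longrightarrow> scalar c * f \<in> V" for f g c
    using assms by (auto simp: symbol_subspace_def)
  show uminus: "f \<in> V \<Longrightarrow> - f \<in> V" for f
    using scale[of f "-1"] by (simp add: single_uminus)
  show "f \<in> V \<Longrightarrow> g \<in> V \<Longrightarrow> f - g \<in> V"
    using add[of f "- g"] uminus[of g] by simp
qed

lemma symbol_subspace_sum:
  "symbol_subspace V \<Longrightarrow> (\<And>x. x \<in> S \<Longrightarrow> f x \<in> V) \<Longrightarrow> sum f S \<in> V"
  by (induction S rule: infinite_finite_induct) (simp_all add: symbol_subspaceD)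

lemma symbol_subspace_scalars: "symbol_subspace (range scalar)"
proof -
  have "(0::symbol) \<in> range scalar" by (rule range_eqI[of _ _ 0]) simp
  then show ?thesis by (auto simp: symbol_subspace_def scalar_mult single_add[symmetric])
qed

definition coeffs_in :: "symbol set \<Rightarrow> symbol fps poly \<Rightarrow> bool" where
  "coeffs_in V W \<longleftrightarrow> (\<forall>i n. fps_nth (coeff W i) n \<in> V)"

lemma coeffs_in_add: "symbol_subspace V \<Longrightarrow> coeffs_in V f \<Longrightarrow> coeffs_in V g \<Longrightarrow> coeffs_in V (f + g)"
  by (simp add: coeffs_in_def symbol_subspaceD)

lemma coeffs_in_sum: "symbol_subspace V \<Longrightarrow> (\<And>x. x \<in> S \<Longrightarrow> coeffs_in V (f x)) \<Longrightarrow> coeffs_in V (sum f S)"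
  by (induction S rule: infinite_finite_induct) (simp_all add: coeffs_in_add, simp_all add: coeffs_in_def symbol_subspaceD)

text \<open>The powers of \<partial> + \<open>g\<close> have complex coefficients, so each
  coefficient of \<open>shift g W\<close> is a finite linear combination of coefficients of
  \<open>W\<close>.\<close>

lemma coeffs_in_shift:
  assumes V: "symbol_subspace V" and W: "coeffs_in V W"
  shows "coeffs_in V (shift g W)"
proof -
  let ?C = "range scalar"
  note C = symbol_subspace_scalars
  have scal: "fps_nth (sfps f * h) n \<in> ?C" if "\<And>n. fps_nth h n \<in> ?C" for f h n
    unfolding fps_mult_nth using that by (intro symbol_subspace_sum[OF C]) (auto intro!: symbol_subspaceD(3)[OF C])
  have dz: "fps_nth (fps_dz h) n \<in> ?C" if "\<And>n. fps_nth h n \<in> ?C" for h n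
  proof (cases n)
    case (Suc n')
    have "of_nat n' * fps_nth h n' = scalar (of_nat n') * fps_nth h n'" by simp
    then show ?thesis
      using Suc symbol_subspaceD(1,3,4)[OF C] that by (auto simp: fps_dz_nth simp del: single_of_nat)
  qed (use symbol_subspaceD(1)[OF C] in \<open>simp add: fps_dz_nth\<close>)
  have step: "coeffs_in ?C (shifted_dz g f)" if f: "coeffs_in ?C f" for f
  proof -
    have "coeffs_in ?C (pCons 0 f)"
      using f symbol_subspaceD(1)[OF C] by (auto simp: coeffs_in_def coeff_pCons split: nat.split)
    moreover have "coeffs_in ?C (poly_dz f)"
      using f dz by (simp add: coeffs_in_def coeff_poly_dz)
    moreover have "coeffs_in ?C (smult (sfps g) f)"
      using f scal by (simp add: coeffs_in_def)
    ultimately show ?thesis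
      unfolding shifted_dz_def by (intro coeffs_in_add[OF C])
  qed
  have "coeffs_in ?C ((shifted_dz g ^^ j) 1)" for j
  proof (induction j)
    case 0
    have "(0::symbol) \<in> ?C" "(1::symbol) \<in> ?C" using single_zero single_one by (metis rangeI)+
    then show ?case by (auto simp: coeffs_in_def coeff_1)
  qed (simp add: step)
  then have T: "coeffs_in ?C ((shifted_dz g ^^ j) 1)" for j .
  have "coeffs_in V (smult (coeff W j) ((shifted_dz g ^^ j) 1))" for j
    unfolding coeffs_in_def coeff_smult fps_mult_nth
  proof (intro allI symbol_subspace_sum[OF V])
    fix i n k
    obtain c where "fps_nth (coeff ((shifted_dz g ^^ j) 1) i) (n - k) = scalar c"
      using T[of j] by (auto simp: coeffs_in_def)
    then show "fps_nth (coeff W j) k * fps_nth (coeff ((shifted_dz g ^^ j) 1) i) (n - k) \<in> V"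
      using symbol_subspaceD(3)[OF V] W by (metis coeffs_in_def mult.commute)
  qed
  then show ?thesis
    unfolding shift_def by (intro coeffs_in_sum[OF V])
qed

lemma coeffs_in_shift_iff: "symbol_subspace V \<Longrightarrow> coeffs_in V (shift g W) \<longleftrightarrow> coeffs_in V W"
  using coeffs_in_shift[of V W g] coeffs_in_shift[of V "shift g W" "- g"] shift_shift[of g W] by metis

definition fls_coeffs_in :: "symbol set \<Rightarrow> symbol fls \<Rightarrow> bool" where
  "fls_coeffs_in V f \<longleftrightarrow> (\<forall>n. fls_nth f n \<in> V)"

abbreviation scalar_fls :: "symbol fls \<Rightarrow> bool" where
  "scalar_fls \<equiv> fls_coeffs_in (range scalar)"

lemma fls_coeffs_in_add: "symbol_subspace V \<Longrightarrow> fls_coeffs_in V f \<Longrightarrow> fls_coeffs_in V g \<Longrightarrow> fls_coeffs_in V (f + g)"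
  by (simp add: fls_coeffs_in_def symbol_subspaceD)

lemma fls_coeffs_in_0: "symbol_subspace V \<Longrightarrow> fls_coeffs_in V 0"
  by (simp add: fls_coeffs_in_def symbol_subspaceD)

lemma fls_coeffs_in_sum: "symbol_subspace V \<Longrightarrow> (\<And>x. x \<in> S \<Longrightarrow> fls_coeffs_in V (f x)) \<Longrightarrow> fls_coeffs_in V (sum f S)"
  by (induction S rule: infinite_finite_induct) (simp_all add: fls_coeffs_in_add fls_coeffs_in_0)

text \<open>A Laurent series has finitely many negative exponents, so each coefficient of the
  product is a finite combination of coefficients of \<open>g\<close> with complex weights.\<close>

lemma fls_coeffs_in_mult:
  assumes V: "symbol_subspace V" and f: "scalar_fls f" and g: "fls_coeffs_in V g"
  shows "fls_coeffs_in V (f * g)"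
  unfolding fls_coeffs_in_def fls_times_nth(2)
proof (intro allI symbol_subspace_sum[OF V])
  fix n i
  obtain c where "fls_nth f i = scalar c" using f by (auto simp: fls_coeffs_in_def)
  then show "fls_nth f i * fls_nth g (n - i) \<in> V"
    using symbol_subspaceD(3)[OF V] g by (simp add: fls_coeffs_in_def)
qed

lemma scalar_fls_1: "scalar_fls 1"
proof -
  have "(0::symbol) \<in> range scalar" "(1::symbol) \<in> range scalar"
    using single_zero single_one by (metis rangeI)+
  then show ?thesis by (simp add: fls_coeffs_in_def)
qed

lemma scalar_fls_prod: "(\<And>x. x \<in> S \<Longrightarrow> scalar_fls (f x)) \<Longrightarrow> scalar_fls (prod f S)"
  by (induction S rule: infinite_finite_induct)
    (simp_all add: scalar_fls_1 fls_coeffs_in_mult symbol_subspace_scalars)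

lemma scalar_fls_uminus: "scalar_fls f \<Longrightarrow> scalar_fls (- f)"
  using symbol_subspaceD(4)[OF symbol_subspace_scalars] by (simp add: fls_coeffs_in_def)

lemma scalar_fls_det:
  assumes "M \<in> carrier_mat n n" "\<And>i j. i < n \<Longrightarrow> j < n \<Longrightarrow> scalar_fls (M $$ (i, j))"
  shows "scalar_fls (det M)"
  unfolding det_def'[OF assms(1)]
proof (intro fls_coeffs_in_sum symbol_subspace_scalars)
  fix p assume "p \<in> {p. p permutes {0..<n}}"
  then have p: "p permutes {0..<n}" by simp
  have "scalar_fls (\<Prod>i = 0..<n. M $$ (i, p i))"
    by (rule scalar_fls_prod, rule assms(2)) (use permutes_in_image[OF p] in auto)
  moreover have "of_int (sign p) = (1::symbol fls) \<or> of_int (sign p) = (- 1::symbol fls)"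
    by (simp add: sign_def)
  ultimately show "scalar_fls (of_int (sign p) * (\<Prod>i = 0..<n. M $$ (i, p i)))"
    using scalar_fls_uminus by auto
qed

text \<open>Multiplication by a scalar series can be undone inside the subspace when the inverse
  series is scalar as well.\<close>

lemma fls_coeffs_in_mult_unit:
  assumes V: "symbol_subspace V" and "scalar_fls f" "scalar_fls f'" "f * f' = 1"
  shows "fls_coeffs_in V (f * g) \<longleftrightarrow> fls_coeffs_in V g"
proof
  assume "fls_coeffs_in V (f * g)"
  then have "fls_coeffs_in V (f' * (f * g))" by (rule fls_coeffs_in_mult[OF V assms(3)])
  moreover have "f' * (f * g) = g"
    using assms(4) by (metis mult.assoc mult.commute mult_1)
  ultimately show "fls_coeffs_in V g" by simp
qed (rule fls_coeffs_in_mult[OF V assms(2)])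

lemma fls_coeffs_in_fps: "symbol_subspace V \<Longrightarrow> fls_coeffs_in V (fps_to_fls f) \<longleftrightarrow> (\<forall>n. fps_nth f n \<in> V)"
proof -
  assume V: "symbol_subspace V"
  have "fls_nth (fps_to_fls f) n = (if n < 0 then 0 else fps_nth f (nat n))" for n by simp
  moreover have "fps_nth f n = fls_nth (fps_to_fls f) (int n)" for n by simp
  ultimately show ?thesis
    unfolding fls_coeffs_in_def using symbol_subspaceD(1)[OF V] by metis
qed

subsection \<open>Evaluation at the inverse of the local parameter\<close>

interpretation fls_const_hom: comm_ring_hom "fls_const :: 'a::comm_ring_1 \<Rightarrow> 'a fls"
  by unfold_locales (simp_all add: fls_plus_const)

interpretation fps_to_fls_hom: comm_ring_hom "fps_to_fls :: 'a::comm_ring_1 fps \<Rightarrow> 'a fls"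
  by unfold_locales (simp_all add: fls_times_fps_to_fls)

interpretation fls_const_poly_hom: map_poly_comm_ring_hom "fls_const :: 'a::comm_ring_1 \<Rightarrow> 'a fls" ..

interpretation fps_to_fls_poly_hom: map_poly_comm_ring_hom "fps_to_fls :: 'a::comm_ring_1 fps \<Rightarrow> 'a fls" ..

text \<open>The Laurent parameter is 1/z, so z is \<open>fls_X_inv\<close>. Power series cannot hold
  z, whence the passage to Laurent series.\<close>

definition eval_inv :: "'a::comm_ring_1 poly \<Rightarrow> 'a fls" where
  "eval_inv q = poly (map_poly fls_const q) fls_X_inv"

interpretation eval_inv_hom: comm_ring_hom "eval_inv :: 'a::comm_ring_1 poly \<Rightarrow> 'a fls"
  by unfold_locales (simp_all add: eval_inv_def hom_distribs)

interpretation eval_inv_poly_hom: map_poly_comm_ring_hom "eval_inv :: 'a::comm_ring_1 poly \<Rightarrow> 'a fls" ..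

text \<open>Sends the outer variable to z and keeps the inner one as polynomial variable, whereas
  \<open>map_poly eval_inv\<close> does the opposite.\<close>

definition swap_eval_inv :: "'a::comm_ring_1 poly poly \<Rightarrow> 'a fls poly" where
  "swap_eval_inv f = poly (map_poly (map_poly fls_const) f) [:fls_X_inv:]"

interpretation fls_const_poly_poly_hom: map_poly_comm_ring_hom "map_poly (fls_const :: 'a::comm_ring_1 \<Rightarrow> 'a fls)" ..

interpretation swap_eval_inv_hom: comm_ring_hom "swap_eval_inv :: 'a::comm_ring_1 poly poly \<Rightarrow> 'a fls poly"
  by unfold_locales (simp_all add: swap_eval_inv_def hom_distribs)

lemma fls_nth_sum: "fls_nth (sum f S) n = (\<Sum>x\<in>S. fls_nth (f x) n)"
  by (induction S rule: infinite_finite_induct) simp_all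

lemma eval_inv_nth: "fls_nth (eval_inv q) n = (if n \<le> 0 then coeff q (nat (- n)) else 0)"
proof -
  have "eval_inv q = (\<Sum>i\<le>Polynomial.degree q. fls_const (coeff q i) * fls_X_inv ^ i)"
    unfolding eval_inv_def poly_altdef
  proof (rule sum.mono_neutral_cong_left)
    show "\<forall>i\<in>{..Polynomial.degree q} - {..Polynomial.degree (map_poly fls_const q)}.
        fls_const (coeff q i) * fls_X_inv ^ i = 0"
      using coeff_eq_0[of "map_poly fls_const q"] by (auto simp: coeff_map_poly)
  qed (simp_all add: degree_map_poly_le coeff_map_poly)
  then have "fls_nth (eval_inv q) n = (\<Sum>i\<le>Polynomial.degree q. if n = - int i then coeff q i else 0)"
    by (simp add: fls_nth_sum) (rule sum.cong, auto)
  also have "\<dots> = (\<Sum>i\<le>Polynomial.degree q. if i = nat (- n) then if n \<le> 0 then coeff q i else 0 else 0)"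
    by (rule sum.cong) auto
  also have "\<dots> = (if n \<le> 0 then coeff q (nat (- n)) else 0)"
    by (auto simp: coeff_eq_0)
  finally show ?thesis .
qed

lemma swap_eval_inv_nth: "fls_nth (coeff (swap_eval_inv f) i) n = (if n \<le> 0 then coeff (coeff f (nat (- n))) i else 0)"
proof -
  have pow: "[:fls_X_inv::'a fls:] ^ j = [:fls_X_inv ^ j:]" for j
    by (induction j) (simp_all add: one_pCons)
  have "swap_eval_inv f = (\<Sum>j\<le>Polynomial.degree f. map_poly fls_const (coeff f j) * [:fls_X_inv:] ^ j)"
    unfolding swap_eval_inv_def poly_altdef
  proof (rule sum.mono_neutral_cong_left)
    show "\<forall>j\<in>{..Polynomial.degree f} - {..Polynomial.degree (map_poly (map_poly fls_const) f)}.
        map_poly fls_const (coeff f j) * [:fls_X_inv:] ^ j = 0"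
      using coeff_eq_0[of "map_poly (map_poly fls_const) f"] by (auto simp: coeff_map_poly)
  qed (simp_all add: degree_map_poly_le coeff_map_poly)
  then have "fls_nth (coeff (swap_eval_inv f) i) n =
      (\<Sum>j\<le>Polynomial.degree f. if n = - int j then coeff (coeff f j) i else 0)"
    by (simp add: coeff_sum fls_nth_sum pow coeff_map_poly mult.commute[of _ "[:_:]"] mult.commute[of "fls_X_inv ^ _"])
      (rule sum.cong, auto)
  also have "\<dots> = (\<Sum>j\<le>Polynomial.degree f. if j = nat (- n) then if n \<le> 0 then coeff (coeff f j) i else 0 else 0)"
    by (rule sum.cong) auto
  also have "\<dots> = (if n \<le> 0 then coeff (coeff f (nat (- n))) i else 0)"
    by (auto simp: coeff_eq_0)
  finally show ?thesis .
qed

text \<open>Both evaluations only rearrange the same doubly indexed array of coefficients and pad it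
  with zeros.\<close>

lemma coeffs_in_eval_inv_iff:
  assumes "symbol_subspace V"
  shows "(\<forall>j. fls_coeffs_in V (coeff (map_poly eval_inv f) j)) \<longleftrightarrow> (\<forall>i j. coeff (coeff f j) i \<in> V)"
    and "(\<forall>i. fls_coeffs_in V (coeff (swap_eval_inv f) i)) \<longleftrightarrow> (\<forall>i j. coeff (coeff f j) i \<in> V)"
proof -
  have *: "(\<forall>n. (if n \<le> (0::int) then a (nat (- n)) else 0) \<in> V) \<longleftrightarrow> (\<forall>i. a i \<in> V)" for a
  proof
    assume "\<forall>n. (if n \<le> (0::int) then a (nat (- n)) else 0) \<in> V"
    then have "(if - int i \<le> (0::int) then a (nat (- (- int i))) else 0) \<in> V" for i by blast
    then show "\<forall>i. a i \<in> V" by simp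
  qed (use symbol_subspaceD(1)[OF assms] in auto)
  show "(\<forall>j. fls_coeffs_in V (coeff (map_poly eval_inv f) j)) \<longleftrightarrow> (\<forall>i j. coeff (coeff f j) i \<in> V)"
    using * by (auto simp: fls_coeffs_in_def coeff_map_poly eval_inv_nth)
  show "(\<forall>i. fls_coeffs_in V (coeff (swap_eval_inv f) i)) \<longleftrightarrow> (\<forall>i j. coeff (coeff f j) i \<in> V)"
    unfolding fls_coeffs_in_def swap_eval_inv_nth by (intro iff_allI *[of "\<lambda>j. coeff (coeff f j) _"])
qed

interpretation const_poly_hom: comm_ring_hom "\<lambda>a::'a::comm_ring_1. [:a:]"
  by unfold_locales (simp_all add: one_pCons)

section \<open>Resolvents as Laurent series and the two readings of the block determinant\<close>

definition fls_res :: "complex fps \<Rightarrow> symbol fls" where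
  "fls_res f = fps_to_fls (sfps f)"

lemma sfps_const: "sfps (fps_const c) = fps_const (scalar c)"
  by (simp add: fps_eq_iff)

lemma fls_res_simps:
  "fls_res (f + g) = fls_res f + fls_res g" "fls_res (f * g) = fls_res f * fls_res g"
  "fls_res (f - g) = fls_res f - fls_res g"
  "fls_res 0 = 0" "fls_res fps_X = fls_X" "fls_res (fps_const c) = fls_const (scalar c)"
proof -
  have "sfps fps_X = fps_X" by (simp add: fps_eq_iff)
  then show "fls_res fps_X = fls_X" by (simp add: fls_res_def fps_X_to_fls)
  show "fls_res (fps_const c) = fls_const (scalar c)"
    by (simp add: fls_res_def sfps_const fps_const_to_fls)
  show "fls_res (f - g) = fls_res f - fls_res g"
    using sfps_add[of f "- g"] by (simp add: fls_res_def sfps_uminus)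
qed (simp_all add: fls_res_def sfps_add sfps_mult fls_times_fps_to_fls)

lemma fls_res_sum: "fls_res (sum f S) = (\<Sum>x\<in>S. fls_res (f x))"
  by (induction S rule: infinite_finite_induct) (simp_all add: fls_res_simps)

lemma scalar_fls_res: "scalar_fls (fls_res f)"
  unfolding fls_res_def by (subst fls_coeffs_in_fps[OF symbol_subspace_scalars]) simp

lemma scalar_fls_const: "scalar_fls (fls_const (scalar c))"
  by (metis fls_res_simps(6) scalar_fls_res)

lemma scalar_fls_X_inv: "scalar_fls fls_X_inv"
  using symbol_subspaceD(1)[OF symbol_subspace_scalars] scalar_fls_1
  by (auto simp: fls_coeffs_in_def) (metis fls_one_nth)

lemma fls_gaudin_symbol: "fps_to_fls (gaudin_symbol K A R v a b) = fls_const (scalar (A a b)) +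
    (\<Sum>r=1..K. \<Sum>s=1..K. fls_res (R r s) * (fls_const (sx (v a s)) * fls_const (sxi (v b r))))"
  by (simp add: gaudin_symbol_def fps_to_fls_hom.hom_add fps_to_fls_hom.hom_sum fls_times_fps_to_fls
      sfps_const fls_res_def fps_const_to_fls)

text \<open>This is (z - B) R = 1 multiplied by 1/z, which keeps the equation within power series in
  1/z. It makes \<open>R\<close> a right inverse.\<close>

definition is_resolvent :: "nat \<Rightarrow> (nat \<Rightarrow> nat \<Rightarrow> complex) \<Rightarrow> (nat \<Rightarrow> nat \<Rightarrow> complex fps) \<Rightarrow> bool" where
  "is_resolvent K B R \<longleftrightarrow> (\<forall>r\<in>{1..K}. \<forall>t\<in>{1..K}.
     R r t - fps_X * (\<Sum>s=1..K. fps_const (B r s) * R s t) = (if r = t then fps_X else 0))"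

lemma resolvent_fls:
  assumes "is_resolvent K B R" "r < K" "t < K"
  shows "fls_X_inv * fls_res (R (Suc r) (Suc t)) -
      (\<Sum>s<K. fls_const (scalar (B (Suc r) (Suc s))) * fls_res (R (Suc s) (Suc t))) = (if r = t then 1 else 0)"
proof -
  have X: "fls_X_inv * fls_X = (1::symbol fls)"
    by (simp add: fls_eq_iff fls_X_inv_times_conv_shift fls_X_conv_shift_1)
  let ?S = "\<Sum>s<K. fls_const (scalar (B (Suc r) (Suc s))) * fls_res (R (Suc s) (Suc t))"
  have "R (Suc r) (Suc t) - fps_X * (\<Sum>s<K. fps_const (B (Suc r) (Suc s)) * R (Suc s) (Suc t)) =
      (if r = t then fps_X else 0)"
    using assms by (simp add: is_resolvent_def sum.atLeast1_atMost_eq)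
  then have "fls_res (R (Suc r) (Suc t) - fps_X * (\<Sum>s<K. fps_const (B (Suc r) (Suc s)) * R (Suc s) (Suc t))) =
      fls_res (if r = t then fps_X else 0)" by simp
  then have "fls_res (R (Suc r) (Suc t)) - fls_X * ?S = (if r = t then fls_X else 0)"
    by (simp add: fls_res_simps fls_res_sum if_distrib cong: if_cong)
  then have "fls_X_inv * (fls_res (R (Suc r) (Suc t)) - fls_X * ?S) = (if r = t then 1 else 0)"
    by (simp add: X)
  then show ?thesis
    by (simp add: right_diff_distrib mult.assoc[symmetric] X)
qed

text \<open>The factor \<open>det P\<close> is a scalar Laurent series with scalar inverse
  \<open>det P'\<close>, hence invisible to membership in a subspace.\<close>

lemma coeffs_in_scalar_factor:
  assumes V: "symbol_subspace V" and P: "P \<in> carrier_mat n n" "P' \<in> carrier_mat n n" and unit: "det P * det P' = 1"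
    and scalar: "\<And>i j. i < n \<Longrightarrow> j < n \<Longrightarrow> scalar_fls (P $$ (i, j))" "\<And>i j. i < n \<Longrightarrow> j < n \<Longrightarrow> scalar_fls (P' $$ (i, j))"
    and C: "C \<in> carrier_mat k k"
    and f: "f = det (map_mat (\<lambda>a. [:a:]) P) * char_poly (map_mat fps_to_fls C)"
  shows "(\<forall>j. fls_coeffs_in V (coeff f j)) \<longleftrightarrow> coeffs_in V (char_poly C)"
proof -
  have "f = [:det P:] * map_poly fps_to_fls (char_poly C)"
    unfolding f const_poly_hom.hom_det fps_to_fls_hom.char_poly_hom[OF C] ..
  then have "coeff f j = det P * fps_to_fls (coeff (char_poly C) j)" for j
    by (simp add: coeff_map_poly)
  then show ?thesis
    using scalar_fls_det[OF P(1) scalar(1)] scalar_fls_det[OF P(2) scalar(2)] unit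
    by (simp add: fls_coeffs_in_mult_unit[OF V] fls_coeffs_in_fps[OF V] coeffs_in_def)
qed

theorem char_poly_duality:
  assumes V: "symbol_subspace V" and RA: "is_resolvent d A RA" and RB: "is_resolvent N B RB"
  shows "coeffs_in V (char_poly (mat d d (\<lambda>(a, b). gaudin_symbol N A RB v (Suc a) (Suc b)))) \<longleftrightarrow>
    coeffs_in V (char_poly (mat N N (\<lambda>(i, j). gaudin_symbol d B RA (\<lambda>i a. v a i) (Suc i) (Suc j))))"
proof -
  define C1 where "C1 = mat d d (\<lambda>(a, b). gaudin_symbol N A RB v (Suc a) (Suc b))"
  define C2 where "C2 = mat N N (\<lambda>(i, j). gaudin_symbol d B RA (\<lambda>i a. v a i) (Suc i) (Suc j))"
  define x where "x a s = sx (v (Suc a) (Suc s))" for a s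
  define \<xi> where "\<xi> a s = sxi (v (Suc a) (Suc s))" for a s
  define blocks where "blocks (t :: symbol fls poly) (s :: symbol fls poly) =
      four_block_mat (mat N N (\<lambda>(i, j). (if i = j then t else 0) - [:fls_const (scalar (B (Suc j) (Suc i))):]))
        (mat N d (\<lambda>(i, b). [:fls_const (\<xi> b i):])) (mat d N (\<lambda>(a, j). [:fls_const (x a j):]))
        (mat d d (\<lambda>(a, b). (if a = b then s else 0) - [:fls_const (scalar (A (Suc a) (Suc b))):]))" for t s
  \<comment> \<open>The generic matrix over polynomials in two variables: the inner variable sits in
    the block of \<open>B\<close>, the outer one in the block of \<open>A\<close>.\<close>
  define G where "G =
      four_block_mat (mat N N (\<lambda>(i, j). (if i = j then [:[:0, 1:]:] else 0) - [:[:scalar (B (Suc j) (Suc i)):]:]))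
        (mat N d (\<lambda>(i, b). [:[:\<xi> b i:]:])) (mat d N (\<lambda>(a, j). [:[:x a j:]:]))
        (mat d d (\<lambda>(a, b). (if a = b then [:0, 1:] else 0) - [:[:scalar (A (Suc a) (Suc b)):]:]))"
  let ?t = "[:fls_X_inv:] :: symbol fls poly" and ?s = "[:0, 1:] :: symbol fls poly"
  define RB' where "RB' i j = fls_res (RB (Suc i) (Suc j))" for i j
  define RA' where "RA' i j = fls_res (RA (Suc i) (Suc j))" for i j

  have eval_inv_const: "eval_inv [:c:] = fls_const c" for c :: symbol
    by (simp add: eval_inv_def hom_distribs)
  have eval_inv_var: "eval_inv [:0, 1:] = (fls_X_inv :: symbol fls)"
    by (simp add: eval_inv_def hom_distribs)
  have "map_mat (map_poly eval_inv) G = blocks ?t ?s"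
    unfolding G_def blocks_def
    by (rule eq_matI) (auto simp: eval_inv_poly_hom.hom_minus hom_distribs eval_inv_const eval_inv_var[simplified])
  then have det1: "map_poly eval_inv (det G) = det (blocks ?t ?s)"
    using eval_inv_poly_hom.hom_det[of G] by simp
  have swap_const: "swap_eval_inv [:[:c:]:] = [:fls_const c:]" for c :: symbol
    by (simp add: swap_eval_inv_def hom_distribs)
  have swap_var: "swap_eval_inv [:[:0, 1:]:] = ?s" "swap_eval_inv [:0, 1:] = ?t"
    by (simp_all add: swap_eval_inv_def hom_distribs)
  \<comment> \<open>In this reading z has moved to the block of \<open>A\<close> and the polynomial
    variable to the block of \<open>B\<close>.\<close>
  have "map_mat swap_eval_inv G = blocks ?s ?t"
    unfolding G_def blocks_def
    by (rule eq_matI) (auto simp: swap_eval_inv_hom.hom_minus swap_const swap_var[simplified])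
  then have det2: "swap_eval_inv (det G) = det (blocks ?s ?t)"
    using swap_eval_inv_hom.hom_det[of G] by simp

  have scal: "scalar_fls ((if b then fls_X_inv else 0) - fls_const (scalar c))" for b c
    using symbol_subspaceD(5)[OF symbol_subspace_scalars] scalar_fls_const[of c] scalar_fls_X_inv
      fls_coeffs_in_0[OF symbol_subspace_scalars]
    by (auto simp: fls_coeffs_in_def simp del: fls_X_inv_nth fls_const_nth)

  have 1: "(\<forall>j. fls_coeffs_in V (coeff (det (blocks ?t ?s)) j)) \<longleftrightarrow> coeffs_in V (char_poly C1)"
  proof -
    let ?P = "mat N N (\<lambda>(i, j). (if i = j then fls_X_inv else 0) - fls_const (scalar (B (Suc j) (Suc i))))"
    let ?P' = "mat N N (\<lambda>(i, j). RB' j i)"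
    let ?c = "\<lambda>a. [:a::symbol fls:]"
    have P: "map_mat ?c ?P = mat N N (\<lambda>(i, j). (if i = j then ?t else 0) - [:fls_const (scalar (B (Suc j) (Suc i))):])"
      by (rule eq_matI) auto
    \<comment> \<open>The block holds the transpose of \<open>B\<close>, so the right inverse
      \<open>RB\<close> enters transposed and becomes a left inverse.\<close>
    have inv: "?P' * ?P = 1\<^sub>m N"
    proof (rule eq_matI)
      fix i j assume ij: "i < dim_row (1\<^sub>m N)" "j < dim_col (1\<^sub>m N)"
      have "(?P' * ?P) $$ (i, j) = (\<Sum>k<N. RB' k i * ((if k = j then fls_X_inv else 0) - fls_const (scalar (B (Suc j) (Suc k)))))"
        using ij by (simp add: scalar_prod_def lessThan_atLeast0)
      also have "\<dots> = fls_X_inv * RB' j i - (\<Sum>k<N. fls_const (scalar (B (Suc j) (Suc k))) * RB' k i)"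
        using ij by (simp add: right_diff_distrib sum_subtractf mult.commute if_distrib[of "(*) _"] cong: if_cong)
      also have "\<dots> = (if j = i then 1 else 0)"
        unfolding RB'_def by (rule resolvent_fls[OF RB]) (use ij in auto)
      finally show "(?P' * ?P) $$ (i, j) = 1\<^sub>m N $$ (i, j)" using ij by auto
    qed simp_all
    have inv': "map_mat ?c ?P' * map_mat ?c ?P = 1\<^sub>m N"
      using const_poly_hom.mat_hom_mult[of ?P' N N ?P N] by (simp add: inv const_poly_hom.mat_hom_one)
    have "mat d d (\<lambda>(a, b). (if a = b then ?s else 0) - [:fls_const (scalar (A (Suc a) (Suc b))):]) -
        mat d N (\<lambda>(a, j). [:fls_const (x a j):]) * map_mat ?c ?P' * mat N d (\<lambda>(i, b). [:fls_const (\<xi> b i):]) =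
        char_poly_matrix (map_mat fps_to_fls C1)" (is "?T - ?X * _ * ?Q = _")
    proof (rule eq_matI)
      fix a b assume "a < dim_row (char_poly_matrix (map_mat fps_to_fls C1))" "b < dim_col (char_poly_matrix (map_mat fps_to_fls C1))"
      then have ab: "a < d" "b < d" by (simp_all add: char_poly_matrix_def C1_def)
      have "(?X * map_mat ?c ?P' * ?Q) $$ (a, b) = [:\<Sum>i<N. \<Sum>j<N. fls_const (x a j) * RB' i j * fls_const (\<xi> b i):]"
        using ab by (simp add: scalar_prod_def lessThan_atLeast0 sum_to_poly sum_distrib_right)
          (simp add: sum_distrib_left mult_ac)
      then show "(?T - ?X * map_mat ?c ?P' * ?Q) $$ (a, b) = char_poly_matrix (map_mat fps_to_fls C1) $$ (a, b)"
        using ab by (simp add: char_poly_matrix_def C1_def fls_gaudin_symbol sum.atLeast1_atMost_eq RB'_def x_def \<xi>_def mult_ac)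
    qed (simp_all add: char_poly_matrix_def C1_def)
    then have "det (blocks ?t ?s) = det (map_mat ?c ?P) * char_poly (map_mat fps_to_fls C1)"
      unfolding blocks_def P[symmetric]
      by (subst det_four_block_left_inverse[where n = N and k = d and P' = "map_mat ?c ?P'", OF _ _ _ _ _ inv']) (simp_all add: char_poly_def)
    moreover have "det ?P * det ?P' = 1"
      using det_mult[of ?P' N ?P] inv by (simp add: mult.commute)
    ultimately show ?thesis
      by (intro coeffs_in_scalar_factor[OF V, where n = N and P = ?P and P' = ?P' and k = d])
        (use scal in \<open>auto simp: C1_def RB'_def scalar_fls_res\<close>)
  qed
  have 2: "(\<forall>j. fls_coeffs_in V (coeff (det (blocks ?s ?t)) j)) \<longleftrightarrow> coeffs_in V (char_poly C2)"
  proof -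
    let ?T = "mat d d (\<lambda>(i, j). (if i = j then fls_X_inv else 0) - fls_const (scalar (A (Suc i) (Suc j))))"
    let ?T' = "mat d d (\<lambda>(i, j). RA' i j)"
    let ?c = "\<lambda>a. [:a::symbol fls:]"
    have T: "map_mat ?c ?T = mat d d (\<lambda>(i, j). (if i = j then ?t else 0) - [:fls_const (scalar (A (Suc i) (Suc j))):])"
      by (rule eq_matI) auto
    have inv: "?T * ?T' = 1\<^sub>m d"
    proof (rule eq_matI)
      fix i j assume ij: "i < dim_row (1\<^sub>m d)" "j < dim_col (1\<^sub>m d)"
      have "(?T * ?T') $$ (i, j) = (\<Sum>k<d. ((if i = k then fls_X_inv else 0) - fls_const (scalar (A (Suc i) (Suc k)))) * RA' k j)"
        using ij by (simp add: scalar_prod_def lessThan_atLeast0)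
      also have "\<dots> = fls_X_inv * RA' i j - (\<Sum>k<d. fls_const (scalar (A (Suc i) (Suc k))) * RA' k j)"
        using ij by (simp add: left_diff_distrib sum_subtractf if_distrib[of "\<lambda>x. x * _"] cong: if_cong)
      also have "\<dots> = (if i = j then 1 else 0)"
        unfolding RA'_def by (rule resolvent_fls[OF RA]) (use ij in auto)
      finally show "(?T * ?T') $$ (i, j) = 1\<^sub>m d $$ (i, j)" using ij by auto
    qed simp_all
    have inv': "map_mat ?c ?T * map_mat ?c ?T' = 1\<^sub>m d"
      using const_poly_hom.mat_hom_mult[of ?T d d ?T' d] by (simp add: inv const_poly_hom.mat_hom_one)
    \<comment> \<open>Since \<open>B\<close> is transposed in its block, the Schur complement is the
      transpose of the characteristic matrix of \<open>C2\<close>, which has the same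
      determinant.\<close>
    have "mat N N (\<lambda>(i, j). (if i = j then ?s else 0) - [:fls_const (scalar (B (Suc j) (Suc i))):]) -
        mat N d (\<lambda>(i, b). [:fls_const (\<xi> b i):]) * map_mat ?c ?T' * mat d N (\<lambda>(a, j). [:fls_const (x a j):]) =
        transpose_mat (char_poly_matrix (map_mat fps_to_fls C2))" (is "?P - ?Q * _ * ?X = _")
    proof (rule eq_matI)
      fix i j assume "i < dim_row (transpose_mat (char_poly_matrix (map_mat fps_to_fls C2)))"
        "j < dim_col (transpose_mat (char_poly_matrix (map_mat fps_to_fls C2)))"
      then have ij: "i < N" "j < N" by (simp_all add: char_poly_matrix_def C2_def)
      have "(?Q * map_mat ?c ?T' * ?X) $$ (i, j) = [:\<Sum>b<d. \<Sum>a<d. fls_const (\<xi> a i) * RA' a b * fls_const (x b j):]"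
        using ij by (simp add: scalar_prod_def lessThan_atLeast0 sum_to_poly sum_distrib_right)
          (simp add: sum_distrib_left mult_ac)
      also have "\<dots> = [:\<Sum>a<d. \<Sum>b<d. RA' a b * (fls_const (x b j) * fls_const (\<xi> a i)):]"
        by (subst sum.swap) (simp add: mult_ac)
      finally show "(?P - ?Q * map_mat ?c ?T' * ?X) $$ (i, j) = transpose_mat (char_poly_matrix (map_mat fps_to_fls C2)) $$ (i, j)"
        using ij by (simp add: char_poly_matrix_def C2_def fls_gaudin_symbol sum.atLeast1_atMost_eq RA'_def x_def \<xi>_def)
    qed (simp_all add: char_poly_matrix_def C2_def)
    then have "det (blocks ?s ?t) = det (map_mat ?c ?T) * det (transpose_mat (char_poly_matrix (map_mat fps_to_fls C2)))"
      unfolding blocks_def T[symmetric]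
      by (subst det_four_block_right_inverse[where n = N and k = d and T' = "map_mat ?c ?T'", OF _ _ _ _ _ inv']) simp_all
    also have "det (transpose_mat (char_poly_matrix (map_mat fps_to_fls C2))) = char_poly (map_mat fps_to_fls C2)"
      unfolding char_poly_def by (rule det_transpose[of _ N]) (simp add: char_poly_matrix_def C2_def)
    finally have "det (blocks ?s ?t) = det (map_mat ?c ?T) * char_poly (map_mat fps_to_fls C2)" .
    moreover have "det ?T * det ?T' = 1"
      using det_mult[of ?T d ?T'] inv by simp
    ultimately show ?thesis
      by (intro coeffs_in_scalar_factor[OF V, where n = d and P = ?T and P' = ?T' and k = N])
        (use scal in \<open>auto simp: C2_def RA'_def scalar_fls_res\<close>)
  qed
  show ?thesis
    using 1 2 coeffs_in_eval_inv_iff[OF V, of "det G"]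
    unfolding det1 det2 C1_def C2_def by blast
qed

section \<open>Blocks and resolvents of Jordan matrices\<close>

lemma offset_1 [simp]: "offset \<gamma> (Suc 0) = 0"
  by (simp add: offset_def)

lemma offset_Suc: "0 < i \<Longrightarrow> offset \<gamma> (Suc i) = offset \<gamma> i + \<gamma> i"
  by (simp add: offset_def)

lemma offset_mono: "i \<le> j \<Longrightarrow> offset \<gamma> i \<le> offset \<gamma> j"
  unfolding offset_def by (rule sum_mono2) auto

text \<open>Row and block numbers start at 1.\<close>

definition block :: "(nat \<Rightarrow> nat) \<Rightarrow> nat \<Rightarrow> nat" where
  "block \<gamma> r = (LEAST i. r \<le> offset \<gamma> (Suc i))"

lemma block_eqI:
  assumes "0 < i" "offset \<gamma> i < r" "r \<le> offset \<gamma> (Suc i)"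
  shows "block \<gamma> r = i"
  unfolding block_def
proof (rule Least_equality)
  fix j assume "r \<le> offset \<gamma> (Suc j)"
  then show "i \<le> j"
    using assms(2) offset_mono[of "Suc j" i \<gamma>] by linarith
qed (use assms in simp)

lemma block_props:
  assumes "r \<in> {1..offset \<gamma> (Suc L)}"
  shows "block \<gamma> r \<in> {1..L}" "offset \<gamma> (block \<gamma> r) < r" "r \<le> offset \<gamma> (Suc (block \<gamma> r))"
proof -
  have le: "r \<le> offset \<gamma> (Suc (block \<gamma> r))"
    unfolding block_def by (rule LeastI[of _ L]) (use assms in auto)
  then show "r \<le> offset \<gamma> (Suc (block \<gamma> r))" .
  have "block \<gamma> r \<noteq> 0"
    using le assms by (intro notI) simp
  then obtain j where j: "block \<gamma> r = Suc j" by (cases "block \<gamma> r") auto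
  then have "\<not> r \<le> offset \<gamma> (Suc j)"
    unfolding block_def using not_less_Least[of j "\<lambda>i. r \<le> offset \<gamma> (Suc i)"] by simp
  then show "offset \<gamma> (block \<gamma> r) < r" using j by simp
  have "block \<gamma> r \<le> L"
    unfolding block_def by (rule Least_le) (use assms in auto)
  then show "block \<gamma> r \<in> {1..L}" using j by simp
qed

lemma block_between:
  assumes "{r, t} \<subseteq> {1..offset \<gamma> (Suc L)}" "block \<gamma> r = block \<gamma> t" "r \<le> s" "s \<le> t"
  shows "block \<gamma> s = block \<gamma> r"
proof (rule block_eqI)
  show "0 < block \<gamma> r" "offset \<gamma> (block \<gamma> r) < s"
    using assms block_props[of r \<gamma> L] by auto
  show "s \<le> offset \<gamma> (Suc (block \<gamma> r))"
    using assms block_props[of t \<gamma> L] by auto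
qed

text \<open>Induction on the number of blocks: a new block is appended at the lower right. Matrix
  indices start at 0 and \<open>block\<close> counts rows from 1, hence the successors.\<close>

lemma jordan_matrix_index:
  assumes "i < offset \<xi> (Suc L)" "j < offset \<xi> (Suc L)"
  shows "jordan_matrix (map (\<lambda>i. (\<xi> i, \<mu> i)) [1..<Suc L]) $$ (i, j) =
    (if i = j then \<mu> (block \<xi> (Suc i)) else if j = Suc i \<and> block \<xi> (Suc i) = block \<xi> (Suc j) then 1 else 0)"
  using assms
proof (induction L)
  case (Suc L)
  let ?J = "\<lambda>L. jordan_matrix (map (\<lambda>i. (\<xi> i, \<mu> i)) [1..<Suc L])"
  have dim: "dim_row (?J L) = offset \<xi> (Suc L)" "dim_col (?J L) = offset \<xi> (Suc L)" for L
    by (simp_all add: offset_def interv_sum_list_conv_sum_set_nat comp_def)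
  have J: "?J (Suc L) = four_block_mat (?J L) (0\<^sub>m (offset \<xi> (Suc L)) (\<xi> (Suc L)))
      (0\<^sub>m (\<xi> (Suc L)) (offset \<xi> (Suc L))) (jordan_block (\<xi> (Suc L)) (\<mu> (Suc L)))"
    using dim[of L] by (simp add: jordan_matrix_def diag_block_mat_last Let_def)
  have off: "offset \<xi> (Suc (Suc L)) = offset \<xi> (Suc L) + \<xi> (Suc L)"
    by (simp add: offset_Suc)
  have last: "block \<xi> (Suc k) = Suc L" if "offset \<xi> (Suc L) \<le> k" "k < offset \<xi> (Suc (Suc L))" for k
    by (rule block_eqI) (use that in auto)
  have first: "block \<xi> (Suc k) \<le> L" if "k < offset \<xi> (Suc L)" for k
    using block_props(1)[of "Suc k" \<xi> L] that by auto
  let ?o = "offset \<xi> (Suc L)"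
  have index: "?J (Suc L) $$ (i, j) = (if i < ?o then if j < ?o then ?J L $$ (i, j) else 0
      else if j < ?o then 0 else jordan_block (\<xi> (Suc L)) (\<mu> (Suc L)) $$ (i - ?o, j - ?o))"
    unfolding J using Suc.prems dim[of L] off by (subst index_mat_four_block) auto
  show ?case
  proof (cases "i < ?o"; cases "j < ?o")
    assume ij: "\<not> i < ?o" "\<not> j < ?o"
    then have "i - ?o = j - ?o \<longleftrightarrow> i = j" "Suc (i - ?o) = j - ?o \<longleftrightarrow> j = Suc i" by auto
    then show ?thesis
      unfolding index using ij Suc.prems off last[of i] last[of j] by (simp add: jordan_block_def)
  next
    assume ij: "i < ?o" "\<not> j < ?o"
    then have "block \<xi> (Suc i) \<noteq> block \<xi> (Suc j)" "i \<noteq> j"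
      using first[of i] last[of j] Suc.prems by auto
    then show ?thesis unfolding index using ij by simp
  qed (use index Suc in simp_all)
qed simp

lemma jordan_index:
  assumes "r \<in> {1..offset \<xi> (Suc L)}" "s \<in> {1..offset \<xi> (Suc L)}"
  shows "jordan L \<mu> \<xi> r s =
    (if r = s then \<mu> (block \<xi> r) else if s = Suc r \<and> block \<xi> r = block \<xi> s then 1 else 0)"
proof -
  obtain r' s' where rs: "r = Suc r'" "s = Suc s'"
    using assms by (metis Suc_le_D atLeastAtMost_iff One_nat_def)
  then show ?thesis
    unfolding jordan_def using assms by (subst jordan_matrix_index) simp_all
qed

section \<open>Resolvents of Jordan matrices\<close>

text \<open>The inverse of z - J for a Jordan matrix J: inside a block with eigenvalue c, the entry
  at distance k above the diagonal is (z - c)^-(k+1).\<close>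

definition jordan_resolvent :: "(nat \<Rightarrow> complex) \<Rightarrow> (nat \<Rightarrow> nat) \<Rightarrow> nat \<Rightarrow> nat \<Rightarrow> complex fps" where
  "jordan_resolvent z \<gamma> r s =
     (if block \<gamma> r = block \<gamma> s \<and> r \<le> s then inv_linear (z (block \<gamma> r)) ^ Suc (s - r) else 0)"

lemma inv_linear: "inv_linear c - fps_X * (fps_const c * inv_linear c) = fps_X"
proof -
  have "(1 - fps_const c * fps_X) * inverse (1 - fps_const c * fps_X) = 1"
    by (rule inverse_mult_eq_1') simp
  then have "fps_X * ((1 - fps_const c * fps_X) * inverse (1 - fps_const c * fps_X)) = fps_X" by simp
  moreover have "inv_linear c - fps_X * (fps_const c * inv_linear c) =
      fps_X * ((1 - fps_const c * fps_X) * inverse (1 - fps_const c * fps_X))"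
    by (simp add: inv_linear_def algebra_simps)
  ultimately show ?thesis by simp
qed

text \<open>With u = 1/z and l = 1/(z - c), differentiate (1 - c u) l = u, multiply by l and cancel
  u.\<close>

lemma fps_dz_inv_linear: "fps_dz (inv_linear c) = - (inv_linear c ^ 2)"
proof -
  let ?l = "inv_linear c"
  note d = derivationD[OF derivation_fps_dz]
  have X: "fps_dz (fps_X :: complex fps) = - (fps_X ^ 2)"
    by (simp add: fps_dz_def)
  have C: "fps_dz (fps_const c) = 0" by simp
  have l: "(1 - fps_X * fps_const c) * ?l = fps_X"
    using inv_linear[of c] by (simp add: algebra_simps)
  have "fps_dz ((1 - fps_X * fps_const c) * ?l) = fps_dz fps_X"
    by (simp only: l)
  then have "(1 - fps_X * fps_const c) * fps_dz ?l + fps_X ^ 2 * fps_const c * ?l = - (fps_X ^ 2)"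
    by (simp add: d X C algebra_simps)
  then have "?l * ((1 - fps_X * fps_const c) * fps_dz ?l + fps_X ^ 2 * fps_const c * ?l) = ?l * (- (fps_X ^ 2))"
    by simp
  moreover have "?l * ((1 - fps_X * fps_const c) * fps_dz ?l + fps_X ^ 2 * fps_const c * ?l) =
      ((1 - fps_X * fps_const c) * ?l) * fps_dz ?l + fps_X ^ 2 * (fps_const c * ?l ^ 2)"
    by (simp add: algebra_simps power2_eq_square)
  ultimately have "fps_X * fps_dz ?l = - (fps_X * (fps_X * ?l + fps_X * (fps_const c * ?l ^ 2)))"
    unfolding l by (simp add: algebra_simps power2_eq_square eq_neg_iff_add_eq_0)
  also have "fps_X * ?l + fps_X * (fps_const c * ?l ^ 2) = ((fps_X + fps_X * fps_const c * ?l)) * ?l"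
    by (simp add: algebra_simps power2_eq_square)
  also have "fps_X + fps_X * fps_const c * ?l = ?l"
    using inv_linear[of c] by (simp add: algebra_simps)
  finally have "fps_X * fps_dz ?l = fps_X * - (?l ^ 2)"
    by (simp add: power2_eq_square)
  then show ?thesis by (simp only: mult_left_cancel[OF fps_X_neq_zero])
qed

lemma fps_dz_inv_linear_power: "fps_dz (inv_linear c ^ n) = - (of_nat n * inv_linear c ^ Suc n)"
  by (induction n)
    (simp_all add: derivationD[OF derivation_fps_dz] fps_dz_inv_linear algebra_simps power2_eq_square)

text \<open>Each of the t - r + 1 intermediate positions in the block contributes the same power to
  the square of the resolvent, and t - r + 1 is also the exponent that differentiation brings
  down.\<close>

lemma jordan_resolvent_dz:
  assumes "{r, t} \<subseteq> {1..offset \<gamma> (Suc L)}"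
  shows "fps_dz (jordan_resolvent z \<gamma> r t) =
    - (\<Sum>s=1..offset \<gamma> (Suc L). jordan_resolvent z \<gamma> r s * jordan_resolvent z \<gamma> s t)"
proof (cases "block \<gamma> r = block \<gamma> t \<and> r \<le> t")
  case True
  have "(\<Sum>s=1..offset \<gamma> (Suc L). jordan_resolvent z \<gamma> r s * jordan_resolvent z \<gamma> s t) =
      (\<Sum>s=r..t. inv_linear (z (block \<gamma> r)) ^ (Suc (Suc (t - r))))"
  proof (rule sum.mono_neutral_cong_right)
    show "jordan_resolvent z \<gamma> r s * jordan_resolvent z \<gamma> s t = inv_linear (z (block \<gamma> r)) ^ Suc (Suc (t - r))"
      if "s \<in> {r..t}" for s
    proof -
      have "block \<gamma> s = block \<gamma> r"
        by (rule block_between[OF assms]) (use True that in auto)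
      then have "jordan_resolvent z \<gamma> r s = inv_linear (z (block \<gamma> r)) ^ Suc (s - r)"
        "jordan_resolvent z \<gamma> s t = inv_linear (z (block \<gamma> r)) ^ Suc (t - s)"
        using that True unfolding jordan_resolvent_def by (metis atLeastAtMost_iff)+
      moreover have "Suc (s - r) + Suc (t - s) = Suc (Suc (t - r))" using that by auto
      ultimately show ?thesis
        by (metis power_add)
    qed
  qed (use assms in \<open>auto simp: jordan_resolvent_def\<close>)
  also have "\<dots> = of_nat (Suc t - r) * inv_linear (z (block \<gamma> r)) ^ (Suc (Suc (t - r)))" by simp
  finally show ?thesis
    using True by (simp add: jordan_resolvent_def fps_dz_inv_linear_power Suc_diff_le del: power_Suc)
next
  case False
  then have "jordan_resolvent z \<gamma> r s * jordan_resolvent z \<gamma> s t = 0" for s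
    by (auto simp: jordan_resolvent_def)
  then have "(\<Sum>s=1..offset \<gamma> (Suc L). jordan_resolvent z \<gamma> r s * jordan_resolvent z \<gamma> s t) = 0"
    by (simp only: sum.neutral_const)
  moreover have "jordan_resolvent z \<gamma> r t = 0"
    using False by (auto simp: jordan_resolvent_def)
  ultimately show ?thesis
    by (simp add: derivationD[OF derivation_fps_dz])
qed

text \<open>Row r of the Jordan matrix meets only the positions r and r + 1, the latter within the
  same block; what remains is the equation of \<open>inv_linear\<close> times a power.\<close>

lemma jordan_resolvent_equation:
  assumes r: "r \<in> {1..offset \<gamma> (Suc L)}" and t: "t \<in> {1..offset \<gamma> (Suc L)}"
  shows "jordan_resolvent z \<gamma> r t -
    fps_X * (\<Sum>s=1..offset \<gamma> (Suc L). fps_const (jordan L z \<gamma> r s) * jordan_resolvent z \<gamma> s t) =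
    (if r = t then fps_X else 0)"
proof -
  let ?K = "offset \<gamma> (Suc L)" and ?R = "jordan_resolvent z \<gamma>" and ?l = "inv_linear (z (block \<gamma> r))"
  have "(\<Sum>s=1..?K. fps_const (jordan L z \<gamma> r s) * ?R s t) =
      (\<Sum>s=1..?K. (if s = r then fps_const (z (block \<gamma> r)) * ?R r t else 0) +
        (if s = Suc r then if block \<gamma> r = block \<gamma> (Suc r) then ?R (Suc r) t else 0 else 0))"
  proof (rule sum.cong)
    fix s assume "s \<in> {1..?K}"
    then show "fps_const (jordan L z \<gamma> r s) * ?R s t = (if s = r then fps_const (z (block \<gamma> r)) * ?R r t else 0) +
        (if s = Suc r then if block \<gamma> r = block \<gamma> (Suc r) then ?R (Suc r) t else 0 else 0)"
      using jordan_index[OF r, of s z] by simp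
  qed simp
  also have "\<dots> = fps_const (z (block \<gamma> r)) * ?R r t +
      (if Suc r \<le> ?K \<and> block \<gamma> r = block \<gamma> (Suc r) then ?R (Suc r) t else 0)"
    using r by (simp add: sum.distrib)
  finally have sum: "(\<Sum>s=1..?K. fps_const (jordan L z \<gamma> r s) * ?R s t) = \<dots>" .
  consider "block \<gamma> r \<noteq> block \<gamma> t \<or> t < r" | "r = t" | "block \<gamma> r = block \<gamma> t" "r < t" by force
  then show ?thesis
  proof cases
    case 1
    then show ?thesis unfolding sum by (auto simp: jordan_resolvent_def)
  next
    case 2
    then show ?thesis unfolding sum using inv_linear[of "z (block \<gamma> r)"] by (auto simp: jordan_resolvent_def)
  next
    case 3
    then have "block \<gamma> (Suc r) = block \<gamma> r" using block_between[of r t \<gamma> L "Suc r"] r t by auto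
    moreover have "Suc (t - r) = Suc (Suc (t - Suc r))" using 3 by simp
    moreover have "?l * ?l ^ Suc (t - Suc r) - fps_X * (fps_const (z (block \<gamma> r)) * (?l * ?l ^ Suc (t - Suc r)) + ?l ^ Suc (t - Suc r)) = 0"
    proof -
      have "?l * y - fps_X * (fps_const (z (block \<gamma> r)) * (?l * y) + y) =
          (?l - fps_X * (fps_const (z (block \<gamma> r)) * ?l) - fps_X) * y" for y
        by (simp add: algebra_simps)
      then show ?thesis by (simp add: inv_linear)
    qed
    ultimately show ?thesis
      unfolding sum using 3 r t by (auto simp: jordan_resolvent_def)
  qed
qed

section \<open>Linear operators on polynomials\<close>

text \<open>Operators on polynomials in all variables of the type: addition and composition are then
  total and give an instance of \<open>ring_1\<close>.\<close>

typedef 'v linop = "{T :: 'v mpol \<Rightarrow> 'v mpol. (\<forall>f g. T (f + g) = T f + T g) \<and>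
    (\<forall>c f. T (Poly_Mapping.single 0 c * f) = Poly_Mapping.single 0 c * T f)}"
  morphisms apply_op Linop
  by (rule exI[of _ "\<lambda>f. f"]) simp

setup_lifting type_definition_linop

lemma apply_op_add: "apply_op T (f + g) = apply_op T f + apply_op T g"
  and apply_op_scale: "apply_op T (Poly_Mapping.single 0 c * f) = Poly_Mapping.single 0 c * apply_op T f"
  using apply_op[of T] by auto

lemma linop_eqI: "(\<And>f. apply_op S f = apply_op T f) \<Longrightarrow> S = T"
  by (simp add: apply_op_inject[symmetric] fun_eq_iff)

instantiation linop :: (type) ring_1
begin
lift_definition zero_linop :: "'a linop" is "\<lambda>f. 0" by simp
lift_definition one_linop :: "'a linop" is "\<lambda>f. f" by simp
lift_definition plus_linop :: "'a linop \<Rightarrow> 'a linop \<Rightarrow> 'a linop" is "\<lambda>S T f. S f + T f"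
  by (simp add: distrib_left add_ac)
lift_definition uminus_linop :: "'a linop \<Rightarrow> 'a linop" is "\<lambda>S f. - S f" by simp
lift_definition minus_linop :: "'a linop \<Rightarrow> 'a linop \<Rightarrow> 'a linop" is "\<lambda>S T f. S f - T f"
  by (simp add: right_diff_distrib)
lift_definition times_linop :: "'a linop \<Rightarrow> 'a linop \<Rightarrow> 'a linop" is "\<lambda>S T f. S (T f)" by simp
instance
proof
  show "(0::'a linop) \<noteq> 1"
    by transfer (metis zero_neq_one)
qed (transfer; simp add: fun_eq_iff add_ac)+
end

lemma linop_simps [simp]:
  "apply_op 0 f = 0" "apply_op 1 f = f" "apply_op (S + T) f = apply_op S f + apply_op T f"
  "apply_op (- S) f = - apply_op S f" "apply_op (S * T) f = apply_op S (apply_op T f)"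
  by (transfer; simp)+

lift_definition scalar_op :: "complex \<Rightarrow> 'v linop" is "\<lambda>c f. Poly_Mapping.single 0 c * f"
  by (simp add: algebra_simps)

lift_definition var_op :: "'v \<Rightarrow> 'v linop" is
  "\<lambda>v f. Poly_Mapping.single (Poly_Mapping.single v 1) 1 * f"
  by (simp add: algebra_simps)

lift_definition partial_op :: "'v \<Rightarrow> 'v linop" is mpol_deriv
  by (simp add: mpol_deriv_add mpol_deriv_scale)

lemma scalar_op_apply [simp]: "apply_op (scalar_op c) f = Poly_Mapping.single 0 c * f"
  by transfer simp

interpretation scalar_op: central_scalars "scalar_op :: complex \<Rightarrow> 'v linop"
proof
  show "scalar_op c * T = T * scalar_op c" for c and T :: "'v linop"
    by (rule linop_eqI) (simp add: apply_op_scale)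
qed (rule linop_eqI; simp add: single_add distrib_right mult_single flip: mult.assoc)+

lemma var_op_commute: "var_op v * var_op w = var_op w * var_op v"
  by transfer (simp add: fun_eq_iff mult_ac)

lemma partial_op_commute: "partial_op v * partial_op w = partial_op w * partial_op v"
proof (transfer, rule ext)
  fix v w :: 'v and f :: "'v mpol"
  show "mpol_deriv v (mpol_deriv w f) = mpol_deriv w (mpol_deriv v f)"
  proof (induction f rule: poly_mapping_additive_induct)
    case (single \<mu> c)
    have "\<mu> - Poly_Mapping.single w 1 - Poly_Mapping.single v 1 = \<mu> - Poly_Mapping.single v 1 - Poly_Mapping.single w (1::nat)"
      by (rule poly_mapping_eqI) (simp add: lookup_minus)
    then show ?case
      by (cases "v = w") (simp_all add: mpol_deriv_single lookup_minus lookup_single mult_ac)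
  qed (simp_all add: mpol_deriv_add)
qed

lemma partial_var_op: "partial_op v * var_op w = var_op w * partial_op v + (if v = w then 1 else 0)"
  by (transfer, rule ext) (auto simp: fun_eq_iff mpol_deriv_mult mpol_deriv_var[unfolded One_nat_def])

section \<open>The Weyl algebra as a ring of linear operators\<close>

lemma polys_0 [simp]: "0 \<in> polys V"
  by (simp add: polys_def)

lemma polys_add: "f \<in> polys V \<Longrightarrow> g \<in> polys V \<Longrightarrow> f + g \<in> polys V"
  using keys_add[of f g] by (auto simp: polys_def)

lemma polys_uminus: "f \<in> polys V \<Longrightarrow> - f \<in> polys V"
  by (simp add: polys_def)

lemma polys_mult: "f \<in> polys V \<Longrightarrow> g \<in> polys V \<Longrightarrow> f * g \<in> polys V"
proof -
  assume fg: "f \<in> polys V" "g \<in> polys V"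
  have "Poly_Mapping.keys \<mu> \<subseteq> V" if \<mu>: "\<mu> \<in> Poly_Mapping.keys (f * g)" for \<mu>
  proof -
    obtain a b where "\<mu> = a + b" "a \<in> Poly_Mapping.keys f" "b \<in> Poly_Mapping.keys g"
      using \<mu> keys_mult[of f g] by blast
    then show ?thesis using fg keys_add[of a b] unfolding polys_def by blast
  qed
  then show ?thesis by (simp add: polys_def)
qed

lemma polys_const: "Poly_Mapping.single 0 c \<in> polys V"
  by (simp add: polys_def)

lemma polys_var: "v \<in> V \<Longrightarrow> Poly_Mapping.single (Poly_Mapping.single v 1) 1 \<in> polys V"
  by (simp add: polys_def)

lemma polys_deriv: "f \<in> polys V \<Longrightarrow> mpol_deriv v f \<in> polys V"
proof -
  assume f: "f \<in> polys V"
  have "Poly_Mapping.single (\<mu> - Poly_Mapping.single v 1) c \<in> polys V" if "\<mu> \<in> Poly_Mapping.keys f" for \<mu> c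
  proof -
    have "Poly_Mapping.keys (\<mu> - Poly_Mapping.single v 1) \<subseteq> Poly_Mapping.keys \<mu>"
      by (auto simp: in_keys_iff lookup_minus)
    then show ?thesis using f that by (auto simp: polys_def)
  qed
  moreover have "sum h S \<in> polys V" if "\<And>x. x \<in> S \<Longrightarrow> h x \<in> polys V" for h and S :: "('a \<Rightarrow>\<^sub>0 nat) set"
    using that by (induction S rule: infinite_finite_induct) (simp_all add: polys_add)
  ultimately show ?thesis by (simp add: mpol_deriv_def)
qed

lemma End_simps:
  "monoid.mult (End V) = compose (polys V)" "one (End V) = (\<lambda>f\<in>polys V. f)"
  "zero (End V) = (\<lambda>f\<in>polys V. 0)" "add (End V) = (\<lambda>S T. \<lambda>f\<in>polys V. S f + T f)"
  "module.smult (End V) = (\<lambda>c S. \<lambda>f\<in>polys V. Poly_Mapping.single 0 c * S f)"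
  by (simp_all add: End_def)

lemma End_carrier: "S \<in> carrier (End V) \<longleftrightarrow> S \<in> polys V \<rightarrow>\<^sub>E polys V \<and>
    (\<forall>f\<in>polys V. \<forall>g\<in>polys V. S (f + g) = S f + S g) \<and>
    (\<forall>c. \<forall>f\<in>polys V. S (Poly_Mapping.single 0 c * f) = Poly_Mapping.single 0 c * S f)"
  by (simp add: End_def)

lemma End_apply: "S \<in> carrier (End V) \<Longrightarrow> f \<in> polys V \<Longrightarrow> S f \<in> polys V"
  by (auto simp: End_carrier)

lemma ring_End: "ring (End V)"
proof (rule ringI)
  show "abelian_group (End V)"
  proof (rule abelian_groupI)
    fix S T assume ST: "S \<in> carrier (End V)" "T \<in> carrier (End V)"
    then show "S \<oplus>\<^bsub>End V\<^esub> T \<in> carrier (End V)"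
      by (auto simp: End_carrier End_simps polys_add polys_mult polys_const distrib_left add_ac
          intro!: polys_add)
    show "S \<oplus>\<^bsub>End V\<^esub> T = T \<oplus>\<^bsub>End V\<^esub> S"
      by (simp add: End_simps add.commute)
  next
    fix S assume S: "S \<in> carrier (End V)"
    show "\<exists>T\<in>carrier (End V). T \<oplus>\<^bsub>End V\<^esub> S = \<zero>\<^bsub>End V\<^esub>"
      by (rule bexI[of _ "\<lambda>f\<in>polys V. - S f"])
        (use S in \<open>auto simp: End_carrier End_simps polys_add polys_mult polys_const fun_eq_iff intro!: polys_uminus\<close>)
    show "\<zero>\<^bsub>End V\<^esub> \<oplus>\<^bsub>End V\<^esub> S = S"
      using S by (auto simp: End_carrier End_simps fun_eq_iff PiE_def extensional_def)
  qed (auto simp: End_carrier End_simps polys_add polys_mult polys_const add_ac fun_eq_iff)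
  show "Group.monoid (End V)"
  proof (rule monoidI)
    fix S T assume ST: "S \<in> carrier (End V)" "T \<in> carrier (End V)"
    then show "S \<otimes>\<^bsub>End V\<^esub> T \<in> carrier (End V)"
      using End_apply[of T V]
      by (auto simp: End_carrier End_simps compose_def polys_add polys_mult polys_const)
  next
    fix S T R assume "S \<in> carrier (End V)" "T \<in> carrier (End V)" "R \<in> carrier (End V)"
    then show "S \<otimes>\<^bsub>End V\<^esub> T \<otimes>\<^bsub>End V\<^esub> R = S \<otimes>\<^bsub>End V\<^esub> (T \<otimes>\<^bsub>End V\<^esub> R)"
      using End_apply by (auto simp: End_simps compose_def fun_eq_iff)
  qed (auto simp: End_carrier End_simps compose_def polys_add polys_mult polys_const fun_eq_iff PiE_def extensional_def)
  fix R S T assume RST: "R \<in> carrier (End V)" "S \<in> carrier (End V)" "T \<in> carrier (End V)"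
  show "(R \<oplus>\<^bsub>End V\<^esub> S) \<otimes>\<^bsub>End V\<^esub> T = R \<otimes>\<^bsub>End V\<^esub> T \<oplus>\<^bsub>End V\<^esub> S \<otimes>\<^bsub>End V\<^esub> T"
    using End_apply[OF RST(3)] by (auto simp: End_simps compose_def fun_eq_iff)
  have "T (R f + S f) = T (R f) + T (S f)" if "f \<in> polys V" for f
    using RST(3) End_apply[OF RST(1) that] End_apply[OF RST(2) that] by (auto simp: End_carrier)
  then show "T \<otimes>\<^bsub>End V\<^esub> (R \<oplus>\<^bsub>End V\<^esub> S) = T \<otimes>\<^bsub>End V\<^esub> R \<oplus>\<^bsub>End V\<^esub> T \<otimes>\<^bsub>End V\<^esub> S"
    by (auto simp: End_simps compose_def fun_eq_iff)
qed

lemma Weyl_simps: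
  "carrier (Weyl V) = generated_subalgebra (End V) (mul_op V ` V \<union> deriv_op V ` V)"
  "monoid.mult (Weyl V) = monoid.mult (End V)" "one (Weyl V) = one (End V)"
  "zero (Weyl V) = zero (End V)" "add (Weyl V) = add (End V)" "module.smult (Weyl V) = module.smult (End V)"
  by (simp_all add: Weyl_def)

lemma mul_op_End: "v \<in> V \<Longrightarrow> mul_op V v \<in> carrier (End V)"
  using polys_var[of v V] by (auto simp: End_carrier mul_op_def polys_add polys_mult polys_const algebra_simps)

lemma deriv_op_End: "deriv_op V v \<in> carrier (End V)"
  by (auto simp: End_carrier deriv_op_def polys_add polys_mult polys_const polys_deriv mpol_deriv_add mpol_deriv_scale)

lemma scalar_End: "c \<odot>\<^bsub>End V\<^esub> \<one>\<^bsub>End V\<^esub> \<in> carrier (End V)"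
  by (auto simp: End_carrier End_simps polys_add polys_mult polys_const algebra_simps)

lemma Weyl_generators_End: "{c \<odot>\<^bsub>End V\<^esub> \<one>\<^bsub>End V\<^esub> | c. True} \<union> (mul_op V ` V \<union> deriv_op V ` V) \<subseteq> carrier (End V)"
  using scalar_End mul_op_End deriv_op_End by auto

lemma ring_Weyl: "ring (Weyl V)"
  unfolding Weyl_def generated_subalgebra_def
  by (rule ring.generate_ring_is_ring[OF ring_End Weyl_generators_End])

lemma Weyl_subset_End: "S \<in> carrier (Weyl V) \<Longrightarrow> S \<in> carrier (End V)"
  unfolding Weyl_simps generated_subalgebra_def
  by (rule ring.generate_ring_in_carrier[OF ring_End Weyl_generators_End])

lemma mul_op_Weyl: "v \<in> V \<Longrightarrow> mul_op V v \<in> carrier (Weyl V)"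
  and deriv_op_Weyl: "v \<in> V \<Longrightarrow> deriv_op V v \<in> carrier (Weyl V)"
  and scalar_Weyl: "c \<odot>\<^bsub>Weyl V\<^esub> \<one>\<^bsub>Weyl V\<^esub> \<in> carrier (Weyl V)"
  unfolding Weyl_simps generated_subalgebra_def by (auto intro: generate_ring.incl)

section \<open>Restriction of operators to the Weyl algebra\<close>

definition restr :: "'v set \<Rightarrow> 'v linop \<Rightarrow> 'v mpol \<Rightarrow> 'v mpol" where
  "restr V T = (\<lambda>f\<in>polys V. apply_op T f)"

lemma restr_add: "restr V (S + T) = restr V S \<oplus>\<^bsub>Weyl V\<^esub> restr V T"
  by (simp add: restr_def Weyl_simps End_simps fun_eq_iff)

lemma restr_0: "restr V 0 = \<zero>\<^bsub>Weyl V\<^esub>" and restr_1: "restr V 1 = \<one>\<^bsub>Weyl V\<^esub>"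
  by (simp_all add: restr_def Weyl_simps End_simps fun_eq_iff)

lemma restr_scale: "restr V (scalar_op c * T) = c \<odot>\<^bsub>Weyl V\<^esub> restr V T"
  by (simp add: restr_def Weyl_simps End_simps fun_eq_iff)

text \<open>Composition commutes with restriction as soon as the inner operator maps
  \<open>polys V\<close> to itself, which membership of its restriction in the Weyl algebra
  ensures.\<close>

lemma restr_mult:
  assumes "restr V T \<in> carrier (Weyl V)"
  shows "restr V (S * T) = restr V S \<otimes>\<^bsub>Weyl V\<^esub> restr V T"
proof -
  have "apply_op T f \<in> polys V" if "f \<in> polys V" for f
    using End_apply[OF Weyl_subset_End[OF assms] that] that by (simp add: restr_def)
  then show ?thesis
    by (simp add: restr_def Weyl_simps End_simps compose_def fun_eq_iff)
qed

lemma restr_var: "restr V (var_op v) = mul_op V v"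
  unfolding restr_def mul_op_def by transfer simp

lemma restr_partial: "restr V (partial_op v) = deriv_op V v"
  unfolding restr_def deriv_op_def by transfer simp

text \<open>The ring of operators on which \<open>restr\<close> is a homomorphism into the Weyl
  algebra.\<close>

definition Weyl_ops :: "'v set \<Rightarrow> 'v linop set" where
  "Weyl_ops V = {T. restr V T \<in> carrier (Weyl V)}"

lemma Weyl_ops_add: "S \<in> Weyl_ops V \<Longrightarrow> T \<in> Weyl_ops V \<Longrightarrow> S + T \<in> Weyl_ops V"
  using ring.ring_simprules(1)[OF ring_Weyl] by (simp add: Weyl_ops_def restr_add)

lemma Weyl_ops_mult: "S \<in> Weyl_ops V \<Longrightarrow> T \<in> Weyl_ops V \<Longrightarrow> S * T \<in> Weyl_ops V"
  using ring.ring_simprules(5)[OF ring_Weyl] by (simp add: Weyl_ops_def restr_mult)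

lemma Weyl_ops_0: "0 \<in> Weyl_ops V" and Weyl_ops_1: "1 \<in> Weyl_ops V"
  using ring.ring_simprules(2,6)[OF ring_Weyl[of V]] by (simp_all add: Weyl_ops_def restr_0 restr_1)

lemma Weyl_ops_scalar: "scalar_op c \<in> Weyl_ops V"
  using scalar_Weyl[where c = c and V = V] restr_scale[of V c 1] by (simp add: Weyl_ops_def restr_1)

lemma Weyl_ops_scale: "T \<in> Weyl_ops V \<Longrightarrow> scalar_op c * T \<in> Weyl_ops V"
  by (rule Weyl_ops_mult[OF Weyl_ops_scalar])

lemma Weyl_ops_uminus: "T \<in> Weyl_ops V \<Longrightarrow> - T \<in> Weyl_ops V"
  using Weyl_ops_scale[of T V "-1"] by (simp add: scalar_op.cs_minus)

lemma Weyl_ops_sum: "(\<And>x. x \<in> S \<Longrightarrow> f x \<in> Weyl_ops V) \<Longrightarrow> sum f S \<in> Weyl_ops V"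
  by (induction S rule: infinite_finite_induct) (simp_all add: Weyl_ops_add Weyl_ops_0)

lemma Weyl_ops_var: "v \<in> V \<Longrightarrow> var_op v \<in> Weyl_ops V"
  and Weyl_ops_partial: "v \<in> V \<Longrightarrow> partial_op v \<in> Weyl_ops V"
  by (simp_all add: Weyl_ops_def restr_var restr_partial mul_op_Weyl deriv_op_Weyl)

lemma restr_uminus:
  assumes "T \<in> Weyl_ops V" shows "restr V (- T) = \<ominus>\<^bsub>Weyl V\<^esub> restr V T"
proof -
  interpret W: ring "Weyl V" by (rule ring_Weyl)
  have "restr V (- T) \<oplus>\<^bsub>Weyl V\<^esub> restr V T = \<zero>\<^bsub>Weyl V\<^esub>"
    by (simp add: restr_add[symmetric] restr_0)
  then show ?thesis
    using assms Weyl_ops_uminus[OF assms] W.minus_equality[of "restr V (- T)" "restr V T"] by (simp add: Weyl_ops_def)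
qed

lemma restr_finsum:
  assumes "\<And>x. x \<in> S \<Longrightarrow> f x \<in> Weyl_ops V"
  shows "(\<Oplus>\<^bsub>Weyl V\<^esub>x\<in>S. restr V (f x)) = restr V (sum f S)"
proof -
  interpret W: ring "Weyl V" by (rule ring_Weyl)
  show ?thesis
    using assms
  proof (induction S rule: infinite_finite_induct)
    case (insert x S)
    then have "(\<lambda>x. restr V (f x)) \<in> S \<rightarrow> carrier (Weyl V)" "restr V (f x) \<in> carrier (Weyl V)"
      by (auto simp: Weyl_ops_def)
    with insert show ?case
      by (simp add: W.finsum_insert restr_add)
  qed (simp_all add: restr_0 W.add.finprod_infinite)
qed

text \<open>A homomorphism commutes with the generation of subalgebras; each inclusion is an
  induction over the generation.\<close>

lemma generated_subalgebra_image:
  assumes R: "ring R" and D: "ring D"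
    and add: "\<And>x y. x \<in> carrier R \<Longrightarrow> y \<in> carrier R \<Longrightarrow> h (x \<oplus>\<^bsub>R\<^esub> y) = h x \<oplus>\<^bsub>D\<^esub> h y"
    and mult: "\<And>x y. x \<in> carrier R \<Longrightarrow> y \<in> carrier R \<Longrightarrow> h (x \<otimes>\<^bsub>R\<^esub> y) = h x \<otimes>\<^bsub>D\<^esub> h y"
    and one: "h \<one>\<^bsub>R\<^esub> = \<one>\<^bsub>D\<^esub>"
    and scalar: "\<And>c. h (c \<odot>\<^bsub>R\<^esub> \<one>\<^bsub>R\<^esub>) = c \<odot>\<^bsub>D\<^esub> \<one>\<^bsub>D\<^esub>"
    and closed: "\<And>x. x \<in> carrier R \<Longrightarrow> h x \<in> carrier D"
    and S: "S \<subseteq> carrier R" and scalar_closed: "\<And>c. c \<odot>\<^bsub>R\<^esub> \<one>\<^bsub>R\<^esub> \<in> carrier R"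
  shows "h ` generated_subalgebra R S = generated_subalgebra D (h ` S)"
proof -
  interpret R: ring R by (rule R)
  interpret D: ring D by (rule D)
  let ?G = "{c \<odot>\<^bsub>R\<^esub> \<one>\<^bsub>R\<^esub> | c. True} \<union> S"
  have G: "?G \<subseteq> carrier R" using S scalar_closed by auto
  have in_R: "x \<in> carrier R" if "x \<in> generate_ring R ?G" for x
    using R.generate_ring_in_carrier[OF G that] .
  have "h \<zero>\<^bsub>R\<^esub> \<oplus>\<^bsub>D\<^esub> h \<zero>\<^bsub>R\<^esub> = h \<zero>\<^bsub>R\<^esub>"
    using add[of "\<zero>\<^bsub>R\<^esub>" "\<zero>\<^bsub>R\<^esub>"] by simp
  then have zero: "h \<zero>\<^bsub>R\<^esub> = \<zero>\<^bsub>D\<^esub>"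
    using D.add.l_cancel_one' closed[OF R.zero_closed] by (metis D.add.r_cancel_one)
  have uminus: "h (\<ominus>\<^bsub>R\<^esub> x) = \<ominus>\<^bsub>D\<^esub> h x" if "x \<in> carrier R" for x
  proof -
    have "h (\<ominus>\<^bsub>R\<^esub> x) \<oplus>\<^bsub>D\<^esub> h x = \<zero>\<^bsub>D\<^esub>"
      using add[of "\<ominus>\<^bsub>R\<^esub> x" x] that by (simp add: R.l_neg zero)
    then show ?thesis
      using D.minus_equality closed that by (metis R.a_inv_closed)
  qed
  have "h x \<in> generate_ring D ({c \<odot>\<^bsub>D\<^esub> \<one>\<^bsub>D\<^esub> | c. True} \<union> h ` S)" if "x \<in> generate_ring R ?G" for x
    using that
  proof (induction rule: generate_ring.induct)
    case (incl x)
    then show ?case using scalar by (intro generate_ring.incl) auto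
  qed (auto simp: one uminus add mult in_R intro: generate_ring.intros)
  moreover have "y \<in> h ` generate_ring R ?G" if "y \<in> generate_ring D ({c \<odot>\<^bsub>D\<^esub> \<one>\<^bsub>D\<^esub> | c. True} \<union> h ` S)" for y
    using that
  proof (induction rule: generate_ring.induct)
    case one
    show ?case using generate_ring.one[of R ?G] \<open>h \<one>\<^bsub>R\<^esub> = _\<close> by (metis imageI)
  next
    case (incl y)
    then consider c where "y = c \<odot>\<^bsub>D\<^esub> \<one>\<^bsub>D\<^esub>" | x where "x \<in> S" "y = h x" by blast
    then show ?case
    proof cases
      case 1
      have "c \<odot>\<^bsub>R\<^esub> \<one>\<^bsub>R\<^esub> \<in> generate_ring R ?G" by (rule generate_ring.incl) blast
      then show ?thesis unfolding 1 scalar[symmetric] by (rule imageI)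
    next
      case 2
      have "x \<in> generate_ring R ?G" by (rule generate_ring.incl) (use 2 in blast)
      then show ?thesis unfolding 2 by (rule imageI)
    qed
  next
    case (a_inv y)
    then obtain x where "x \<in> generate_ring R ?G" "y = h x" by blast
    then show ?case
      by (intro image_eqI[where x = "\<ominus>\<^bsub>R\<^esub> x"]) (simp_all add: uminus in_R generate_ring.a_inv)
  next
    case (eng_add y y')
    then obtain x x' where "x \<in> generate_ring R ?G" "y = h x" "x' \<in> generate_ring R ?G" "y' = h x'" by blast
    then show ?case
      by (intro image_eqI[where x = "x \<oplus>\<^bsub>R\<^esub> x'"]) (simp_all add: add in_R generate_ring.eng_add)
  next
    case (eng_mult y y')
    then obtain x x' where "x \<in> generate_ring R ?G" "y = h x" "x' \<in> generate_ring R ?G" "y' = h x'" by blast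
    then show ?case
      by (intro image_eqI[where x = "x \<otimes>\<^bsub>R\<^esub> x'"]) (simp_all add: mult in_R generate_ring.eng_mult)
  qed
  ultimately show ?thesis unfolding generated_subalgebra_def by blast
qed

section \<open>Enveloping algebras acting by Weyl operators\<close>

locale weyl_rep = lie_rep scalar_op L \<rho>
  for L :: "'g lie_algebra" and \<rho> :: "'g \<Rightarrow> 'v linop" +
  fixes V :: "'v set"
  assumes rho_closed: "x \<in> carrier L \<Longrightarrow> \<rho> x \<in> Weyl_ops V"
begin

lemma prod_list_closed:
  "set xs \<subseteq> carrier L \<Longrightarrow> prod_list (map \<rho> xs) \<in> Weyl_ops V"
  by (induction xs) (simp_all add: Weyl_ops_1 Weyl_ops_mult rho_closed)

lemma eval_closed: "f \<in> carrier F \<Longrightarrow> eval f \<in> Weyl_ops V"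
  unfolding eval_def lin_ext_def
  by (intro Weyl_ops_sum Weyl_ops_scale prod_list_closed) (auto simp: free_algebra_carrier)

lemma free_algebra_eval_eq:
  assumes f: "f \<in> carrier F" and \<rho>': "\<And>x. x \<in> carrier L \<Longrightarrow> \<rho>' x = restr V (\<rho> x)"
  shows "free_algebra_eval (Weyl V) \<rho>' f = restr V (eval f)"
proof -
  interpret W: ring "Weyl V" by (rule ring_Weyl)
  have "foldr (\<lambda>x r. \<rho>' x \<otimes>\<^bsub>Weyl V\<^esub> r) xs \<one>\<^bsub>Weyl V\<^esub> = restr V (prod_list (map \<rho> xs))"
    if "set xs \<subseteq> carrier L" for xs
    using that
  proof (induction xs)
    case (Cons x xs)
    then show ?case
      using prod_list_closed[of xs] restr_mult[of V "prod_list (map \<rho> xs)" "\<rho> x"]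
      by (simp add: \<rho>' Weyl_ops_def)
  qed (simp add: restr_1)
  then have "c \<odot>\<^bsub>Weyl V\<^esub> foldr (\<lambda>x r. \<rho>' x \<otimes>\<^bsub>Weyl V\<^esub> r) xs \<one>\<^bsub>Weyl V\<^esub> =
      restr V (scalar_op c * prod_list (map \<rho> xs))" if "set xs \<subseteq> carrier L" for c xs
    using that by (simp add: restr_scale)
  moreover have "restr V (scalar_op c * prod_list (map \<rho> xs)) \<in> carrier (Weyl V)" if "set xs \<subseteq> carrier L" for c xs
    using Weyl_ops_scale[OF prod_list_closed[OF that]] by (simp add: Weyl_ops_def)
  ultimately have "free_algebra_eval (Weyl V) \<rho>' f = (\<Oplus>\<^bsub>Weyl V\<^esub>u\<in>Poly_Mapping.keys f.
      restr V (scalar_op (Poly_Mapping.lookup f u) * prod_list (map \<rho> (letters u))))"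
    unfolding free_algebra_eval_def
    using f by (intro W.add.finprod_cong' refl Pi_I) (simp_all add: free_algebra_carrier)
  also have "\<dots> = restr V (eval f)"
    unfolding eval_def lin_ext_def
    by (rule restr_finsum) (use f in \<open>auto simp: free_algebra_carrier intro!: Weyl_ops_scale prod_list_closed\<close>)
  finally show ?thesis .
qed

lemma hom_closed: "A \<in> carrier (U L) \<Longrightarrow> hom A \<in> Weyl_ops V"
  by (auto simp: U_carrier hom_coset eval_closed)

text \<open>Evaluation is constant on the coset, so the set from which \<open>U_lift\<close>
  extracts its element is a singleton.\<close>

lemma U_lift_eq:
  assumes A: "A \<in> carrier (U L)" and \<rho>': "\<And>x. x \<in> carrier L \<Longrightarrow> \<rho>' x = restr V (\<rho> x)"
  shows "U_lift (Weyl V) \<rho>' A = restr V (hom A)"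
proof -
  obtain f where f: "f \<in> carrier F" "A = I +>\<^bsub>F\<^esub> f" using A by (auto simp: U_carrier)
  have const: "free_algebra_eval (Weyl V) \<rho>' g = restr V (hom A)" if "g \<in> A" for g
    using that f coset_subset[OF f(1)] free_algebra_eval_eq[OF _ \<rho>', of g] eval_coset[of f g]
    by (auto simp: hom_coset)
  have "f \<in> A" using f I.a_rcos_self by blast
  have "free_algebra_eval (Weyl V) \<rho>' ` A = (\<lambda>_. restr V (hom A)) ` A"
    by (rule image_cong[OF refl const])
  also have "\<dots> = {restr V (hom A)}"
    using \<open>f \<in> A\<close> by (rule image_constant)
  finally have "free_algebra_eval (Weyl V) \<rho>' ` A = {restr V (hom A)}" .
  then show ?thesis by (simp add: U_lift_def)
qed

lemma U_lift_image:
  assumes \<rho>': "\<And>x. x \<in> carrier L \<Longrightarrow> \<rho>' x = restr V (\<rho> x)" and S: "S \<subseteq> carrier (U L)"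
  shows "U_lift (Weyl V) \<rho>' ` generated_subalgebra (U L) S =
    generated_subalgebra (Weyl V) ((\<lambda>A. restr V (hom A)) ` S)"
proof -
  interpret H: algebra_hom scalar_op "U L" hom by (rule algebra_hom_hom)
  have closed: "A \<in> carrier (U L) \<Longrightarrow> restr V (hom A) \<in> carrier (Weyl V)" for A
    using hom_closed by (simp add: Weyl_ops_def)
  have "(\<lambda>A. restr V (hom A)) ` generated_subalgebra (U L) S =
      generated_subalgebra (Weyl V) ((\<lambda>A. restr V (hom A)) ` S)"
    by (rule generated_subalgebra_image)
      (use S closed restr_scale[of V _ 1] in \<open>auto simp: ring_U ring_Weyl H.H_add H.H_mult H.H_one H.H_smult H.smult_closed
        restr_add restr_mult restr_1\<close>)
  moreover have "generated_subalgebra (U L) S \<subseteq> carrier (U L)"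
    unfolding generated_subalgebra_def
    by (rule H.R.generate_ring_incl) (use S H.smult_closed in auto)
  ultimately show ?thesis
    using U_lift_eq[OF _ \<rho>'] by (metis (no_types, lifting) image_cong subsetD)
qed

end

section \<open>Representations of Takiff algebras\<close>

text \<open>A block, a power k and a position r with r + k still in the block amount to a pair of
  positions r \<le> s of one block, with s = r + k.\<close>

lemma sum_blocks:
  "(\<Sum>i=1..L. \<Sum>k<\<gamma> i. \<Sum>r=offset \<gamma> i + 1..offset \<gamma> (i + 1) - k. F i k r) =
    (\<Sum>r=1..offset \<gamma> (Suc L). \<Sum>s=1..offset \<gamma> (Suc L).
      if block \<gamma> r = block \<gamma> s \<and> r \<le> s then F (block \<gamma> r) (s - r) r else 0)"
  for F :: "nat \<Rightarrow> nat \<Rightarrow> nat \<Rightarrow> 'a::comm_monoid_add"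
proof -
  let ?K = "{1..offset \<gamma> (Suc L)}"
  let ?S = "{(r, s) \<in> ?K \<times> ?K. block \<gamma> r = block \<gamma> s \<and> r \<le> s}"
  have "(\<Sum>i=1..L. \<Sum>k<\<gamma> i. \<Sum>r=offset \<gamma> i + 1..offset \<gamma> (i + 1) - k. F i k r) =
      (\<Sum>(i, k, r)\<in>(SIGMA i:{1..L}. SIGMA k:{..<\<gamma> i}. {offset \<gamma> i + 1..offset \<gamma> (i + 1) - k}). F i k r)"
    by (simp add: sum.Sigma split_def)
  also have "\<dots> = (\<Sum>(r, s)\<in>?S. F (block \<gamma> r) (s - r) r)"
  proof (rule sum.reindex_bij_witness[where i = "\<lambda>(r, s). (block \<gamma> r, s - r, r)" and j = "\<lambda>(i, k, r). (r, r + k)"])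
    fix x assume "x \<in> (SIGMA i:{1..L}. SIGMA k:{..<\<gamma> i}. {offset \<gamma> i + 1..offset \<gamma> (i + 1) - k})"
    then obtain i k r where x: "x = (i, k, r)" "1 \<le> i" "i \<le> L" "k < \<gamma> i" "offset \<gamma> i < r" "r + k \<le> offset \<gamma> (Suc i)"
      by (auto simp: offset_Suc)
    have "offset \<gamma> (Suc i) \<le> offset \<gamma> (Suc L)" using x by (intro offset_mono) simp
    moreover have "block \<gamma> r = i" "block \<gamma> (r + k) = i"
      using x by (auto intro: block_eqI)
    ultimately show "(case (case x of (i, k, r) \<Rightarrow> (r, r + k)) of (r, s) \<Rightarrow> (block \<gamma> r, s - r, r)) = x"
      "(case x of (i, k, r) \<Rightarrow> (r, r + k)) \<in> ?S"
      "(case (case x of (i, k, r) \<Rightarrow> (r, r + k)) of (r, s) \<Rightarrow> F (block \<gamma> r) (s - r) r) = (case x of (i, k, r) \<Rightarrow> F i k r)"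
      using x by auto
  next
    fix x assume "x \<in> ?S"
    then obtain r s where x: "x = (r, s)" "r \<in> ?K" "s \<in> ?K" "block \<gamma> r = block \<gamma> s" "r \<le> s" by auto
    then show "(case (case x of (r, s) \<Rightarrow> (block \<gamma> r, s - r, r)) of (i, k, r) \<Rightarrow> (r, r + k)) = x"
      "(case x of (r, s) \<Rightarrow> (block \<gamma> r, s - r, r)) \<in> (SIGMA i:{1..L}. SIGMA k:{..<\<gamma> i}. {offset \<gamma> i + 1..offset \<gamma> (i + 1) - k})"
      using block_props[OF x(2)] block_props[OF x(3)] by (auto simp: offset_Suc)
  qed
  also have "\<dots> = (\<Sum>x\<in>?K \<times> ?K. case x of (r, s) \<Rightarrow> if block \<gamma> r = block \<gamma> s \<and> r \<le> s then F (block \<gamma> r) (s - r) r else 0)"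
    by (rule sum.mono_neutral_cong_left) (auto split: if_splits)
  also have "\<dots> = (\<Sum>r\<in>?K. \<Sum>s\<in>?K. if block \<gamma> r = block \<gamma> s \<and> r \<le> s then F (block \<gamma> r) (s - r) r else 0)"
    by (simp add: sum.cartesian_product)
  finally show ?thesis .
qed

text \<open>Elements with the commutation relations of matrix units make the linear extension a Lie
  homomorphism from matrices.\<close>

lemma (in central_scalars) gl_commutator:
  fixes E :: "'i \<Rightarrow> 'i \<Rightarrow> 'o"
  assumes S: "finite S"
    and E: "\<And>u v u' v'. E u v * E u' v' - E u' v' * E u v =
      (if v = u' then E u v' else 0) - (if v' = u then E u' v else 0)"
  shows "(\<Sum>u\<in>S. \<Sum>v\<in>S. cs (\<alpha> u v) * E u v) * (\<Sum>u\<in>S. \<Sum>v\<in>S. cs (\<beta> u v) * E u v) -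
      (\<Sum>u\<in>S. \<Sum>v\<in>S. cs (\<beta> u v) * E u v) * (\<Sum>u\<in>S. \<Sum>v\<in>S. cs (\<alpha> u v) * E u v) =
    (\<Sum>u\<in>S. \<Sum>v\<in>S. cs (\<Sum>w\<in>S. \<alpha> u w * \<beta> w v - \<beta> u w * \<alpha> w v) * E u v)"
proof -
  have mult: "(cs a * x) * (cs b * y) = cs (a * b) * (x * y)" for a b x y
    by (simp add: cs_mult mult.assoc cs_left_commute[of x])
  let ?A = "\<Sum>u\<in>S. \<Sum>v\<in>S. cs (\<alpha> u v) * E u v" and ?B = "\<Sum>u\<in>S. \<Sum>v\<in>S. cs (\<beta> u v) * E u v"
  have A: "?A = (\<Sum>(u, v)\<in>S \<times> S. cs (\<alpha> u v) * E u v)" and B: "?B = (\<Sum>(u, v)\<in>S \<times> S. cs (\<beta> u v) * E u v)"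
    by (simp_all add: sum.cartesian_product)
  have "?B * ?A = (\<Sum>(u, v)\<in>S \<times> S. \<Sum>(u', v')\<in>S \<times> S. cs (\<alpha> u v * \<beta> u' v') * (E u' v' * E u v))"
    unfolding A B sum_product by (subst sum.swap) (simp add: split_def mult mult.commute[of "\<beta> _ _"])
  moreover have "?A * ?B = (\<Sum>(u, v)\<in>S \<times> S. \<Sum>(u', v')\<in>S \<times> S. cs (\<alpha> u v * \<beta> u' v') * (E u v * E u' v'))"
    unfolding A B sum_product by (simp add: split_def mult)
  ultimately have "?A * ?B - ?B * ?A = (\<Sum>(u, v)\<in>S \<times> S. \<Sum>(u', v')\<in>S \<times> S. cs (\<alpha> u v * \<beta> u' v') *
      ((if v = u' then E u v' else 0) - (if v' = u then E u' v else 0)))"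
    by (simp add: sum_subtractf[symmetric] right_diff_distrib[symmetric] split_def E)
  also have "\<dots> = (\<Sum>u\<in>S. \<Sum>v\<in>S. \<Sum>u'\<in>S. \<Sum>v'\<in>S.
      (if v = u' then cs (\<alpha> u v * \<beta> u' v') * E u v' else 0) - (if v' = u then cs (\<alpha> u v * \<beta> u' v') * E u' v else 0))"
    by (simp add: sum.cartesian_product[symmetric] right_diff_distrib if_distrib[of "(*) _"] cong: if_cong)
  also have "\<dots> = (\<Sum>u\<in>S. \<Sum>v\<in>S. \<Sum>v'\<in>S. cs (\<alpha> u v * \<beta> v v') * E u v') -
      (\<Sum>u\<in>S. \<Sum>v\<in>S. \<Sum>u'\<in>S. cs (\<alpha> u v * \<beta> u' u) * E u' v)"
  proof -
    have "(\<Sum>u'\<in>S. \<Sum>v'\<in>S. if v = u' then cs (\<alpha> u v * \<beta> u' v') * E u v' else 0) =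
        (\<Sum>v'\<in>S. cs (\<alpha> u v * \<beta> v v') * E u v')" if "v \<in> S" for u v
      using that S by (subst sum.swap) simp
    then show ?thesis using S by (simp add: sum_subtractf)
  qed
  also have "(\<Sum>u\<in>S. \<Sum>v\<in>S. \<Sum>v'\<in>S. cs (\<alpha> u v * \<beta> v v') * E u v') =
      (\<Sum>u\<in>S. \<Sum>v'\<in>S. \<Sum>v\<in>S. cs (\<alpha> u v * \<beta> v v') * E u v')"
    by (intro sum.cong refl sum.swap)
  also have "(\<Sum>u\<in>S. \<Sum>v\<in>S. \<Sum>u'\<in>S. cs (\<alpha> u v * \<beta> u' u) * E u' v) =
      (\<Sum>u\<in>S. \<Sum>u'\<in>S. \<Sum>v\<in>S. cs (\<alpha> u v * \<beta> u' u) * E u' v)"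
    by (intro sum.cong refl sum.swap)
  also have "\<dots> = (\<Sum>u'\<in>S. \<Sum>u\<in>S. \<Sum>v\<in>S. cs (\<alpha> u v * \<beta> u' u) * E u' v)"
    by (rule sum.swap)
  also have "\<dots> = (\<Sum>u'\<in>S. \<Sum>v\<in>S. \<Sum>u\<in>S. cs (\<alpha> u v * \<beta> u' u) * E u' v)"
    by (intro sum.cong refl sum.swap)
  finally show ?thesis
    by (simp add: cs_sum sum_distrib_right sum_subtractf[symmetric] left_diff_distrib[symmetric])
      (simp add: cs_diff mult.commute)
qed

text \<open>The multiple of the monomial has no coefficients below n, and the remainder has none
  from n on.\<close>

lemma coeff_mod_monom:
  fixes f :: "complex poly"
  shows "coeff (f mod Polynomial.monom 1 n) k = (if k < n then coeff f k else 0)"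
proof (cases "k < n")
  case True
  have "coeff f k = coeff (Polynomial.monom 1 n * (f div Polynomial.monom 1 n) + f mod Polynomial.monom 1 n) k"
    by simp
  also have "\<dots> = coeff (f mod Polynomial.monom 1 n) k"
    unfolding coeff_add using True by (simp add: coeff_monom_mult)
  finally show ?thesis using True by simp
next
  case False
  have "Polynomial.monom 1 n \<noteq> (0 :: complex poly)" by simp
  from degree_mod_less[OF this, of f] False show ?thesis
    by (auto simp: degree_monom_eq intro: coeff_eq_0)
qed

lemma gl_takiff_simps [simp]:
  "lie_add (gl_takiff N L \<gamma>) A B = (\<lambda>i a b. A i a b + B i a b)"
  "lie_scale (gl_takiff N L \<gamma>) c A = (\<lambda>i a b. Polynomial.smult c (A i a b))"
  "lie_bracket (gl_takiff N L \<gamma>) A B = (\<lambda>i a b.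
     (\<Sum>c=1..N. A i a c * B i c b - B i a c * A i c b) mod Polynomial.monom 1 (\<gamma> i))"
  by (simp_all add: gl_takiff_def)

lemma gl_takiff_carrier:
  "A \<in> carrier (gl_takiff N L \<gamma>) \<longleftrightarrow> (\<forall>i a b. if i \<in> {1..L} \<and> a \<in> {1..N} \<and> b \<in> {1..N}
     then Polynomial.degree (A i a b) < \<gamma> i else A i a b = 0)"
  by (simp add: gl_takiff_def)

lemma closed_lie_gl_takiff: "closed_lie (gl_takiff N L \<gamma>)"
proof
  fix A B assume AB: "A \<in> carrier (gl_takiff N L \<gamma>)" "B \<in> carrier (gl_takiff N L \<gamma>)"
  show "lie_add (gl_takiff N L \<gamma>) A B \<in> carrier (gl_takiff N L \<gamma>)"
    unfolding gl_takiff_carrier gl_takiff_simps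
  proof (intro allI)
    fix i a b
    show "if i \<in> {1..L} \<and> a \<in> {1..N} \<and> b \<in> {1..N}
        then Polynomial.degree (A i a b + B i a b) < \<gamma> i else A i a b + B i a b = 0"
    proof (cases "i \<in> {1..L} \<and> a \<in> {1..N} \<and> b \<in> {1..N}")
      case True
      then have "Polynomial.degree (A i a b) < \<gamma> i" "Polynomial.degree (B i a b) < \<gamma> i"
        using AB unfolding gl_takiff_carrier by meson+
      then have "Polynomial.degree (A i a b + B i a b) < \<gamma> i" by (rule degree_add_less)
      then show ?thesis using True by simp
    next
      case False
      then have "A i a b = 0" "B i a b = 0" using AB unfolding gl_takiff_carrier by meson+
      then show ?thesis unfolding if_not_P[OF False] by simp
    qed
  qed
  show "lie_bracket (gl_takiff N L \<gamma>) A B \<in> carrier (gl_takiff N L \<gamma>)"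
    unfolding gl_takiff_carrier gl_takiff_simps
  proof (intro allI)
    fix i a b
    let ?f = "\<Sum>c=1..N. A i a c * B i c b - B i a c * A i c b" and ?m = "Polynomial.monom 1 (\<gamma> i) :: complex poly"
    show "if i \<in> {1..L} \<and> a \<in> {1..N} \<and> b \<in> {1..N} then Polynomial.degree (?f mod ?m) < \<gamma> i else ?f mod ?m = 0"
    proof (cases "i \<in> {1..L} \<and> a \<in> {1..N} \<and> b \<in> {1..N}")
      case True
      \<comment> \<open>A degree is strictly below \<open>\<gamma> i\<close>, which forces
        \<open>\<gamma> i\<close> to be positive.\<close>
      then have "0 < \<gamma> i" using AB(1) unfolding gl_takiff_carrier by (metis less_nat_zero_code neq0_conv)
      moreover have "?m \<noteq> 0" by simp
      ultimately have "Polynomial.degree (?f mod ?m) < \<gamma> i"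
        using degree_mod_less[of ?m ?f] by (auto simp: degree_monom_eq)
      then show ?thesis using True by simp
    next
      case False
      then have "A i a c * B i c b - B i a c * A i c b = 0" for c
        using AB unfolding gl_takiff_carrier by (metis cancel_comm_monoid_add_class.diff_cancel mult_zero_left mult_zero_right)
      then have "?f = 0" by (simp only: sum.neutral_const)
      then show ?thesis unfolding if_not_P[OF False] by simp
    qed
  qed
next
  fix A c assume A: "A \<in> carrier (gl_takiff N L \<gamma>)"
  then show "lie_scale (gl_takiff N L \<gamma>) c A \<in> carrier (gl_takiff N L \<gamma>)"
    unfolding gl_takiff_carrier gl_takiff_simps
    by (metis degree_smult_le le_less_trans smult_0_right)
qed

text \<open>The Takiff algebra acts through the block Toeplitz matrices with entries indexed by pairs of a
  row of \<open>gl_N\<close> and a position \<open>r\<close> in some block: \<open>t^k\<close> shifts \<open>r\<close> to \<open>r + k\<close>.\<close>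

definition toeplitz :: "(nat \<Rightarrow> nat) \<Rightarrow> (nat \<Rightarrow> nat \<Rightarrow> nat \<Rightarrow> complex poly) \<Rightarrow> nat \<times> nat \<Rightarrow> nat \<times> nat \<Rightarrow> complex" where
  "toeplitz \<gamma> A = (\<lambda>(a, s) (b, r). if block \<gamma> r = block \<gamma> s \<and> r \<le> s then coeff (A (block \<gamma> r) a b) (s - r) else 0)"

text \<open>Multiplication of polynomials is convolution of coefficients, that is, multiplication of
  triangular Toeplitz matrices within each block.\<close>

lemma toeplitz_mult:
  assumes r: "r \<in> {1..offset \<gamma> (Suc L)}" and s: "s \<in> {1..offset \<gamma> (Suc L)}"
  shows "(\<Sum>w\<in>{1..N} \<times> {1..offset \<gamma> (Suc L)}. toeplitz \<gamma> A (a, s) w * toeplitz \<gamma> B w (b, r)) =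
    (if block \<gamma> r = block \<gamma> s \<and> r \<le> s
     then coeff (\<Sum>c=1..N. A (block \<gamma> r) a c * B (block \<gamma> r) c b) (s - r) else 0)"
proof -
  let ?K = "{1..offset \<gamma> (Suc L)}"
  have "(\<Sum>q\<in>?K. toeplitz \<gamma> A (a, s) (c, q) * toeplitz \<gamma> B (c, q) (b, r)) =
      (if block \<gamma> r = block \<gamma> s \<and> r \<le> s then coeff (A (block \<gamma> r) a c * B (block \<gamma> r) c b) (s - r) else 0)" for c
  proof (cases "block \<gamma> r = block \<gamma> s \<and> r \<le> s")
    case True
    have "(\<Sum>q\<in>?K. toeplitz \<gamma> A (a, s) (c, q) * toeplitz \<gamma> B (c, q) (b, r)) =
        (\<Sum>q=r..s. coeff (A (block \<gamma> r) a c) (s - q) * coeff (B (block \<gamma> r) c b) (q - r))"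
    proof (rule sum.mono_neutral_cong_right)
      show "toeplitz \<gamma> A (a, s) (c, q) * toeplitz \<gamma> B (c, q) (b, r) =
          coeff (A (block \<gamma> r) a c) (s - q) * coeff (B (block \<gamma> r) c b) (q - r)" if "q \<in> {r..s}" for q
      proof -
        have "block \<gamma> q = block \<gamma> r"
          by (rule block_between[of r s \<gamma> L]) (use True that r s in auto)
        then show ?thesis using True that by (simp add: toeplitz_def)
      qed
    qed (use r s in \<open>auto simp: toeplitz_def\<close>)
    also have "\<dots> = (\<Sum>j\<le>s - r. coeff (A (block \<gamma> r) a c) j * coeff (B (block \<gamma> r) c b) (s - r - j))"
      by (rule sum.reindex_bij_witness[where i = "\<lambda>j. s - j" and j = "\<lambda>q. s - q"]) (use True in auto)
    finally show ?thesis using True by (simp add: coeff_mult)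
  next
    case False
    then have "toeplitz \<gamma> A (a, s) (c, q) * toeplitz \<gamma> B (c, q) (b, r) = 0" for q
      by (auto simp: toeplitz_def)
    then show ?thesis using False by (simp only: sum.neutral_const if_False)
  qed
  then show ?thesis
    unfolding sum.cartesian_product'
    by (cases "block \<gamma> r = block \<gamma> s \<and> r \<le> s")
      (simp_all only: if_True if_False coeff_sum sum.neutral_const simp_thms)
qed

text \<open>Two positions of a block differ by less than its size, so the matrix never shows a
  coefficient that reduction modulo t^\<gamma> removes.\<close>

lemma toeplitz_bracket:
  assumes "u \<in> {1..N} \<times> {1..offset \<gamma> (Suc L)}" "v \<in> {1..N} \<times> {1..offset \<gamma> (Suc L)}"
  shows "toeplitz \<gamma> (lie_bracket (gl_takiff N L \<gamma>) A B) u v =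
    (\<Sum>w\<in>{1..N} \<times> {1..offset \<gamma> (Suc L)}. toeplitz \<gamma> A u w * toeplitz \<gamma> B w v - toeplitz \<gamma> B u w * toeplitz \<gamma> A w v)"
proof -
  obtain a s b r where uv: "u = (a, s)" "v = (b, r)" by (metis surj_pair)
  then have rs: "r \<in> {1..offset \<gamma> (Suc L)}" "s \<in> {1..offset \<gamma> (Suc L)}" using assms by auto
  have "s - r < \<gamma> (block \<gamma> r)" if "block \<gamma> r = block \<gamma> s" "r \<le> s"
    using block_props[OF rs(1)] block_props[OF rs(2)] that by (auto simp: offset_Suc)
  then show ?thesis
    unfolding uv sum_subtractf toeplitz_mult[OF rs]
    by (simp add: toeplitz_def coeff_mod_monom coeff_sum sum_subtractf)
qed

text \<open>The part of order 0 in \<partial> of an entry of the Gaudin matrix after the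
  homomorphism is applied, with the poles collected in \<open>R\<close>.\<close>

definition gaudin_series :: "(complex \<Rightarrow> 'o::ring_1) \<Rightarrow> nat \<Rightarrow> (nat \<Rightarrow> nat \<Rightarrow> complex) \<Rightarrow>
    (nat \<Rightarrow> nat \<Rightarrow> complex fps) \<Rightarrow> (nat \<Rightarrow> nat \<Rightarrow> nat \<Rightarrow> nat \<Rightarrow> 'o) \<Rightarrow> nat \<Rightarrow> nat \<Rightarrow> nat \<Rightarrow> 'o" where
  "gaudin_series cs K A R e a b n = - (if n = 0 then cs (A a b) else 0) -
     (\<Sum>r=1..K. \<Sum>s=1..K. cs (fps_nth (R r s) n) * e a s b r)"

text \<open>\<open>e a s b r\<close> plays the part of the matrix unit with row (a, s) and column
  (b, r).\<close>

locale gl_rep = central_scalars cs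
  for cs :: "complex \<Rightarrow> 'o::ring_1" +
  fixes e :: "nat \<Rightarrow> nat \<Rightarrow> nat \<Rightarrow> nat \<Rightarrow> 'o"
  assumes commutator: "e a s b r * e a' s' b' r' - e a' s' b' r' * e a s b r =
    (if b = a' \<and> r = s' then e a s b' r' else 0) - (if b' = a \<and> r' = s then e a' s' b r else 0)"
begin

definition takiff_unit_image :: "(nat \<Rightarrow> nat) \<Rightarrow> nat \<Rightarrow> nat \<Rightarrow> nat \<Rightarrow> nat \<Rightarrow> 'o" where
  "takiff_unit_image \<gamma> i k a b = (\<Sum>r=offset \<gamma> i + 1..offset \<gamma> (i + 1) - k. e a (r + k) b r)"

definition takiff_image :: "nat \<Rightarrow> nat \<Rightarrow> (nat \<Rightarrow> nat) \<Rightarrow> (nat \<Rightarrow> nat \<Rightarrow> nat \<Rightarrow> complex poly) \<Rightarrow> 'o" where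
  "takiff_image N L \<gamma> A = (\<Sum>i=1..L. \<Sum>k<\<gamma> i. \<Sum>a=1..N. \<Sum>b=1..N.
     cs (coeff (A i a b) k) * takiff_unit_image \<gamma> i k a b)"

text \<open>Regrouping by pairs of positions exhibits the image as a linear combination of matrix
  units with a Toeplitz matrix of coefficients, the form that \<open>gl_commutator\<close>
  handles.\<close>

lemma takiff_image_toeplitz:
  "takiff_image N L \<gamma> A = (\<Sum>u\<in>{1..N} \<times> {1..offset \<gamma> (Suc L)}. \<Sum>v\<in>{1..N} \<times> {1..offset \<gamma> (Suc L)}.
     cs (toeplitz \<gamma> A u v) * (case u of (a, s) \<Rightarrow> case v of (b, r) \<Rightarrow> e a s b r))"
proof -
  let ?K = "{1..offset \<gamma> (Suc L)}" and ?N = "{1..N}"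
  let ?f = "\<lambda>a s b r. cs (toeplitz \<gamma> A (a, s) (b, r)) * e a s b r"
  have "(\<Sum>a\<in>?N. \<Sum>b\<in>?N. cs (coeff (A i a b) k) * takiff_unit_image \<gamma> i k a b) =
      (\<Sum>r=offset \<gamma> i + 1..offset \<gamma> (i + 1) - k. \<Sum>a\<in>?N. \<Sum>b\<in>?N. cs (coeff (A i a b) k) * e a (r + k) b r)" for i k
  proof -
    have "(\<Sum>a\<in>?N. \<Sum>b\<in>?N. cs (coeff (A i a b) k) * takiff_unit_image \<gamma> i k a b) =
        (\<Sum>a\<in>?N. \<Sum>b\<in>?N. \<Sum>r=offset \<gamma> i + 1..offset \<gamma> (i + 1) - k. cs (coeff (A i a b) k) * e a (r + k) b r)"
      by (simp add: takiff_unit_image_def sum_distrib_left)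
    also have "\<dots> = (\<Sum>a\<in>?N. \<Sum>r=offset \<gamma> i + 1..offset \<gamma> (i + 1) - k. \<Sum>b\<in>?N. cs (coeff (A i a b) k) * e a (r + k) b r)"
      by (intro sum.cong refl sum.swap)
    also have "\<dots> = (\<Sum>r=offset \<gamma> i + 1..offset \<gamma> (i + 1) - k. \<Sum>a\<in>?N. \<Sum>b\<in>?N. cs (coeff (A i a b) k) * e a (r + k) b r)"
      by (rule sum.swap)
    finally show ?thesis .
  qed
  then have "takiff_image N L \<gamma> A = (\<Sum>r\<in>?K. \<Sum>s\<in>?K. if block \<gamma> r = block \<gamma> s \<and> r \<le> s then
      (\<Sum>a\<in>?N. \<Sum>b\<in>?N. cs (coeff (A (block \<gamma> r) a b) (s - r)) * e a (r + (s - r)) b r) else 0)"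
    unfolding takiff_image_def by (simp only: sum_blocks)
  also have "\<dots> = (\<Sum>r\<in>?K. \<Sum>s\<in>?K. \<Sum>a\<in>?N. \<Sum>b\<in>?N. ?f a s b r)"
  proof (intro sum.cong refl)
    fix r s
    show "(if block \<gamma> r = block \<gamma> s \<and> r \<le> s then
        (\<Sum>a\<in>?N. \<Sum>b\<in>?N. cs (coeff (A (block \<gamma> r) a b) (s - r)) * e a (r + (s - r)) b r) else 0) =
      (\<Sum>a\<in>?N. \<Sum>b\<in>?N. ?f a s b r)"
      by (cases "block \<gamma> r = block \<gamma> s \<and> r \<le> s") (simp_all only: toeplitz_def prod.case if_True if_False
          le_add_diff_inverse cs_0 mult_zero_left sum.neutral_const simp_thms)
  qed
  also have "\<dots> = (\<Sum>r\<in>?K. \<Sum>a\<in>?N. \<Sum>s\<in>?K. \<Sum>b\<in>?N. ?f a s b r)"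
    by (intro sum.cong[OF refl] sum.swap)
  also have "\<dots> = (\<Sum>a\<in>?N. \<Sum>r\<in>?K. \<Sum>s\<in>?K. \<Sum>b\<in>?N. ?f a s b r)"
    by (rule sum.swap)
  also have "\<dots> = (\<Sum>a\<in>?N. \<Sum>s\<in>?K. \<Sum>r\<in>?K. \<Sum>b\<in>?N. ?f a s b r)"
    by (intro sum.cong[OF refl] sum.swap)
  also have "\<dots> = (\<Sum>a\<in>?N. \<Sum>s\<in>?K. \<Sum>b\<in>?N. \<Sum>r\<in>?K. ?f a s b r)"
    by (intro sum.cong[OF refl]) (rule sum.swap)
  finally show ?thesis
    by (simp add: sum.cartesian_product')
qed

lemma lie_rep_takiff_image: "lie_rep cs (gl_takiff N L \<gamma>) (takiff_image N L \<gamma>)"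
proof (intro lie_rep.intro lie_rep_axioms.intro central_scalars_axioms closed_lie_gl_takiff)
  fix A B :: "nat \<Rightarrow> nat \<Rightarrow> nat \<Rightarrow> complex poly" and c
  show "takiff_image N L \<gamma> (lie_add (gl_takiff N L \<gamma>) A B) = takiff_image N L \<gamma> A + takiff_image N L \<gamma> B"
    by (simp add: takiff_image_def cs_add distrib_right sum.distrib)
  show "takiff_image N L \<gamma> (lie_scale (gl_takiff N L \<gamma>) c A) = cs c * takiff_image N L \<gamma> A"
    by (simp add: takiff_image_def cs_mult sum_distrib_left mult.assoc)
  let ?S = "{1..N} \<times> {1..offset \<gamma> (Suc L)}"
  let ?E = "\<lambda>u v. case u of (a, s) \<Rightarrow> case v of (b, r) \<Rightarrow> e a s b r"
  have "takiff_image N L \<gamma> A * takiff_image N L \<gamma> B - takiff_image N L \<gamma> B * takiff_image N L \<gamma> A =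
    (\<Sum>u\<in>?S. \<Sum>v\<in>?S. cs (\<Sum>w\<in>?S. toeplitz \<gamma> A u w * toeplitz \<gamma> B w v - toeplitz \<gamma> B u w * toeplitz \<gamma> A w v) * ?E u v)"
    unfolding takiff_image_toeplitz
  proof (rule gl_commutator)
    show "?E u v * ?E u' v' - ?E u' v' * ?E u v = (if v = u' then ?E u v' else 0) - (if v' = u then ?E u' v else 0)"
      for u v u' v'
      by (cases u; cases v; cases u'; cases v') (simp only: prod.case prod.inject commutator)
  qed simp
  also have "\<dots> = takiff_image N L \<gamma> (lie_bracket (gl_takiff N L \<gamma>) A B)"
    unfolding takiff_image_toeplitz
    by (intro sum.cong refl arg_cong2[of _ _ _ _ "(*)"] arg_cong[of _ _ cs] toeplitz_bracket[symmetric])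
  finally show "takiff_image N L \<gamma> (lie_bracket (gl_takiff N L \<gamma>) A B) =
      takiff_image N L \<gamma> A * takiff_image N L \<gamma> B - takiff_image N L \<gamma> B * takiff_image N L \<gamma> A" by simp
qed

lemma takiff_unit_closed:
  assumes "\<forall>i\<in>{1..L}. 0 < \<gamma> i" "i \<in> {1..L}" "k < \<gamma> i" "a \<in> {1..N}" "b \<in> {1..N}"
  shows "takiff_unit i k a b \<in> carrier (gl_takiff N L \<gamma>)"
  using assms by (auto simp: gl_takiff_carrier takiff_unit_def degree_monom_eq)

lemma takiff_image_unit:
  assumes "i \<in> {1..L}" "k < \<gamma> i" "a \<in> {1..N}" "b \<in> {1..N}"
  shows "takiff_image N L \<gamma> (takiff_unit i k a b) = takiff_unit_image \<gamma> i k a b"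
proof -
  have entry: "cs (coeff (takiff_unit i k a b i' a' b') k') * takiff_unit_image \<gamma> i' k' a' b' =
      (if b' = b then if a' = a then if k' = k then if i' = i then takiff_unit_image \<gamma> i k a b else 0 else 0 else 0 else 0)"
    for i' k' a' b'
    by (auto simp: takiff_unit_def)
  have "takiff_image N L \<gamma> (takiff_unit i k a b) = (\<Sum>i'=1..L. \<Sum>k'<\<gamma> i'. \<Sum>a'=1..N. \<Sum>b'=1..N.
      if b' = b then if a' = a then if k' = k then if i' = i then takiff_unit_image \<gamma> i k a b else 0 else 0 else 0 else 0)"
    unfolding takiff_image_def entry ..
  also have "\<dots> = (\<Sum>i'=1..L. if i' = i then if k < \<gamma> i' then takiff_unit_image \<gamma> i k a b else 0 else 0)"
    by (rule sum.cong[OF refl]) (use assms in simp)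
  finally show ?thesis using assms by simp
qed

lemma
  assumes pos: "\<forall>i\<in>{1..L}. 0 < \<gamma> i"
  shows hom_gaudin_cdet: "lie_rep.hom cs (takiff_image N L \<gamma>)
     (cdet (diff_ops (U (gl_takiff N L \<gamma>))) N (gaudin_matrix N J L z \<gamma>) i n) =
   op_cdet N (gaudin_series cs (offset \<gamma> (Suc L)) J (jordan_resolvent z \<gamma>) e) i n"
  and gaudin_cdet_closed: "cdet (diff_ops (U (gl_takiff N L \<gamma>))) N (gaudin_matrix N J L z \<gamma>) i n
     \<in> carrier (U (gl_takiff N L \<gamma>))"
proof -
  let ?K = "{1..offset \<gamma> (Suc L)}"
  interpret lie_rep cs "gl_takiff N L \<gamma>" "takiff_image N L \<gamma>" by (rule lie_rep_takiff_image)
  interpret H: algebra_hom cs "U (gl_takiff N L \<gamma>)" hom by (rule algebra_hom_hom)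
  let ?f = "gaudin_series cs (offset \<gamma> (Suc L)) J (jordan_resolvent z \<gamma>) e"
  have "H.represents (gaudin_matrix N J L z \<gamma> a b)
      (\<lambda>k n. if k = 0 then ?f a b n else if k = 1 \<and> n = 0 \<and> a = b then 1 else 0)"
    if ab: "a \<in> {1..N}" "b \<in> {1..N}" for a b
  proof -
    \<comment> \<open>The pole (z - z_i)^-(k+1) is the resolvent entry at two positions of block i
      at distance k, so the sum over poles becomes a sum over pairs of positions.\<close>
    have entry: "(\<Sum>i=1..L. \<Sum>k<\<gamma> i. cs (fps_nth (inv_linear (z i) ^ (k + 1)) n) * hom (U_incl (gl_takiff N L \<gamma>) (takiff_unit i k a b))) =
        (\<Sum>r\<in>?K. \<Sum>s\<in>?K. cs (fps_nth (jordan_resolvent z \<gamma> r s) n) * e a s b r)" for n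
    proof -
      have "(\<Sum>i=1..L. \<Sum>k<\<gamma> i. cs (fps_nth (inv_linear (z i) ^ (k + 1)) n) * hom (U_incl (gl_takiff N L \<gamma>) (takiff_unit i k a b))) =
          (\<Sum>i=1..L. \<Sum>k<\<gamma> i. \<Sum>r=offset \<gamma> i + 1..offset \<gamma> (i + 1) - k. cs (fps_nth (inv_linear (z i) ^ (k + 1)) n) * e a (r + k) b r)"
        using ab by (intro sum.cong refl)
          (simp add: hom_incl takiff_unit_closed[OF pos] takiff_image_unit takiff_unit_image_def sum_distrib_left)
      also have "\<dots> = (\<Sum>r\<in>?K. \<Sum>s\<in>?K. if block \<gamma> r = block \<gamma> s \<and> r \<le> s
          then cs (fps_nth (inv_linear (z (block \<gamma> r)) ^ (s - r + 1)) n) * e a (r + (s - r)) b r else 0)"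
        by (rule sum_blocks)
      also have "\<dots> = (\<Sum>r\<in>?K. \<Sum>s\<in>?K. cs (fps_nth (jordan_resolvent z \<gamma> r s) n) * e a s b r)"
        by (intro sum.cong refl) (simp add: jordan_resolvent_def)
      finally show ?thesis .
    qed
    have "H.represents (gaudin_matrix N J L z \<gamma> a b)
      (\<lambda>j n. if j = 0 then - (if n = 0 then cs (J a b) else 0) - (\<Sum>i=1..L. \<Sum>k<\<gamma> i.
           cs (fps_nth (inv_linear (z i) ^ (k + 1)) n) * hom (U_incl (gl_takiff N L \<gamma>) (takiff_unit i k a b)))
         else if j = 1 \<and> n = 0 \<and> a = b then 1 else 0)"
      unfolding gaudin_matrix_def Let_def
      by (rule H.represents_gaudin) (use ab in \<open>auto intro!: U_incl_closed takiff_unit_closed[OF pos]\<close>)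
    then show ?thesis unfolding entry gaudin_series_def .
  qed
  then have "H.represents (cdet (diff_ops (U (gl_takiff N L \<gamma>))) N (gaudin_matrix N J L z \<gamma>)) (op_cdet N ?f)"
    by (rule H.represents_cdet)
  then show "hom (cdet (diff_ops (U (gl_takiff N L \<gamma>))) N (gaudin_matrix N J L z \<gamma>) i n) = op_cdet N ?f i n"
    "cdet (diff_ops (U (gl_takiff N L \<gamma>))) N (gaudin_matrix N J L z \<gamma>) i n \<in> carrier (U (gl_takiff N L \<gamma>))"
    by (auto simp: H.represents_def H.D_closed)
qed

end

section \<open>The two images\<close>

text \<open>The two orders of p and q differ by a constant. Such constants have no effect on
  commutators, and they cancel between the two terms on the right of the relation, so both orders
  satisfy it.\<close>

lemma gl_rep_oscillators:
  fixes p q :: "nat \<Rightarrow> nat \<Rightarrow> 'o::ring_1"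
  assumes "central_scalars cs"
    and pp: "\<And>a s b r. p a s * p b r = p b r * p a s" and qq: "\<And>a s b r. q a s * q b r = q b r * q a s"
    and qp: "\<And>a s b r. q b r * p a s = p a s * q b r + (if b = a \<and> r = s then 1 else 0)"
  shows "gl_rep cs (\<lambda>a s b r. p a s * q b r)" and "gl_rep cs (\<lambda>a s b r. q b r * p a s)"
proof -
  interpret central_scalars cs by fact
  have mid: "x * (q b r * p a s) * y = x * (p a s * q b r) * y + (if b = a \<and> r = s then x * y else 0)" for x y a s b r
    by (simp add: qp distrib_left distrib_right)
  show "gl_rep cs (\<lambda>a s b r. p a s * q b r)"
  proof
    fix a s b r a' s' b' r'
    have "p a s * q b r * (p a' s' * q b' r') = (p a s * p a' s') * (q b r * q b' r') + (if b = a' \<and> r = s' then p a s * q b' r' else 0)"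
      using mid[of "p a s" b r a' s' "q b' r'"] by (simp only: mult.assoc)
    moreover have "p a' s' * q b' r' * (p a s * q b r) = (p a s * p a' s') * (q b r * q b' r') + (if b' = a \<and> r' = s then p a' s' * q b r else 0)"
    proof -
      have "p a' s' * (p a s * q b' r') * q b r = (p a s * p a' s') * (q b r * q b' r')"
        by (metis mult.assoc pp qq)
      then show ?thesis
        using mid[of "p a' s'" b' r' a s "q b r"] by (simp only: mult.assoc)
    qed
    ultimately show "p a s * q b r * (p a' s' * q b' r') - p a' s' * q b' r' * (p a s * q b r) =
        (if b = a' \<and> r = s' then p a s * q b' r' else 0) - (if b' = a \<and> r' = s then p a' s' * q b r else 0)"
      by simp
  qed
  show "gl_rep cs (\<lambda>a s b r. q b r * p a s)"
  proof
    fix a s b r a' s' b' r'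
    have "q b r * (q b' r' * p a s) * p a' s' = q b r * p a s * (q b' r' * p a' s') + (if b' = a \<and> r' = s then q b r * p a' s' else 0)"
      using mid[of "q b r" b' r' a s "p a' s'"] by (simp only: mult.assoc)
    moreover have "q b' r' * (q b r * p a' s') * p a s = q b' r' * p a' s' * (q b r * p a s) + (if b = a' \<and> r = s' then q b' r' * p a s else 0)"
      using mid[of "q b' r'" b r a' s' "p a s"] by (simp only: mult.assoc)
    moreover have "q b r * (q b' r' * p a s) * p a' s' = q b' r' * (q b r * p a' s') * p a s"
      by (metis mult.assoc pp qq)
    ultimately show "q b r * p a s * (q b' r' * p a' s') - q b' r' * p a' s' * (q b r * p a s) =
        (if b = a' \<and> r = s' then q b' r' * p a s else 0) - (if b' = a \<and> r' = s then q b r * p a' s' else 0)"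
      by (simp add: algebra_simps)
  qed
qed

lemma restr_finsum_eq:
  assumes "\<And>x. x \<in> S \<Longrightarrow> f x = restr V (f' x)" "\<And>x. x \<in> S \<Longrightarrow> f' x \<in> Weyl_ops V"
  shows "finsum (Weyl V) f S = restr V (\<Sum>x\<in>S. f' x)"
proof -
  interpret W: ring "Weyl V" by (rule ring_Weyl)
  have "finsum (Weyl V) f S = (\<Oplus>\<^bsub>Weyl V\<^esub>x\<in>S. restr V (f' x))"
    by (rule W.add.finprod_cong') (use assms in \<open>auto simp: Weyl_ops_def\<close>)
  then show ?thesis using restr_finsum[of S f' V] assms by simp
qed

lemma Weyl_takiff_image:
  assumes "gl_rep scalar_op e" and pos: "\<forall>i\<in>{1..L}. 0 < \<gamma> i"
    and closed: "\<And>i k a b. i \<in> {1..L} \<Longrightarrow> k < \<gamma> i \<Longrightarrow> a \<in> {1..N} \<Longrightarrow> b \<in> {1..N} \<Longrightarrow>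
      gl_rep.takiff_unit_image e \<gamma> i k a b \<in> Weyl_ops V"
    and h: "\<And>i k a b. i \<in> {1..L} \<Longrightarrow> k < \<gamma> i \<Longrightarrow> a \<in> {1..N} \<Longrightarrow> b \<in> {1..N} \<Longrightarrow>
      h i k a b = restr V (gl_rep.takiff_unit_image e \<gamma> i k a b)"
  shows "U_lift (Weyl V) (takiff_linear (Weyl V) N L \<gamma> h) ` gaudin_algebra N J L z \<gamma> =
    generated_subalgebra (Weyl V) {restr V (op_cdet N (gaudin_series scalar_op (offset \<gamma> (Suc L)) J (jordan_resolvent z \<gamma>) e) i n) | i n. i < N}" (is "?lhs = ?rhs")
    and "restr V (op_cdet N (gaudin_series scalar_op (offset \<gamma> (Suc L)) J (jordan_resolvent z \<gamma>) e) i n) \<in> carrier (Weyl V)"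
proof -
  interpret gl_rep scalar_op e by fact
  have image_closed: "takiff_image N L \<gamma> A \<in> Weyl_ops V" for A
    unfolding takiff_image_def by (intro Weyl_ops_sum Weyl_ops_scale closed) auto
  interpret weyl_rep "gl_takiff N L \<gamma>" "takiff_image N L \<gamma>" V
    by (intro weyl_rep.intro weyl_rep_axioms.intro lie_rep_takiff_image image_closed)
  interpret W: ring "Weyl V" by (rule ring_Weyl)
  have linear: "takiff_linear (Weyl V) N L \<gamma> h A = restr V (takiff_image N L \<gamma> A)" for A
    unfolding takiff_linear_def takiff_image_def
    by (intro restr_finsum_eq Weyl_ops_sum Weyl_ops_scale closed) (auto simp: h restr_scale)
  let ?S = "{cdet (diff_ops (U (gl_takiff N L \<gamma>))) N (gaudin_matrix N J L z \<gamma>) i n | i n. i < N}"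
  have "U_lift (Weyl V) (takiff_linear (Weyl V) N L \<gamma> h) ` gaudin_algebra N J L z \<gamma> =
      generated_subalgebra (Weyl V) ((\<lambda>A. restr V (hom A)) ` ?S)"
    unfolding gaudin_algebra_def Let_def
    by (rule U_lift_image) (use linear gaudin_cdet_closed[OF pos] in auto)
  also have "(\<lambda>A. restr V (hom A)) ` ?S = {restr V (op_cdet N (gaudin_series scalar_op (offset \<gamma> (Suc L)) J (jordan_resolvent z \<gamma>) e) i n) | i n. i < N}"
    using hom_gaudin_cdet[OF pos, of N J z] by (auto simp: image_iff) metis+
  finally show "?lhs = ?rhs" .
  show "restr V (op_cdet N (gaudin_series scalar_op (offset \<gamma> (Suc L)) J (jordan_resolvent z \<gamma>) e) i n) \<in> carrier (Weyl V)"
    using hom_closed[OF gaudin_cdet_closed[OF pos, of N J z i n]] hom_gaudin_cdet[OF pos, of N J z i n]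
    by (simp add: Weyl_ops_def)
qed

section \<open>Transfer of generators between the two algebras\<close>

text \<open>Each power of \<partial> + \<open>g\<close> keeps leading coefficient 1. From the degree
  of \<open>W\<close> on, the coefficients are therefore 1 or 0 and lie in every subalgebra, which
  reconciles the finite range of generators with conditions on all coefficients.\<close>

lemma coeff_shift_monic:
  assumes "monic W" "Polynomial.degree W \<le> i"
  shows "coeff (shift g W) i = (if i = Polynomial.degree W then 1 else 0)"
proof -
  have T: "coeff ((shifted_dz g ^^ j) 1) i = (if i = j then 1 else 0)" if "j \<le> i" for j i
    using that
  proof (induction j arbitrary: i)
    case (Suc j)
    then obtain k where "i = Suc k" by (cases i) auto
    with Suc show ?case
      by (simp add: shifted_dz_def coeff_poly_dz derivationD[OF derivation_fps_dz])
  qed (auto simp: coeff_1)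
  have "coeff (shift g W) i = (\<Sum>j\<le>Polynomial.degree W. if i = j then coeff W j else 0)"
    unfolding shift_def coeff_sum by (rule sum.cong) (use assms(2) T in auto)
  also have "\<dots> = (if i = Polynomial.degree W then 1 else 0)"
    using assms by auto
  finally show ?thesis .
qed

definition gaudin_char_poly :: "nat \<Rightarrow> nat \<Rightarrow> (nat \<Rightarrow> nat \<Rightarrow> complex) \<Rightarrow> (nat \<Rightarrow> nat \<Rightarrow> complex fps) \<Rightarrow>
    (nat \<Rightarrow> nat \<Rightarrow> nat) \<Rightarrow> symbol fps poly" where
  "gaudin_char_poly N K A R v = char_poly (mat N N (\<lambda>(a, b). gaudin_symbol K A R v (Suc a) (Suc b)))"

lemma gaudin_char_poly_permutations:
  "(\<Sum>\<sigma> | \<sigma> permutes {1..N}. of_int (sign \<sigma>) *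
     (\<Prod>j\<in>{1..N}. (if \<sigma> j = j then [:0, 1:] else 0) - [:gaudin_symbol K A R v (\<sigma> j) j:])) =
   gaudin_char_poly N K A R v"
proof -
  have "mat N N (\<lambda>(i, j). (if Suc i = Suc j then [:0, 1:] else 0) - [:gaudin_symbol K A R v (Suc i) (Suc j):]) =
      char_poly_matrix (mat N N (\<lambda>(a, b). gaudin_symbol K A R v (Suc a) (Suc b)))"
    by (rule eq_matI) (auto simp: char_poly_matrix_def)
  then show ?thesis
    using det_shift_index[where N = N and h = "\<lambda>i j. (if i = j then [:0, 1:] else 0) - [:gaudin_symbol K A R v i j:]"]
    by (simp add: gaudin_char_poly_def char_poly_def)
qed

lemma gaudin_char_poly_monic:
  "monic (gaudin_char_poly N K A R v)" "Polynomial.degree (gaudin_char_poly N K A R v) = N"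
  using degree_monic_char_poly[of "mat N N (\<lambda>(a, b). gaudin_symbol K A R v (Suc a) (Suc b))" N]
  by (simp_all add: gaudin_char_poly_def)

lemma generated_subalgebra_mono:
  assumes D: "ring D" and T: "T \<subseteq> generated_subalgebra D S"
  shows "generated_subalgebra D T \<subseteq> generated_subalgebra D S"
proof
  fix x assume "x \<in> generated_subalgebra D T"
  then show "x \<in> generated_subalgebra D S"
    unfolding generated_subalgebra_def
  proof (induction rule: generate_ring.induct)
    case (incl x)
    then show ?case using T by (auto simp: generated_subalgebra_def intro: generate_ring.incl)
  qed (auto intro: generate_ring.intros)
qed

text \<open>The symbols whose quantization is sent into \<open>G\<close> form a subspace. It
  contains the coefficients of \<open>W\<close>, hence those of \<open>W'\<close>, and the
  substitutions \<open>g\<close> and \<open>g'\<close> do not affect such a membership.\<close>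

lemma (in normal_ordering) coefficients_transfer:
  fixes r :: "'a \<Rightarrow> 'b" and G :: "'b set"
  assumes G_0: "r 0 \<in> G" and G_1: "r 1 \<in> G"
    and G_add: "\<And>S T. r S \<in> G \<Longrightarrow> r T \<in> G \<Longrightarrow> r (S + T) \<in> G"
    and G_scale: "\<And>c T. r T \<in> G \<Longrightarrow> r (cs c * T) \<in> G"
    and W: "monic W" and G: "\<And>i n. i < Polynomial.degree W \<Longrightarrow> r (op_symbol (shift g W) i n) \<in> G"
    and iff: "\<And>V. symbol_subspace V \<Longrightarrow> coeffs_in V W \<longleftrightarrow> coeffs_in V W'"
  shows "r (op_symbol (shift g' W') i n) \<in> G"
proof -
  define V where "V = {f. r (quantize f) \<in> G}"
  have V: "symbol_subspace V"
    using G_0 G_add G_scale by (simp add: V_def symbol_subspace_def quantize_add quantize_scalar)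
  have "r (op_symbol (shift g W) i n) \<in> G" for i n
  proof (cases "i < Polynomial.degree W")
    case False
    then show ?thesis
      using coeff_shift_monic[OF W, of i g] G_0 G_1 by (simp add: op_symbol_def quantize_1)
  qed (rule G)
  then have "coeffs_in V (shift g W)"
    by (simp add: coeffs_in_def V_def op_symbol_def)
  then have "coeffs_in V (shift g' W')"
    using coeffs_in_shift_iff[OF V] iff[OF V] by blast
  then show ?thesis
    by (simp add: coeffs_in_def V_def op_symbol_def)
qed

lemma generated_subalgebra_restr:
  assumes S: "S \<subseteq> carrier (Weyl V)"
  shows "restr V 0 \<in> generated_subalgebra (Weyl V) S" "restr V 1 \<in> generated_subalgebra (Weyl V) S"
    and "restr V T \<in> generated_subalgebra (Weyl V) S \<Longrightarrow> restr V T' \<in> generated_subalgebra (Weyl V) S \<Longrightarrow>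
      restr V (T + T') \<in> generated_subalgebra (Weyl V) S"
    and "restr V T \<in> generated_subalgebra (Weyl V) S \<Longrightarrow> restr V (scalar_op c * T) \<in> generated_subalgebra (Weyl V) S"
    and "x \<in> S \<Longrightarrow> x \<in> generated_subalgebra (Weyl V) S"
proof -
  interpret W: ring "Weyl V" by (rule ring_Weyl)
  let ?G = "{c \<odot>\<^bsub>Weyl V\<^esub> \<one>\<^bsub>Weyl V\<^esub> | c. True} \<union> S"
  have G: "?G \<subseteq> carrier (Weyl V)" using S scalar_Weyl by auto
  show "restr V 0 \<in> generated_subalgebra (Weyl V) S" "restr V 1 \<in> generated_subalgebra (Weyl V) S"
    by (simp_all add: generated_subalgebra_def restr_0 restr_1 W.zero_in_generate generate_ring.one)
  show "restr V (T + T') \<in> generated_subalgebra (Weyl V) S"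
    if "restr V T \<in> generated_subalgebra (Weyl V) S" "restr V T' \<in> generated_subalgebra (Weyl V) S"
    using that by (simp add: generated_subalgebra_def restr_add generate_ring.eng_add)
  show "restr V (scalar_op c * T) \<in> generated_subalgebra (Weyl V) S"
    if T: "restr V T \<in> generated_subalgebra (Weyl V) S"
  proof -
    have "restr V T \<in> carrier (Weyl V)"
      using T W.generate_ring_in_carrier[OF G] by (simp add: generated_subalgebra_def)
    then have "restr V (scalar_op c * T) = restr V (scalar_op c * 1) \<otimes>\<^bsub>Weyl V\<^esub> restr V T"
      by (simp add: restr_mult)
    moreover have "restr V (scalar_op c * 1) \<in> generate_ring (Weyl V) ?G"
      unfolding restr_scale restr_1 by (rule generate_ring.incl) blast
    ultimately show ?thesis
      using T by (simp add: generated_subalgebra_def generate_ring.eng_mult)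
  qed
  show "x \<in> S \<Longrightarrow> x \<in> generated_subalgebra (Weyl V) S"
    unfolding generated_subalgebra_def by (rule generate_ring.incl) blast
qed

text \<open>In terms of these operators the two homomorphisms are
  \<open>e_ab t^k \<mapsto> \<Sum>r. osc_q b r * osc_p a (r + k)\<close> and \<open>E_ij t^k \<mapsto> \<Sum>\<alpha>. osc_p (\<alpha> + k) i * osc_q \<alpha> j\<close>.
  The Fourier transform in the variables \<open>y\<close> makes all \<open>osc_p a s\<close> multiplications and
  \<open>osc_q a s\<close> the corresponding derivatives.\<close>

definition osc_p :: "nat \<Rightarrow> nat \<Rightarrow> nat \<Rightarrow> var linop" where
  "osc_p p a s = (if s \<le> p then partial_op (YV a s) else var_op (XV a (s - p)))"

definition osc_q :: "nat \<Rightarrow> nat \<Rightarrow> nat \<Rightarrow> var linop" where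
  "osc_q p a s = (if s \<le> p then - var_op (YV a s) else partial_op (XV a (s - p)))"

lemma osc_commute:
  "osc_p p a s * osc_p p b r = osc_p p b r * osc_p p a s"
  "osc_q p a s * osc_q p b r = osc_q p b r * osc_q p a s"
  "osc_q p b r * osc_p p a s = osc_p p a s * osc_q p b r + (if b = a \<and> r = s then 1 else 0)"
proof -
  have *: "partial_op v * var_op u = var_op u * partial_op v" if "v \<noteq> u" for u v :: var
    using that by (simp add: partial_var_op)
  show "osc_p p a s * osc_p p b r = osc_p p b r * osc_p p a s"
    by (auto simp: osc_p_def * partial_op_commute var_op_commute)
  show "osc_q p a s * osc_q p b r = osc_q p b r * osc_q p a s"
    by (auto simp: osc_q_def * partial_op_commute var_op_commute)
  show "osc_q p b r * osc_p p a s = osc_p p a s * osc_q p b r + (if b = a \<and> r = s then 1 else 0)"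
    by (auto simp: osc_p_def osc_q_def partial_var_op partial_op_commute var_op_commute)
qed

lemma gl_rep_phi: "gl_rep scalar_op (\<lambda>a s b r. osc_q p b r * osc_p p a s)"
  by (rule gl_rep_oscillators(2)) (rule scalar_op.central_scalars_axioms osc_commute)+

text \<open>The same oscillators with their two indices in exchanged roles: a row of
  \<open>gl_d\<close> is now the position in a block, and a position becomes the row of
  \<open>gl_(m+p)\<close>.\<close>

lemma gl_rep_varphi: "gl_rep scalar_op (\<lambda>i \<beta> j \<alpha>. osc_p p \<beta> i * osc_q p \<alpha> j)"
proof (rule gl_rep_oscillators(1))
  show "osc_q p r b * osc_p p s a = osc_p p s a * osc_q p r b + (if b = a \<and> r = s then 1 else 0)" for a s b r
    using osc_commute(3)[of p r b s a] by (simp add: conj_commute)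
qed (rule scalar_op.central_scalars_axioms osc_commute)+

text \<open>Oscillators are indexed by pairs and symbols by natural numbers;
  \<open>prod_encode\<close> mediates, and its injectivity keeps the commutators apart.\<close>

lemma weyl_generators_osc:
  "weyl_generators scalar_op (\<lambda>k. case prod_decode k of (a, s) \<Rightarrow> osc_p p a s)
     (\<lambda>k. case prod_decode k of (a, s) \<Rightarrow> osc_q p a s)"
proof
  fix i j
  obtain a s b r where ij: "i = prod_encode (a, s)" "j = prod_encode (b, r)"
    by (metis prod_decode_inverse surj_pair)
  show "(case prod_decode i of (a, s) \<Rightarrow> osc_p p a s) * (case prod_decode j of (a, s) \<Rightarrow> osc_p p a s) =
      (case prod_decode j of (a, s) \<Rightarrow> osc_p p a s) * (case prod_decode i of (a, s) \<Rightarrow> osc_p p a s)"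
    "(case prod_decode i of (a, s) \<Rightarrow> osc_q p a s) * (case prod_decode j of (a, s) \<Rightarrow> osc_q p a s) =
      (case prod_decode j of (a, s) \<Rightarrow> osc_q p a s) * (case prod_decode i of (a, s) \<Rightarrow> osc_q p a s)"
    by (simp_all add: ij osc_commute(1)[of p a s] osc_commute(2)[of p a s])
  show "(case prod_decode i of (a, s) \<Rightarrow> osc_q p a s) * (case prod_decode j of (a, s) \<Rightarrow> osc_p p a s) =
      (case prod_decode j of (a, s) \<Rightarrow> osc_p p a s) * (case prod_decode i of (a, s) \<Rightarrow> osc_q p a s) +
      (if i = j then 1 else 0)"
    using osc_commute(3)[of p a s b r] by (simp add: ij)
qed

lemma osc_closed:
  assumes "a \<in> {1..d}" "s \<in> {1..p + m}"
  shows "osc_p p a s \<in> Weyl_ops (vars d p m)" "osc_q p a s \<in> Weyl_ops (vars d p m)"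
proof -
  have "YV a s \<in> vars d p m" if "s \<le> p" using assms that by (auto simp: vars_def)
  moreover have "XV a (s - p) \<in> vars d p m" if "\<not> s \<le> p" using assms that by (auto simp: vars_def)
  ultimately show "osc_p p a s \<in> Weyl_ops (vars d p m)" "osc_q p a s \<in> Weyl_ops (vars d p m)"
    by (auto simp: osc_p_def osc_q_def intro!: Weyl_ops_var Weyl_ops_partial Weyl_ops_uminus)
qed

lemma restr_mult_generators:
  assumes "v \<in> V"
  shows "restr V (T * var_op v) = restr V T \<otimes>\<^bsub>Weyl V\<^esub> mul_op V v"
    "restr V (T * partial_op v) = restr V T \<otimes>\<^bsub>Weyl V\<^esub> deriv_op V v"
  using assms by (simp_all add: restr_mult restr_var restr_partial mul_op_Weyl deriv_op_Weyl)

text \<open>The first p' blocks fill the positions up to p and concern the variables y; the others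
  lie beyond p and concern the variables x.\<close>

lemma phi_unit_eq:
  assumes p: "offset \<gamma> (Suc p') = p" and total: "offset \<gamma> (Suc (p' + m')) = p + m"
    and i: "i \<in> {1..p' + m'}" and k: "k < \<gamma> i" and a: "a \<in> {1..d}" and b: "b \<in> {1..d}"
  shows "(\<Sum>r=offset \<gamma> i + 1..offset \<gamma> (i + 1) - k. osc_q p b r * osc_p p a (r + k)) \<in> Weyl_ops (vars d p m)"
    and "phi_unit d p m p' \<gamma> i k a b = restr (vars d p m)
      (\<Sum>r=offset \<gamma> i + 1..offset \<gamma> (i + 1) - k. osc_q p b r * osc_p p a (r + k))"
proof -
  let ?V = "vars d p m" and ?R = "{offset \<gamma> i + 1..offset \<gamma> (i + 1) - k}"
  have off: "offset \<gamma> (i + 1) = offset \<gamma> i + \<gamma> i" using i by (simp add: offset_Suc)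
  have le: "offset \<gamma> (i + 1) \<le> p + m"
    unfolding total[symmetric] by (rule offset_mono) (use i in simp)
  have range: "r \<in> {1..p + m}" "r + k \<in> {1..p + m}" if "r \<in> ?R" for r
    using that le by auto
  show "(\<Sum>r\<in>?R. osc_q p b r * osc_p p a (r + k)) \<in> Weyl_ops ?V"
    by (intro Weyl_ops_sum Weyl_ops_mult osc_closed a b range)
  show "phi_unit d p m p' \<gamma> i k a b = restr ?V (\<Sum>r\<in>?R. osc_q p b r * osc_p p a (r + k))"
  proof (cases "i \<le> p'")
    case True
    then have le_p: "offset \<gamma> (i + 1) \<le> p"
      unfolding p[symmetric] by (intro offset_mono) simp
    have summand: "var_op (YV b r) * partial_op (YV a (r + k)) \<in> Weyl_ops ?V"
      "restr ?V (var_op (YV b r) * partial_op (YV a (r + k))) = mul_op ?V (YV b r) \<otimes>\<^bsub>Weyl ?V\<^esub> deriv_op ?V (YV a (r + k))"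
      if "r \<in> ?R" for r
    proof -
      have v: "YV b r \<in> ?V" "YV a (r + k) \<in> ?V"
        using that le_p a b by (auto simp: vars_def)
      show "var_op (YV b r) * partial_op (YV a (r + k)) \<in> Weyl_ops ?V"
        by (intro Weyl_ops_mult Weyl_ops_var Weyl_ops_partial v)
      show "restr ?V (var_op (YV b r) * partial_op (YV a (r + k))) = mul_op ?V (YV b r) \<otimes>\<^bsub>Weyl ?V\<^esub> deriv_op ?V (YV a (r + k))"
        by (simp add: restr_mult_generators v restr_var)
    qed
    have "(\<Sum>r\<in>?R. osc_q p b r * osc_p p a (r + k)) = - (\<Sum>r\<in>?R. var_op (YV b r) * partial_op (YV a (r + k)))"
      unfolding sum_negf[symmetric] by (rule sum.cong) (use le_p in \<open>auto simp: osc_p_def osc_q_def\<close>)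
    moreover have "(\<Oplus>\<^bsub>Weyl ?V\<^esub>r\<in>?R. mul_op ?V (YV b r) \<otimes>\<^bsub>Weyl ?V\<^esub> deriv_op ?V (YV a (r + k))) =
        restr ?V (\<Sum>r\<in>?R. var_op (YV b r) * partial_op (YV a (r + k)))"
      by (rule restr_finsum_eq) (use summand in auto)
    moreover have "(\<Sum>r\<in>?R. var_op (YV b r) * partial_op (YV a (r + k))) \<in> Weyl_ops ?V"
      by (intro Weyl_ops_sum summand)
    ultimately show ?thesis
      using True by (simp add: phi_unit_def Let_def restr_uminus)
  next
    case False
    then have ge_p: "p \<le> offset \<gamma> i"
      unfolding p[symmetric] by (intro offset_mono) simp
    \<comment> \<open>Lower indices of the x variables are positions diminished by p. By
      \<open>ge_p\<close> and k < \<open>\<gamma> i\<close> the subtraction is not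
      truncated.\<close>
    let ?R' = "{offset \<gamma> i + 1 - p..offset \<gamma> (i + 1) - k - p}"
    have summand: "partial_op (XV b r) * var_op (XV a (r + k)) \<in> Weyl_ops ?V"
      "restr ?V (partial_op (XV b r) * var_op (XV a (r + k))) = deriv_op ?V (XV b r) \<otimes>\<^bsub>Weyl ?V\<^esub> mul_op ?V (XV a (r + k))"
      if "r \<in> ?R'" for r
    proof -
      have v: "XV b r \<in> ?V" "XV a (r + k) \<in> ?V"
        using that ge_p le a b off k by (auto simp: vars_def)
      show "partial_op (XV b r) * var_op (XV a (r + k)) \<in> Weyl_ops ?V"
        by (intro Weyl_ops_mult Weyl_ops_var Weyl_ops_partial v)
      show "restr ?V (partial_op (XV b r) * var_op (XV a (r + k))) = deriv_op ?V (XV b r) \<otimes>\<^bsub>Weyl ?V\<^esub> mul_op ?V (XV a (r + k))"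
        by (simp add: restr_mult_generators v restr_partial)
    qed
    have "(\<Sum>r\<in>?R. osc_q p b r * osc_p p a (r + k)) = (\<Sum>r\<in>?R'. partial_op (XV b r) * var_op (XV a (r + k)))"
      by (rule sum.reindex_bij_witness[where i = "\<lambda>r. r + p" and j = "\<lambda>r. r - p"])
        (use ge_p off k in \<open>auto simp: osc_p_def osc_q_def\<close>)
    moreover have "(\<Oplus>\<^bsub>Weyl ?V\<^esub>r\<in>?R'. deriv_op ?V (XV b r) \<otimes>\<^bsub>Weyl ?V\<^esub> mul_op ?V (XV a (r + k))) =
        restr ?V (\<Sum>r\<in>?R'. partial_op (XV b r) * var_op (XV a (r + k)))"
      by (rule restr_finsum_eq) (use summand in auto)
    ultimately show ?thesis
      using False by (simp add: phi_unit_def Let_def)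
  qed
qed

lemma varphi_unit_eq:
  assumes total: "offset \<xi> (Suc d') = d"
    and a: "a \<in> {1..d'}" and i: "i \<in> {1..p + m}" and j: "j \<in> {1..p + m}"
  shows "(\<Sum>\<alpha>=offset \<xi> a + 1..offset \<xi> (a + 1) - k. osc_p p (\<alpha> + k) i * osc_q p \<alpha> j) \<in> Weyl_ops (vars d p m)"
    and "varphi_unit d p m \<xi> a k i j = restr (vars d p m)
      (\<Sum>\<alpha>=offset \<xi> a + 1..offset \<xi> (a + 1) - k. osc_p p (\<alpha> + k) i * osc_q p \<alpha> j)"
proof -
  let ?V = "vars d p m" and ?W = "Weyl (vars d p m)" and ?R = "{offset \<xi> a + 1..offset \<xi> (a + 1) - k}"
  interpret W: ring "Weyl ?V" by (rule ring_Weyl)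
  have le: "offset \<xi> (a + 1) \<le> d"
    unfolding total[symmetric] by (rule offset_mono) (use a in simp)
  have range: "\<alpha> \<in> {1..d}" "\<alpha> + k \<in> {1..d}" if "\<alpha> \<in> ?R" for \<alpha>
    using that le by auto
  have v: "i \<le> p \<Longrightarrow> YV \<alpha> i \<in> ?V" "\<not> i \<le> p \<Longrightarrow> XV \<alpha> (i - p) \<in> ?V" if "\<alpha> \<in> {1..d}" "i \<in> {1..p + m}" for \<alpha> i
    using that by (auto simp: vars_def)
  have closed: "osc_p p (\<alpha> + k) i * osc_q p \<alpha> j \<in> Weyl_ops ?V" if "\<alpha> \<in> ?R" for \<alpha>
    by (intro Weyl_ops_mult osc_closed range i j that)
  then show "(\<Sum>\<alpha>\<in>?R. osc_p p (\<alpha> + k) i * osc_q p \<alpha> j) \<in> Weyl_ops ?V"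
    by (rule Weyl_ops_sum)
  have pos: "(\<Oplus>\<^bsub>Weyl ?V\<^esub>\<alpha>\<in>?R. F \<alpha>) = restr ?V (\<Sum>\<alpha>\<in>?R. osc_p p (\<alpha> + k) i * osc_q p \<alpha> j)"
    if "\<And>\<alpha>. \<alpha> \<in> ?R \<Longrightarrow> F \<alpha> = restr ?V (osc_p p (\<alpha> + k) i * osc_q p \<alpha> j)" for F
    by (rule restr_finsum_eq) (use that closed in auto)
  \<comment> \<open>\<open>osc_q p \<alpha> j\<close> carries a minus sign for j \<le> p, precisely
    where \<open>varphi_unit\<close> has the sign in front of the sum.\<close>
  have neg: "\<ominus>\<^bsub>Weyl ?V\<^esub> (\<Oplus>\<^bsub>Weyl ?V\<^esub>\<alpha>\<in>?R. F \<alpha>) = restr ?V (\<Sum>\<alpha>\<in>?R. osc_p p (\<alpha> + k) i * osc_q p \<alpha> j)"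
    if "\<And>\<alpha>. \<alpha> \<in> ?R \<Longrightarrow> F \<alpha> = restr ?V (- (osc_p p (\<alpha> + k) i * osc_q p \<alpha> j))" for F
  proof -
    have "(\<Oplus>\<^bsub>Weyl ?V\<^esub>\<alpha>\<in>?R. F \<alpha>) = restr ?V (\<Sum>\<alpha>\<in>?R. - (osc_p p (\<alpha> + k) i * osc_q p \<alpha> j))"
      by (rule restr_finsum_eq) (use that closed Weyl_ops_uminus in auto)
    moreover have "(\<Sum>\<alpha>\<in>?R. - (osc_p p (\<alpha> + k) i * osc_q p \<alpha> j)) \<in> Weyl_ops ?V"
      by (intro Weyl_ops_sum Weyl_ops_uminus closed)
    ultimately show ?thesis
      using restr_uminus[of "\<Sum>\<alpha>\<in>?R. - (osc_p p (\<alpha> + k) i * osc_q p \<alpha> j)" ?V] by (simp add: sum_negf)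
  qed
  have entry: "restr ?V (osc_p p (\<alpha> + k) i * osc_q p \<alpha> j) =
      (if i \<le> p then if j \<le> p then restr ?V (- (partial_op (YV (\<alpha> + k) i) * var_op (YV \<alpha> j)))
         else deriv_op ?V (YV (\<alpha> + k) i) \<otimes>\<^bsub>?W\<^esub> deriv_op ?V (XV \<alpha> (j - p))
       else if j \<le> p then restr ?V (- (var_op (XV (\<alpha> + k) (i - p)) * var_op (YV \<alpha> j)))
         else mul_op ?V (XV (\<alpha> + k) (i - p)) \<otimes>\<^bsub>?W\<^esub> deriv_op ?V (XV \<alpha> (j - p)))"
    "j \<le> p \<Longrightarrow> restr ?V (- (osc_p p (\<alpha> + k) i * osc_q p \<alpha> j)) =
      (if i \<le> p then deriv_op ?V (YV (\<alpha> + k) i) \<otimes>\<^bsub>?W\<^esub> mul_op ?V (YV \<alpha> j)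
       else mul_op ?V (XV (\<alpha> + k) (i - p)) \<otimes>\<^bsub>?W\<^esub> mul_op ?V (YV \<alpha> j))"
    if "\<alpha> \<in> ?R" for \<alpha>
    using v[OF range(1)[OF that] j]
    by (simp_all add: osc_p_def osc_q_def restr_mult_generators restr_var restr_partial)
  show "varphi_unit d p m \<xi> a k i j = restr ?V (\<Sum>\<alpha>\<in>?R. osc_p p (\<alpha> + k) i * osc_q p \<alpha> j)"
  proof (cases "j \<le> p")
    case True
    then show ?thesis
      using neg[of "\<lambda>\<alpha>. deriv_op ?V (YV (\<alpha> + k) i) \<otimes>\<^bsub>?W\<^esub> mul_op ?V (YV \<alpha> j)"]
        neg[of "\<lambda>\<alpha>. mul_op ?V (XV (\<alpha> + k) (i - p)) \<otimes>\<^bsub>?W\<^esub> mul_op ?V (YV \<alpha> j)"] entry(2)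
      unfolding varphi_unit_def Let_def by auto
  next
    case False
    then show ?thesis
      using pos[of "\<lambda>\<alpha>. deriv_op ?V (YV (\<alpha> + k) i) \<otimes>\<^bsub>?W\<^esub> deriv_op ?V (XV \<alpha> (j - p))"]
        pos[of "\<lambda>\<alpha>. mul_op ?V (XV (\<alpha> + k) (i - p)) \<otimes>\<^bsub>?W\<^esub> deriv_op ?V (XV \<alpha> (j - p))"] entry(1)
      unfolding varphi_unit_def Let_def by auto
  qed
qed

theorem corollary4p8:
  fixes d p m d' p' m' :: nat
    and w z :: "nat \<Rightarrow> complex"
    and \<xi> \<gamma> :: "nat \<Rightarrow> nat"
  assumes "1 \<le> d" and "1 \<le> p + m"
    and "1 \<le> d'" and "d' \<le> d" and "p' \<le> p" and "m' \<le> m"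
    and "\<forall>a\<in>{1..d'}. 0 < \<xi> a" and "(\<Sum>a=1..d'. \<xi> a) = d"
    and "\<forall>i\<in>{1..p' + m'}. 0 < \<gamma> i"
    and "(\<Sum>i=1..p'. \<gamma> i) = p" and "(\<Sum>i=1..m'. \<gamma> (p' + i)) = m"
  shows "phi d p m p' m' \<gamma> ` gaudin_algebra d (jordan d' w \<xi>) (p' + m') z \<gamma> =
         varphi d p m d' \<xi> ` gaudin_algebra (p + m) (jordan (p' + m') z \<gamma>) d' w \<xi>"
proof -
  let ?L = "p' + m'" and ?N = "p + m" and ?V = "vars d p m"
  let ?A = "jordan d' w \<xi>" and ?B = "jordan ?L z \<gamma>"
  let ?RA = "jordan_resolvent w \<xi>" and ?RB = "jordan_resolvent z \<gamma>"
  \<comment> \<open>One numbering of the oscillators serves both sides; the second side uses it with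
    the arguments exchanged, as the duality requires.\<close>
  let ?v = "\<lambda>a s. prod_encode (a, s)"
  let ?W = "Weyl ?V"
  have offset_sum: "offset \<gamma> (Suc n) = (\<Sum>i=1..n. \<gamma> i)" for \<gamma> n
    by (simp add: offset_def atLeastLessThanSuc_atLeastAtMost)
  have off_\<xi>: "offset \<xi> (Suc d') = d" using assms(8) by (simp add: offset_sum)
  have off_p: "offset \<gamma> (Suc p') = p" using assms(10) by (simp add: offset_sum)
  have "{1..?L} = {1..p'} \<union> (\<lambda>i. p' + i) ` {1..m'}"
    by (auto simp: image_iff)
  then have "(\<Sum>i=1..?L. \<gamma> i) = (\<Sum>i=1..p'. \<gamma> i) + (\<Sum>i\<in>(\<lambda>i. p' + i) ` {1..m'}. \<gamma> i)"
    by (simp add: sum.union_disjoint disjoint_iff)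
  also have "(\<Sum>i\<in>(\<lambda>i. p' + i) ` {1..m'}. \<gamma> i) = (\<Sum>i=1..m'. \<gamma> (p' + i))"
    by (subst sum.reindex) (simp_all add: comp_def)
  finally have off_\<gamma>: "offset \<gamma> (Suc ?L) = ?N" using assms(10,11) by (simp add: offset_sum)

  \<comment> \<open>A strict upper bound for all codes in use: each is at most the sum of all of
    them.\<close>
  define M where "M = Suc (\<Sum>a=1..d. \<Sum>s=1..?N. ?v a s)"
  have v_less: "?v a s < M" if "a \<in> {1..d}" "s \<in> {1..?N}" for a s
  proof -
    have "?v a s \<le> (\<Sum>s=1..?N. ?v a s)"
      by (rule member_le_sum) (use that in auto)
    also have "\<dots> \<le> (\<Sum>a=1..d. \<Sum>s=1..?N. ?v a s)"
      by (rule member_le_sum[of a "{1..d}" "\<lambda>a. \<Sum>s=1..?N. ?v a s"]) (use that in auto)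
    finally show ?thesis by (simp add: M_def)
  qed
  interpret weyl_generators scalar_op "\<lambda>k. case prod_decode k of (a, s) \<Rightarrow> osc_p p a s"
      "\<lambda>k. case prod_decode k of (a, s) \<Rightarrow> osc_q p a s"
    by (rule weyl_generators_osc)
  interpret normal_ordering scalar_op "\<lambda>k. case prod_decode k of (a, s) \<Rightarrow> osc_p p a s"
      "\<lambda>k. case prod_decode k of (a, s) \<Rightarrow> osc_q p a s" M ..

  define W1 where "W1 = gaudin_char_poly d ?N ?A ?RB ?v"
  define W2 where "W2 = gaudin_char_poly ?N d ?B ?RA (\<lambda>i a. ?v a i)"
  \<comment> \<open>Bringing \<open>osc_q p b r\<close> to the right of \<open>osc_p p a s\<close>
    leaves 1 when a = b and r = s; weighted by the resolvent, these terms give its trace on the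
    diagonal of the matrix.\<close>
  define g where "g = - (\<Sum>r=1..?N. ?RB r r)"
  have res: "is_resolvent d ?A ?RA" "is_resolvent ?N ?B ?RB"
    using jordan_resolvent_equation[of _ \<xi> d' _ w] jordan_resolvent_equation[of _ \<gamma> ?L _ z]
    unfolding is_resolvent_def off_\<xi> off_\<gamma> by blast+
  have iff: "coeffs_in V W1 \<longleftrightarrow> coeffs_in V W2" if "symbol_subspace V" for V
    unfolding W1_def W2_def gaudin_char_poly_def by (rule char_poly_duality[OF that res])

  have cdet1: "op_cdet d (gaudin_series scalar_op (offset \<gamma> (Suc ?L)) ?A ?RB (\<lambda>a s b r. osc_q p b r * osc_p p a s)) i n =
      op_symbol (shift g W1) i n" for i n
    unfolding W1_def gaudin_char_poly_permutations[symmetric] off_\<gamma>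
  proof (rule op_cdet_eq)
    show "fps_dz (?RB r s) = - (\<Sum>q=1..?N. ?RB r q * ?RB q s)" if "{r, s} \<subseteq> {1..?N}" for r s
      using jordan_resolvent_dz[of r s \<gamma> ?L z] that by (simp add: off_\<gamma>)
    fix a b n
    have "(\<Sum>r=1..?N. \<Sum>s=1..?N. scalar_op (fps_nth (?RB r s) n) * (osc_q p b r * osc_p p a s)) =
        (\<Sum>r=1..?N. \<Sum>s=1..?N. scalar_op (fps_nth (?RB r s) n) * (osc_p p a s * osc_q p b r) +
          (if r = s then if a = b then scalar_op (fps_nth (?RB r s) n) else 0 else 0))"
      by (intro sum.cong refl) (auto simp: osc_commute(3) distrib_left)
    also have "\<dots> = (\<Sum>r=1..?N. \<Sum>s=1..?N. scalar_op (fps_nth (?RB r s) n) * (osc_p p a s * osc_q p b r)) +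
        (if a = b then scalar_op (\<Sum>r=1..?N. fps_nth (?RB r r) n) else 0)"
      by (simp add: sum.distrib scalar_op.cs_sum)
    finally show "gaudin_series scalar_op ?N ?A ?RB (\<lambda>a s b r. osc_q p b r * osc_p p a s) a b n =
        (if a = b then scalar_op (fps_nth g n) else 0) - (if n = 0 then scalar_op (?A a b) else 0) -
        (\<Sum>r=1..?N. \<Sum>s=1..?N. scalar_op (fps_nth (?RB r s) n) *
          ((case prod_decode (?v a s) of (a, s) \<Rightarrow> osc_p p a s) * (case prod_decode (?v b r) of (a, s) \<Rightarrow> osc_q p a s)))"
      by (simp add: gaudin_series_def g_def scalar_op.cs_minus fps_sum_nth)
  qed (use v_less in auto)
  \<comment> \<open>Here the products are normally ordered from the start, so the substitution is by
    0.\<close>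
  have cdet2: "op_cdet ?N (gaudin_series scalar_op (offset \<xi> (Suc d')) ?B ?RA (\<lambda>i \<beta> j \<alpha>. osc_p p \<beta> i * osc_q p \<alpha> j)) i n =
      op_symbol (shift 0 W2) i n" for i n
    unfolding W2_def gaudin_char_poly_permutations[symmetric] off_\<xi>
  proof (rule op_cdet_eq)
    show "fps_dz (?RA r s) = - (\<Sum>q=1..d. ?RA r q * ?RA q s)" if "{r, s} \<subseteq> {1..d}" for r s
      using jordan_resolvent_dz[of r s \<xi> d' w] that by (simp add: off_\<xi>)
  qed (use v_less in \<open>auto simp: gaudin_series_def\<close>)

  have phi: "phi d p m p' m' \<gamma> ` gaudin_algebra d ?A ?L z \<gamma> =
      generated_subalgebra ?W {restr ?V (op_symbol (shift g W1) i n) | i n. i < d}" (is "_ = ?G1")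
    and closed1: "restr ?V (op_symbol (shift g W1) i n) \<in> carrier ?W" for i n
  proof -
    note image = Weyl_takiff_image[OF gl_rep_phi[of p] assms(9), where N = d and V = ?V
        and h = "phi_unit d p m p' \<gamma>" and J = ?A and z = z,
      unfolded gl_rep.takiff_unit_image_def[OF gl_rep_phi] cdet1, OF phi_unit_eq[OF off_p off_\<gamma>]]
    show "phi d p m p' m' \<gamma> ` gaudin_algebra d ?A ?L z \<gamma> = ?G1"
      unfolding phi_def Let_def by (rule image(1))
    show "restr ?V (op_symbol (shift g W1) i n) \<in> carrier ?W" for i n
      by (rule image(2))
  qed
  have varphi: "varphi d p m d' \<xi> ` gaudin_algebra ?N ?B d' w \<xi> =
      generated_subalgebra ?W {restr ?V (op_symbol (shift 0 W2) i n) | i n. i < ?N}" (is "_ = ?G2")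
    and closed2: "restr ?V (op_symbol (shift 0 W2) i n) \<in> carrier ?W" for i n
  proof -
    note image = Weyl_takiff_image[OF gl_rep_varphi[of p] assms(7), where N = ?N and V = ?V
        and h = "varphi_unit d p m \<xi>" and J = ?B and z = w,
      unfolded gl_rep.takiff_unit_image_def[OF gl_rep_varphi] cdet2, OF varphi_unit_eq[OF off_\<xi>]]
    show "varphi d p m d' \<xi> ` gaudin_algebra ?N ?B d' w \<xi> = ?G2"
      unfolding varphi_def Let_def by (rule image(1))
    show "restr ?V (op_symbol (shift 0 W2) i n) \<in> carrier ?W" for i n
      by (rule image(2))
  qed
  \<comment> \<open>Stated for an arbitrary pair, so that each of the two inclusions is an instance,
    with W1 and W2 in either order.\<close>
  have transfer: "restr ?V (op_symbol (shift g' W') i n) \<in> generated_subalgebra ?W {restr ?V (op_symbol (shift g W) i n) | i n. i < Polynomial.degree W}"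
    if W: "monic W" and closed: "\<And>i n. restr ?V (op_symbol (shift g W) i n) \<in> carrier ?W"
      and iff: "\<And>V. symbol_subspace V \<Longrightarrow> coeffs_in V W \<longleftrightarrow> coeffs_in V W'" for g g' W W' i n
  proof -
    let ?S = "{restr ?V (op_symbol (shift g W) i n) | i n. i < Polynomial.degree W}"
    show ?thesis
      by (rule coefficients_transfer[OF _ _ _ _ W _ iff])
        (use closed in \<open>auto intro: generated_subalgebra_restr\<close>)
  qed
  have "?G2 \<subseteq> ?G1"
    using transfer[of W1 g W2 0] gaudin_char_poly_monic[of d ?N ?A ?RB ?v] closed1 iff
    by (intro generated_subalgebra_mono ring_Weyl) (auto simp: W1_def[symmetric])
  moreover have "?G1 \<subseteq> ?G2"
    using transfer[of W2 0 W1 g] gaudin_char_poly_monic[of ?N d ?B ?RA "\<lambda>i a. ?v a i"] closed2 iff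
    by (intro generated_subalgebra_mono ring_Weyl) (auto simp: W2_def[symmetric])
  ultimately show ?thesis unfolding phi varphi by (rule equalityI[rotated])
qed

end
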